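(* Let $X$ be a closed orientable surface $S$ of genus at least two equipped with a hyperbolic metric. Every geodesic current $\mu\in\mathbb{R}\mathrm{Teich}^\infty(S)$ is strongly hyperbolic.
   Context: $\widetilde X$ is the universal cover of $X$. $\mathcal G(\widetilde X)\cong (S^1\times S^1-\Delta)/\mathbb Z_2$ is the space of unparametrized, unoriented bi-infinite geodesics of $\widetilde X$. A geodesic current on $X$ is a locally finite, positive, $\pi_1(X)$-invariant Borel measure on $\mathcal G(\widetilde X)$; $\mathcal C(X)$ (also $\mathcal C(S)$) is the space of geodesic currents with the weak$^*$ topology. Dual pseudometric: for $\mu\in\mathcal C(X)$ and $x,y\in\widetilde X$, $d_\mu(x,y)=\frac12\mu(G[x,y))+\frac12\mu(G(x,y])$, where for a geodesic segment $I$, $G(I)$ is the set of bi-infinite geodesics of $\widetilde X$ intersecting $I$ transversely. A (pseudo)metric space $(M,d)$ is $\epsilon$-strongly hyperbolic ($\epsilon>0$) if for all $x,y,z,w\in M$: $e^{\frac{\epsilon}{2}(d(x,z)+d(y,w))}\le e^{\frac{\epsilon}{2}(d(x,y)+d(z,w))}+e^{\frac{\epsilon}{2}(d(x,w)+d(y,z))}$; it is strongly hyperbolic if this holds for some $\epsilon>0$. A geodesic current $\mu$ is strongly hyperbolic if $(\widetilde X,d_\mu)$ is strongly hyperbolic. Let $Y\to X$ be a finite cover of degree $n$, so that $\pi_1(Y)\le\pi_1(X)$ has index $n$ and $\widetilde Y=\widetilde X$; $\mathcal C(Y)$ is the space of $\pi_1(Y)$-invariant locally finite positive Borel measures on $\mathcal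 G(\widetilde X)$. The transfer map $\Pi_Y:\mathcal C(Y)\to\mathcal C(X)$ is $\Pi_Y(\mu)=\frac1n\sum_{i=1}^n (g_i)_*\mu$, where $g_1,\dots,g_n\in\pi_1(X)$ is a transversal, i.e. $\pi_1(X)=\bigsqcup_i g_i\pi_1(Y)$. For a marked hyperbolic surface $Z=[(Z,f)]\in\mathrm{Teich}(Y)$, $f:Y\to Z$, with equivariant lift $\widetilde f$ (extended to the boundary at infinity), the hyperbolic Liouville current $\mathcal L_Z\in\mathcal C(Y)$ is $\mathcal L_Z=(\widetilde f^{-1})_*L_Z$, where $L_Z$ is the Liouville measure on $\mathcal G(\widetilde Z)$, determined by $L_Z([a,b]\times[c,d])=\left|\log\left|\frac{(a-c)(b-d)}{(a-d)(b-c)}\right|\right|$ for disjoint boundary intervals $[a,b],[c,d]$ of $\partial\widetilde Z\cong\mathbb R\cup\{\infty\}$. $\mathbb{R}\mathrm{Teich}^\infty(S)$ is the set of all currents $\Pi_Y\left(\sum_{i=1}^k\lambda_i\mathcal L_{Y_i}\right)\in\mathcal C(X)$ where $Y\to X$ is a finite cover, $k\in\mathbb N$, $\lambda_i\ge0$ and $Y_i\in\mathrm{Teich}(Y)$. *)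

theory Defs
  imports
    "HOL-Analysis.Analysis"
    "HOL-Algebra.Coset"
    "HOL-Algebra.Bij"
    "HOL-Complex_Analysis.Riemann_Mapping"
    "HOL-Library.Uprod"
begin

text \<open>The universal cover of a hyperbolic surface is the Poincare disc \<^term>\<open>ball (0::complex) 1\<close>
  and its boundary at infinity is the unit circle \<^term>\<open>sphere (0::complex) 1\<close>.\<close>

definition hdist :: "complex \<Rightarrow> complex \<Rightarrow> real" where
  "hdist z w = 2 * artanh (cmod (Moebius_function 0 w z))"

definition hsegment :: "complex \<Rightarrow> complex \<Rightarrow> complex set" where
  "hsegment x y = {z \<in> ball 0 1. hdist x z + hdist z y = hdist x y}"

definition geodesic_line :: "(real \<Rightarrow> complex) \<Rightarrow> bool" where
  "geodesic_line \<gamma> \<longleftrightarrow> range \<gamma> \<subseteq> ball 0 1 \<and> (\<forall>s t. hdist (\<gamma> s) (\<gamma> t) = \<bar>s - t\<bar>)"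

text \<open>A bi-infinite geodesic, without parametrization and orientation, is recorded by its unordered
  pair of distinct endpoints on the circle.\<close>

definition endpoint_pairs :: "(complex \<times> complex) set" where
  "endpoint_pairs = {(a, b). a \<in> sphere 0 1 \<and> b \<in> sphere 0 1 \<and> a \<noteq> b}"

definition geodesics :: "complex uprod set" where
  "geodesics = (\<lambda>(a, b). Upair a b) ` endpoint_pairs"

definition geodesic_points :: "complex uprod \<Rightarrow> complex set" where
  "geodesic_points e = {z. \<exists>\<gamma> a b. geodesic_line \<gamma> \<and> (\<gamma> \<longlongrightarrow> a) at_bot \<and> (\<gamma> \<longlongrightarrow> b) at_top \<and>
     e = Upair a b \<and> z \<in> range \<gamma>}"

definition geodesic_topology :: "complex uprod topology" where
  "geodesic_topology = topology (\<lambda>U. U \<subseteq> geodesics \<and>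
     openin (top_of_set endpoint_pairs) {p \<in> endpoint_pairs. (\<lambda>(a, b). Upair a b) p \<in> U})"

lemma openin_geodesic_topology:
  "openin geodesic_topology U \<longleftrightarrow> U \<subseteq> geodesics \<and>
     openin (top_of_set endpoint_pairs) {p \<in> endpoint_pairs. (\<lambda>(a, b). Upair a b) p \<in> U}"
proof -
  let ?f = "\<lambda>(a, b). Upair a b"
  let ?P = "\<lambda>U. U \<subseteq> geodesics \<and> openin (top_of_set endpoint_pairs) {p \<in> endpoint_pairs. ?f p \<in> U}"
  have inter: "?P (S \<inter> T)" if "?P S" "?P T" for S T
  proof -
    have "{p \<in> endpoint_pairs. ?f p \<in> S \<inter> T} =
        {p \<in> endpoint_pairs. ?f p \<in> S} \<inter> {p \<in> endpoint_pairs. ?f p \<in> T}"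
      by auto
    with that show ?thesis
      by (simp only: openin_Int) blast
  qed
  have union: "?P (\<Union>K)" if "\<forall>S\<in>K. ?P S" for K
  proof -
    have "{p \<in> endpoint_pairs. ?f p \<in> \<Union>K} = (\<Union>S\<in>K. {p \<in> endpoint_pairs. ?f p \<in> S})"
      by auto
    moreover have "openin (top_of_set endpoint_pairs) (\<Union>S\<in>K. {p \<in> endpoint_pairs. ?f p \<in> S})"
      using that by (intro openin_Union) blast
    ultimately show ?thesis
      using that by (simp only:) blast
  qed
  have "istopology ?P"
    unfolding istopology_def using inter union by blast
  then show ?thesis
    unfolding geodesic_topology_def by (simp only: topology_inverse')
qed

lemma topspace_geodesic_topology: "topspace geodesic_topology = geodesics"
proof -
  have "{p \<in> endpoint_pairs. (\<lambda>(a, b). Upair a b) p \<in> geodesics} = endpoint_pairs"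
    by (auto simp: geodesics_def)
  then have "openin geodesic_topology geodesics"
    unfolding openin_geodesic_topology by simp
  then show ?thesis
    using openin_geodesic_topology openin_subset openin_topspace by blast
qed

lemma quotient_map_geodesic_topology:
  "quotient_map (top_of_set endpoint_pairs) geodesic_topology (\<lambda>(a, b). Upair a b)"
  unfolding quotient_map_def topspace_geodesic_topology openin_geodesic_topology
  by (simp add: geodesics_def)

definition geodesic_borel :: "complex uprod measure" where
  "geodesic_borel = sigma geodesics {U. openin geodesic_topology U}"

text \<open>Isometries are taken together with their action on the circle at infinity, as extensional
  functions on the closed disc; in particular they lie in the carrier of
  \<^term>\<open>BijGroup (cball (0::complex) 1)\<close>.\<close>

abbreviation Disc_Group :: "(complex \<Rightarrow> complex) monoid" where
  "Disc_Group \<equiv> BijGroup (cball 0 1)"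

definition disc_isometries :: "(complex \<Rightarrow> complex) set" where
  "disc_isometries = {restrict (Moebius_function t w) (cball 0 1) | t w. w \<in> ball 0 1}"

text \<open>A closed oriented hyperbolic surface is presented by its group of deck transformations.
  Its genus is at least two by Gauss-Bonnet.\<close>

definition closed_surface_group :: "(complex \<Rightarrow> complex) set \<Rightarrow> bool" where
  "closed_surface_group \<Gamma> \<longleftrightarrow> subgroup \<Gamma> Disc_Group \<and> \<Gamma> \<subseteq> disc_isometries \<and>
     (\<forall>g\<in>\<Gamma>. \<forall>z\<in>ball 0 1. g z = z \<longrightarrow> g = \<one>\<^bsub>Disc_Group\<^esub>) \<and>
     (\<forall>K. compact K \<and> K \<subseteq> ball 0 1 \<longrightarrow> finite {g \<in> \<Gamma>. g ` K \<inter> K \<noteq> {}}) \<and>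
     (\<exists>K. compact K \<and> K \<subseteq> ball 0 1 \<and> (\<Union>g\<in>\<Gamma>. g ` K) = ball 0 1)"

definition geodesic_currents :: "(complex \<Rightarrow> complex) set \<Rightarrow> complex uprod measure set" where
  "geodesic_currents \<Gamma> = {\<mu>. space \<mu> = geodesics \<and> sets \<mu> = sets geodesic_borel \<and>
     (\<forall>e\<in>geodesics. \<exists>U. openin geodesic_topology U \<and> e \<in> U \<and> emeasure \<mu> U < \<infinity>) \<and>
     (\<forall>g\<in>\<Gamma>. distr \<mu> geodesic_borel (map_uprod g) = \<mu>)}"

definition crossing :: "complex set \<Rightarrow> complex uprod set" where
  "crossing I = {e \<in> geodesics. geodesic_points e \<inter> I \<noteq> {} \<and> \<not> I \<subseteq> geodesic_points e}"

text \<open>The sets measured below are relatively compact in the space of geodesics, so that the real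
  valued \<^const>\<open>measure\<close> loses nothing for a locally finite measure. For \<open>x = y\<close> the half-open
  segments are empty.\<close>

definition dual_dist :: "complex uprod measure \<Rightarrow> complex \<Rightarrow> complex \<Rightarrow> real" where
  "dual_dist \<mu> x y = 1/2 * measure \<mu> (crossing (hsegment x y - {y}))
                   + 1/2 * measure \<mu> (crossing (hsegment x y - {x}))"

definition pseudometric_on :: "'a set \<Rightarrow> ('a \<Rightarrow> 'a \<Rightarrow> real) \<Rightarrow> bool" where
  "pseudometric_on M d \<longleftrightarrow>
     (\<forall>x\<in>M. d x x = 0) \<and> (\<forall>x\<in>M. \<forall>y\<in>M. 0 \<le> d x y \<and> d x y = d y x) \<and>
     (\<forall>x\<in>M. \<forall>y\<in>M. \<forall>z\<in>M. d x z \<le> d x y + d y z)"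

definition strongly_hyperbolic_with :: "real \<Rightarrow> 'a set \<Rightarrow> ('a \<Rightarrow> 'a \<Rightarrow> real) \<Rightarrow> bool" where
  "strongly_hyperbolic_with \<epsilon> M d \<longleftrightarrow> pseudometric_on M d \<and>
     (\<forall>x\<in>M. \<forall>y\<in>M. \<forall>z\<in>M. \<forall>w\<in>M.
        exp (\<epsilon> / 2 * (d x z + d y w))
          \<le> exp (\<epsilon> / 2 * (d x y + d z w)) + exp (\<epsilon> / 2 * (d x w + d y z)))"

definition strongly_hyperbolic :: "'a set \<Rightarrow> ('a \<Rightarrow> 'a \<Rightarrow> real) \<Rightarrow> bool" where
  "strongly_hyperbolic M d \<longleftrightarrow> (\<exists>\<epsilon>>0. strongly_hyperbolic_with \<epsilon> M d)"

definition strongly_hyperbolic_current :: "complex uprod measure \<Rightarrow> bool" where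
  "strongly_hyperbolic_current \<mu> \<longleftrightarrow> strongly_hyperbolic (ball 0 1) (dual_dist \<mu>)"

text \<open>The box formula has the same shape on the circle as on the real projective line, since the
  Cayley transform preserves cross-ratios. The parameters run through all pairs of disjoint closed
  arcs, given counterclockwise by their angles. The boxes determine the measure uniquely.\<close>

definition is_liouville_measure :: "complex uprod measure \<Rightarrow> bool" where
  "is_liouville_measure L \<longleftrightarrow> space L = geodesics \<and> sets L = sets geodesic_borel \<and>
     (\<forall>\<alpha> \<beta> \<gamma> \<delta>. \<alpha> \<le> \<beta> \<and> \<beta> < \<gamma> \<and> \<gamma> \<le> \<delta> \<and> \<delta> < \<alpha> + 2 * pi \<longrightarrow>
        (let a = cis \<alpha>; b = cis \<beta>; c = cis \<gamma>; d = cis \<delta> in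
         emeasure L {Upair p q | p q. p \<in> cis ` {\<alpha>..\<beta>} \<and> q \<in> cis ` {\<gamma>..\<delta>}}
           = ennreal \<bar>ln (cmod (((a - c) * (b - d)) / ((a - d) * (b - c))))\<bar>))"

text \<open>A point of Teichmueller space of the surface with group \<open>H\<close> is represented by a lift \<open>F\<close> of the
  marking, extended to the closed disc; the group of the marked surface is then the conjugate of \<open>H\<close>
  by \<open>F\<close>. The marking may reverse orientation, which does not change the set of Liouville currents:
  replace the marked surface by its mirror image.\<close>

definition marked_surfaces :: "(complex \<Rightarrow> complex) set \<Rightarrow> (complex \<Rightarrow> complex) set" where
  "marked_surfaces H = {F \<in> carrier Disc_Group. F ` ball 0 1 = ball 0 1 \<and>
     homeomorphism (cball 0 1) (cball 0 1) F (inv\<^bsub>Disc_Group\<^esub> F) \<and>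
     closed_surface_group ((\<lambda>h. F \<otimes>\<^bsub>Disc_Group\<^esub> h \<otimes>\<^bsub>Disc_Group\<^esub> inv\<^bsub>Disc_Group\<^esub> F) ` H)}"

definition pullback_measure ::
    "complex uprod measure \<Rightarrow> (complex \<Rightarrow> complex) \<Rightarrow> complex uprod measure" where
  "pullback_measure L F = distr L geodesic_borel (map_uprod (inv\<^bsub>Disc_Group\<^esub> F))"

definition combination ::
    "'i set \<Rightarrow> ('i \<Rightarrow> real) \<Rightarrow> ('i \<Rightarrow> complex uprod measure) \<Rightarrow> complex uprod measure" where
  "combination I c M = measure_of geodesics (sets geodesic_borel)
     (\<lambda>A. \<Sum>i\<in>I. ennreal (c i) * emeasure (M i) A)"

definition is_transversal ::
    "(complex \<Rightarrow> complex) set \<Rightarrow> (complex \<Rightarrow> complex) set \<Rightarrow> (complex \<Rightarrow> complex) set \<Rightarrow> bool" where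
  "is_transversal \<Gamma> H T \<longleftrightarrow> finite T \<and> T \<subseteq> \<Gamma> \<and> (\<forall>g\<in>\<Gamma>. \<exists>!t. t \<in> T \<and> g \<in> t <#\<^bsub>Disc_Group\<^esub> H)"

text \<open>On measures invariant under \<open>H\<close> the result does not depend on the transversal \<open>T\<close>.\<close>

definition transfer_map ::
    "(complex \<Rightarrow> complex) set \<Rightarrow> complex uprod measure \<Rightarrow> complex uprod measure" where
  "transfer_map T \<mu> =
     combination T (\<lambda>_. 1 / real (card T)) (\<lambda>g. distr \<mu> geodesic_borel (map_uprod g))"

text \<open>Finite covers of the surface with group \<open>\<Gamma>\<close> correspond to the finite index subgroups \<open>H\<close>.\<close>

definition RTeich_inf :: "(complex \<Rightarrow> complex) set \<Rightarrow> complex uprod measure set" where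
  "RTeich_inf \<Gamma> = {transfer_map T (combination {..<k} c (\<lambda>i. pullback_measure L (F i))) |
      H T L (k::nat) c F.
      subgroup H Disc_Group \<and> H \<subseteq> \<Gamma> \<and> is_transversal \<Gamma> H T \<and> is_liouville_measure L \<and>
      (\<forall>i<k. 0 \<le> c i \<and> F i \<in> marked_surfaces H)}"

end

(* A current is strongly hyperbolic as soon as, for every cyclically ordered quadruple of points at
   infinity, the masses A, B of its two opposite boxes satisfy exp (-eps A) + exp (-eps B) >= 1: the
   lines through opposite vertices of four points in the disc end in such a quadruple, and their
   distances exceed the required bound by at most twice the mass of a box. For a single Liouville
   current and eps = 1 equality holds by Ptolemy's theorem. For a positive combination one needs
   that a box that is long for one current is long for all of them. By cocompactness a marking
   distorts the cross-ratio of boxes of cross-ratio 1/2 by a bounded amount only, and cutting an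
   arbitrary box into such pieces gives a Hoelder comparison of cross-ratios, which suffices for a
   small eps. Geodesics and segments are straight in the Klein model of the disc. *)

theory Submission
  imports Defs
begin

text \<open>Why a power of the cross-ratio is enough: let the base cross-ratio of the longer box lie
  between \<open>(1/2)^(n+1)\<close> and \<open>(1/2)^n\<close>. Every current in the combination
  then sees this box with cross-ratio at least \<open>\<kappa>^(n+1)\<close>, and the opposite box
  with cross-ratio at least \<open>1 - (1-\<kappa>)^n\<close>. Raised to a small power, the first
  bound decays more slowly in \<open>n\<close> than the defect \<open>(1-\<kappa>)^n\<close> of the
  second, so the two powers add up to at least 1. All markings are compared with the circle of the
  base surface rather than with each other; the elements of the transversal are isometries and do
  not change this reference.

  The obstacle in the four-point step is that a current may charge geodesics through the given
  points. The two half-open segments of the dual pseudometric make each geodesic contribute half the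
  jump of a sign, and prolonging segments up to the circle turns weak separation into strict
  separation. Upper bounds for the masses of open boxes therefore suffice.\<close>

subsection \<open>Four points on the circle\<close>

text \<open>Twice the signed area of the triangle \<open>a, b, v\<close>, positive if
  \<open>v\<close> lies to the left of the line from \<open>a\<close> to \<open>b\<close>. It is
  affine in \<open>v\<close>, so the same function serves points of the circle and points of the
  Klein disc.\<close>

definition side :: "complex \<Rightarrow> complex \<Rightarrow> complex \<Rightarrow> real" where
  "side a b v = Im (cnj (b - a) * (v - a))"

lemma side_swap: "side b a v = - side a b v"
  by (simp add: side_def algebra_simps)

lemma side_self [simp]: "side a a v = 0" "side a b a = 0" "side a b b = 0"
  by (simp_all add: side_def algebra_simps)

lemma side_affine: "side a b ((1 - t) *\<^sub>R x + t *\<^sub>R y) = (1 - t) * side a b x + t * side a b y"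
  by (simp add: side_def algebra_simps)

lemma continuous_side [continuous_intros]:
  assumes "continuous_on A f" "continuous_on A g" "continuous_on A h"
  shows "continuous_on A (\<lambda>x. side (f x) (g x) (h x))"
  unfolding side_def by (intro continuous_intros assms)

text \<open>Sum-to-product formulas factor the cross product into sines of half angles. Each sine is
  positive for a gap between 0 and \<open>2 * pi\<close>, so orientation reduces to the order of the
  angles.\<close>

lemma side_cis:
  "side (cis \<alpha>) (cis \<beta>) (cis \<theta>) =
     4 * sin ((\<beta> - \<alpha>) / 2) * sin ((\<theta> - \<alpha>) / 2) * sin ((\<theta> - \<beta>) / 2)"
proof -
  have c: "cos u - cos \<alpha> = - 2 * sin ((u + \<alpha>) / 2) * sin ((u - \<alpha>) / 2)" for u
    using sin_minus[of "(u - \<alpha>) / 2"] by (simp add: cos_diff_cos minus_divide_left)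
  have "(\<theta> - \<beta>) / 2 = (\<theta> + \<alpha>) / 2 - (\<beta> + \<alpha>) / 2"
    by (simp add: field_simps)
  then have s: "sin ((\<theta> - \<beta>) / 2) = sin ((\<theta> + \<alpha>) / 2) * cos ((\<beta> + \<alpha>) / 2) - cos ((\<theta> + \<alpha>) / 2) * sin ((\<beta> + \<alpha>) / 2)"
    by (simp only: sin_diff)
  have "side (cis \<alpha>) (cis \<beta>) (cis \<theta>) =
      (cos \<beta> - cos \<alpha>) * (sin \<theta> - sin \<alpha>) - (sin \<beta> - sin \<alpha>) * (cos \<theta> - cos \<alpha>)"
    by (simp add: side_def algebra_simps)
  then show ?thesis
    unfolding c sin_diff_sin s by (simp add: algebra_simps)
qed

lemma cmod_cis_diff: "cmod (cis \<alpha> - cis \<beta>) = 2 * \<bar>sin ((\<alpha> - \<beta>) / 2)\<bar>"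
proof -
  have "(cmod (cis \<alpha> - cis \<beta>))\<^sup>2 = (cos \<alpha> - cos \<beta>)\<^sup>2 + (sin \<alpha> - sin \<beta>)\<^sup>2"
    by (simp add: cmod_power2)
  also have "\<dots> = 4 * ((sin ((\<alpha> - \<beta>) / 2))\<^sup>2 * (sin ((\<alpha> + \<beta>) / 2))\<^sup>2) +
      4 * ((sin ((\<alpha> - \<beta>) / 2))\<^sup>2 * (cos ((\<alpha> + \<beta>) / 2))\<^sup>2)"
    using sin_minus[of "(\<alpha> - \<beta>) / 2"] unfolding cos_diff_cos sin_diff_sin
    by (simp add: minus_divide_left power_mult_distrib mult_ac)
  also have "\<dots> = (2 * \<bar>sin ((\<alpha> - \<beta>) / 2)\<bar>)\<^sup>2"
    by (simp add: power_mult_distrib flip: distrib_left)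
  finally have "(cmod (cis \<alpha> - cis \<beta>))\<^sup>2 = (2 * \<bar>sin ((\<alpha> - \<beta>) / 2)\<bar>)\<^sup>2" .
  then show ?thesis
    by (rule power2_eq_imp_eq) auto
qed

lemma cis_diff_pos: "\<alpha> < \<beta> \<Longrightarrow> \<beta> < \<alpha> + 2 * pi \<Longrightarrow> cmod (cis \<beta> - cis \<alpha>) = 2 * sin ((\<beta> - \<alpha>) / 2)"
  using sin_gt_zero[of "(\<beta> - \<alpha>) / 2"] by (simp add: cmod_cis_diff)

lemma sin_half_pos: "\<alpha> < \<beta> \<Longrightarrow> \<beta> < \<alpha> + 2 * pi \<Longrightarrow> 0 < sin ((\<beta> - \<alpha>) / 2)"
  by (rule sin_gt_zero) auto

lemma cis_neq: "\<alpha> < \<beta> \<Longrightarrow> \<beta> < \<alpha> + 2 * pi \<Longrightarrow> cis \<alpha> \<noteq> cis \<beta>"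
  using cis_diff_pos[of \<alpha> \<beta>] sin_half_pos[of \<alpha> \<beta>] by fastforce

lemma side_cis_neg:
  assumes "\<alpha> < \<theta>" "\<theta> < \<beta>" "\<beta> < \<alpha> + 2 * pi"
  shows "side (cis \<alpha>) (cis \<beta>) (cis \<theta>) < 0"
proof -
  have "0 < sin ((\<beta> - \<alpha>) / 2) * sin ((\<theta> - \<alpha>) / 2) * sin ((\<beta> - \<theta>) / 2)"
    by (intro mult_pos_pos sin_half_pos) (use assms in auto)
  moreover have "sin ((\<theta> - \<beta>) / 2) = - sin ((\<beta> - \<theta>) / 2)"
    using sin_minus[of "(\<beta> - \<theta>) / 2"] by (simp add: minus_divide_left)
  ultimately show ?thesis by (simp add: side_cis ac_simps)
qed

lemma side_cis_pos:
  assumes "\<alpha> < \<beta>" "\<beta> < \<theta>" "\<theta> < \<alpha> + 2 * pi"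
  shows "0 < side (cis \<alpha>) (cis \<beta>) (cis \<theta>)"
  unfolding side_cis by (intro mult_pos_pos sin_half_pos) (use assms in auto)

definition ccw :: "complex \<Rightarrow> complex \<Rightarrow> complex \<Rightarrow> complex \<Rightarrow> bool" where
  "ccw p q r s \<longleftrightarrow> (\<exists>\<alpha> \<beta> \<gamma> \<delta>. \<alpha> < \<beta> \<and> \<beta> < \<gamma> \<and> \<gamma> < \<delta> \<and> \<delta> < \<alpha> + 2 * pi \<and>
     p = cis \<alpha> \<and> q = cis \<beta> \<and> r = cis \<gamma> \<and> s = cis \<delta>)"

definition cyclic4 :: "complex \<Rightarrow> complex \<Rightarrow> complex \<Rightarrow> complex \<Rightarrow> bool" where
  "cyclic4 p q r s \<longleftrightarrow> ccw p q r s \<or> ccw s r q p"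

lemma cis_add_2pi [simp]: "cis (\<alpha> + 2 * pi) = cis \<alpha>" "cis (\<alpha> + pi * 2) = cis \<alpha>"
  by (simp_all flip: cis_mult add: mult.commute[of pi])

lemma ccwI:
  "\<alpha> < \<beta> \<Longrightarrow> \<beta> < \<gamma> \<Longrightarrow> \<gamma> < \<delta> \<Longrightarrow> \<delta> < \<alpha> + 2 * pi \<Longrightarrow> ccw (cis \<alpha>) (cis \<beta>) (cis \<gamma>) (cis \<delta>)"
  unfolding ccw_def by blast

lemma ccw_rotate:
  assumes "ccw p q r s" shows "ccw q r s p"
proof -
  obtain \<alpha> \<beta> \<gamma> \<delta> where "\<alpha> < \<beta>" "\<beta> < \<gamma>" "\<gamma> < \<delta>" "\<delta> < \<alpha> + 2 * pi"
    "p = cis \<alpha>" "q = cis \<beta>" "r = cis \<gamma>" "s = cis \<delta>"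
    using assms unfolding ccw_def by blast
  then show ?thesis
    using ccwI[of \<beta> \<gamma> \<delta> "\<alpha> + 2 * pi"] by simp
qed

lemma cyclic4_rotate: "cyclic4 p q r s \<Longrightarrow> cyclic4 q r s p"
  unfolding cyclic4_def by (metis ccw_rotate)

lemma sphere_cis_ge:
  assumes "p \<in> sphere 0 1"
  obtains \<theta> where "\<alpha> \<le> \<theta>" "\<theta> < \<alpha> + 2 * pi" "p = cis \<theta>"
proof -
  define t where "t = Arg2pi (p / cis \<alpha>)"
  have "p / cis \<alpha> = cis t"
    using Arg2pi_eq[of "p / cis \<alpha>"] assms by (simp add: t_def cis_conv_exp norm_divide mult.commute)
  moreover have "p = cis \<alpha> * (p / cis \<alpha>)" by simp
  ultimately have "p = cis (\<alpha> + t)" by (simp only: cis_mult)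
  moreover have "0 \<le> t" "t < 2 * pi"
    unfolding t_def by (rule Arg2pi_ge_0 Arg2pi_lt_2pi)+
  ultimately show thesis
    by (intro that[of "\<alpha> + t"]) simp_all
qed

text \<open>With the angle of \<open>p\<close> as base point the other three angles have six
  possible orders, and reversal identifies these in pairs.\<close>

lemma cyclic4_trichotomy:
  assumes "p \<in> sphere 0 1" "q \<in> sphere 0 1" "r \<in> sphere 0 1" "s \<in> sphere 0 1" "distinct [p, q, r, s]"
  shows "cyclic4 p q r s \<or> cyclic4 p q s r \<or> cyclic4 p r q s"
proof -
  obtain \<alpha> where \<alpha>: "p = cis \<alpha>" using sphere_cis_ge[OF assms(1)] by metis
  obtain \<beta> where \<beta>: "\<alpha> \<le> \<beta>" "\<beta> < \<alpha> + 2 * pi" "q = cis \<beta>" using sphere_cis_ge[OF assms(2)] by metis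
  obtain \<gamma> where \<gamma>: "\<alpha> \<le> \<gamma>" "\<gamma> < \<alpha> + 2 * pi" "r = cis \<gamma>" using sphere_cis_ge[OF assms(3)] by metis
  obtain \<delta> where \<delta>: "\<alpha> \<le> \<delta>" "\<delta> < \<alpha> + 2 * pi" "s = cis \<delta>" using sphere_cis_ge[OF assms(4)] by metis
  have ne: "\<alpha> \<noteq> \<beta>" "\<alpha> \<noteq> \<gamma>" "\<alpha> \<noteq> \<delta>" "\<beta> \<noteq> \<gamma>" "\<beta> \<noteq> \<delta>" "\<gamma> \<noteq> \<delta>"
    using assms(5) \<alpha> \<beta> \<gamma> \<delta> by auto
  have pos: "\<alpha> < \<beta>" "\<alpha> < \<gamma>" "\<alpha> < \<delta>"
    using ne \<beta> \<gamma> \<delta> by auto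
  have *: "ccw p x y z" if "x = cis \<xi>" "y = cis \<eta>" "z = cis \<zeta>" "\<alpha> < \<xi>" "\<xi> < \<eta>" "\<eta> < \<zeta>" "\<zeta> < \<alpha> + 2 * pi"
    for x y z \<xi> \<eta> \<zeta>
    using that ccwI[of \<alpha> \<xi> \<eta> \<zeta>] \<alpha> by simp
  have "\<beta> < \<gamma> \<and> \<gamma> < \<delta> \<or> \<beta> < \<delta> \<and> \<delta> < \<gamma> \<or> \<gamma> < \<beta> \<and> \<beta> < \<delta> \<or> \<gamma> < \<delta> \<and> \<delta> < \<beta> \<or> \<delta> < \<beta> \<and> \<beta> < \<gamma> \<or> \<delta> < \<gamma> \<and> \<gamma> < \<beta>"
    using ne by (auto simp: neq_iff)
  then have "ccw p q r s \<or> ccw p q s r \<or> ccw p r q s \<or> ccw p r s q \<or> ccw p s q r \<or> ccw p s r q"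
    using *[OF \<beta>(3) \<gamma>(3) \<delta>(3)] *[OF \<beta>(3) \<delta>(3) \<gamma>(3)] *[OF \<gamma>(3) \<beta>(3) \<delta>(3)] *[OF \<gamma>(3) \<delta>(3) \<beta>(3)]
      *[OF \<delta>(3) \<beta>(3) \<gamma>(3)] *[OF \<delta>(3) \<gamma>(3) \<beta>(3)] pos \<beta>(2) \<gamma>(2) \<delta>(2) by blast
  then show ?thesis
    unfolding cyclic4_def by (metis ccw_rotate)
qed

lemma ccw_side:
  assumes "ccw p q r s"
  shows "side p r q * side p r s < 0" "0 < side p q r * side p q s" "0 < side p s q * side p s r"
proof -
  obtain \<alpha> \<beta> \<gamma> \<delta> where *: "\<alpha> < \<beta>" "\<beta> < \<gamma>" "\<gamma> < \<delta>" "\<delta> < \<alpha> + 2 * pi"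
    and eq: "p = cis \<alpha>" "q = cis \<beta>" "r = cis \<gamma>" "s = cis \<delta>"
    using assms unfolding ccw_def by blast
  show "side p r q * side p r s < 0"
    unfolding eq by (intro mult_neg_pos side_cis_neg side_cis_pos) (use * in auto)
  show "0 < side p q r * side p q s"
    unfolding eq by (intro mult_pos_pos side_cis_neg side_cis_pos) (use * in auto)
  show "0 < side p s q * side p s r"
    unfolding eq by (intro mult_neg_neg side_cis_neg side_cis_pos) (use * in auto)
qed

lemma ccw_sphere:
  assumes "ccw p q r s"
  shows "p \<in> sphere 0 1" "q \<in> sphere 0 1" "r \<in> sphere 0 1" "s \<in> sphere 0 1"
  using assms unfolding ccw_def by auto

lemma cyclic4_sphere:
  assumes "cyclic4 p q r s"
  shows "p \<in> sphere 0 1" "q \<in> sphere 0 1" "r \<in> sphere 0 1" "s \<in> sphere 0 1"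
  using assms ccw_sphere unfolding cyclic4_def by blast+

text \<open>Of the three possible arrangements only this one puts \<open>q\<close> and
  \<open>s\<close> on different sides of the chord from \<open>p\<close> to \<open>r\<close>.
  Products of signs are what circle homeomorphisms are later shown to respect.\<close>

lemma cyclic4_iff_side:
  assumes "p \<in> sphere 0 1" "q \<in> sphere 0 1" "r \<in> sphere 0 1" "s \<in> sphere 0 1"
  shows "cyclic4 p q r s \<longleftrightarrow> side p r q * side p r s < 0"
proof
  show "side p r q * side p r s < 0" if "cyclic4 p q r s"
    using that ccw_side(1) ccw_rotate unfolding cyclic4_def by (metis mult.commute)
  assume neg: "side p r q * side p r s < 0"
  then have "distinct [p, q, r, s]"
    by (auto simp: mult_less_0_iff)
  then consider "cyclic4 p q r s" | "cyclic4 p q s r" | "cyclic4 p r q s"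
    using cyclic4_trichotomy assms by blast
  then show "cyclic4 p q r s"
  proof cases
    case 2
    then have "0 < side p r q * side p r s"
      using ccw_side(2,3) ccw_rotate unfolding cyclic4_def by (metis mult.commute)
    then show ?thesis using neg by simp
  next
    case 3
    then have "0 < side p r q * side p r s"
      using ccw_side(2,3) ccw_rotate unfolding cyclic4_def by (metis mult.commute)
    then show ?thesis using neg by simp
  qed
qed

lemma cyclic4_distinct:
  assumes "cyclic4 p q r s" shows "distinct [p, q, r, s]"
proof -
  have "side p r q * side p r s < 0"
    using cyclic4_iff_side[OF cyclic4_sphere[OF assms]] assms by blast
  moreover have "side q s r * side q s p < 0"
    using cyclic4_iff_side[OF cyclic4_sphere[OF cyclic4_rotate[OF assms]]] cyclic4_rotate[OF assms] by blast
  ultimately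
  show ?thesis by (auto simp: mult_less_0_iff)
qed

section \<open>Ptolemy's theorem and cross-ratios\<close>

text \<open>The Liouville mass of the box cut out by \<open>p, q, r, s\<close> is \<open>- ln (crr p q r s)\<close>.\<close>

definition crr :: "complex \<Rightarrow> complex \<Rightarrow> complex \<Rightarrow> complex \<Rightarrow> real" where
  "crr p q r s = cmod (p - q) * cmod (r - s) / (cmod (p - r) * cmod (q - s))"

lemma crr_reverse: "crr s r q p = crr p q r s"
  by (simp add: crr_def norm_minus_commute mult.commute)

lemma crr_rotate2: "crr r s p q = crr p q r s"
  by (simp add: crr_def norm_minus_commute mult.commute)

lemma sin_ptolemy:
  fixes a b c :: real
  shows "sin (a + b) * sin (b + c) = sin a * sin c + sin (a + b + c) * sin b"
proof -
  have "(a + b) - (b + c) = a - c" "(a + b) + (b + c) = a + 2 * b + c"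
    "(a + b + c) - b = a + c" "(a + b + c) + b = a + 2 * b + c" by simp_all
  then show ?thesis
    unfolding sin_times_sin[of "a + b" "b + c"] sin_times_sin[of a c] sin_times_sin[of "a + b + c" b]
    by (simp add: field_simps)
qed

text \<open>A chord is twice the sine of half its arc, so \<open>sin_ptolemy\<close> with the three
  consecutive half arcs is the claim.\<close>

lemma cyclic4_ptolemy:
  assumes "cyclic4 p q r s"
  shows "cmod (p - r) * cmod (q - s) = cmod (p - q) * cmod (r - s) + cmod (p - s) * cmod (q - r)"
proof -
  have *: "cmod (p - r) * cmod (q - s) = cmod (p - q) * cmod (r - s) + cmod (p - s) * cmod (q - r)"
    if c: "ccw p q r s" for p q r s
  proof -
    obtain \<alpha> \<beta> \<gamma> \<delta> where o: "\<alpha> < \<beta>" "\<beta> < \<gamma>" "\<gamma> < \<delta>" "\<delta> < \<alpha> + 2 * pi"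
      and eq: "p = cis \<alpha>" "q = cis \<beta>" "r = cis \<gamma>" "s = cis \<delta>"
      using c unfolding ccw_def by blast
    have eqs: "(\<beta> - \<alpha>) / 2 + (\<gamma> - \<beta>) / 2 = (\<gamma> - \<alpha>) / 2" "(\<gamma> - \<beta>) / 2 + (\<delta> - \<gamma>) / 2 = (\<delta> - \<beta>) / 2"
      "(\<gamma> - \<alpha>) / 2 + (\<delta> - \<gamma>) / 2 = (\<delta> - \<alpha>) / 2"
      by argo+
    have "sin ((\<gamma> - \<alpha>) / 2) * sin ((\<delta> - \<beta>) / 2) =
        sin ((\<beta> - \<alpha>) / 2) * sin ((\<delta> - \<gamma>) / 2) + sin ((\<delta> - \<alpha>) / 2) * sin ((\<gamma> - \<beta>) / 2)"
      using sin_ptolemy[of "(\<beta> - \<alpha>) / 2" "(\<gamma> - \<beta>) / 2" "(\<delta> - \<gamma>) / 2"] unfolding eqs .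
    then have "cmod (r - p) * cmod (s - q) = cmod (q - p) * cmod (s - r) + cmod (s - p) * cmod (r - q)"
      unfolding eq using o by (simp add: cis_diff_pos)
    then show ?thesis by (simp add: norm_minus_commute)
  qed
  show ?thesis
    using assms *[of p q r s] *[of s r q p] unfolding cyclic4_def
    by (auto simp: norm_minus_commute algebra_simps)
qed

text \<open>Ptolemy's theorem divided by the product of the diagonals. It also converts an upper
  bound for one box into a lower bound for the opposite box.\<close>

lemma crr_add:
  assumes "cyclic4 p q r s"
  shows "crr p q r s + crr q r s p = 1"
proof -
  have "cmod (p - r) * cmod (q - s) \<noteq> 0"
    using cyclic4_distinct[OF assms] by simp
  then show ?thesis
    using cyclic4_ptolemy[OF assms]
    by (simp add: crr_def norm_minus_commute mult.commute flip: add_divide_distrib)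
qed

lemma crr_pos: "distinct [p, q, r, s] \<Longrightarrow> 0 < crr p q r s"
  by (simp add: crr_def)

lemma crr_bounds:
  assumes "cyclic4 p q r s"
  shows "0 < crr p q r s" "crr p q r s < 1"
proof -
  have "0 < crr p q r s" "0 < crr q r s p"
    using crr_pos cyclic4_distinct assms cyclic4_rotate by blast+
  then show "0 < crr p q r s" "crr p q r s < 1"
    using crr_add[OF assms] by auto
qed

text \<open>Additivity of the Liouville mass in multiplicative form: \<open>x\<close> cuts the arc
  from \<open>q\<close> to \<open>r\<close>, and hence the box, into two pieces.\<close>

lemma crr_mult:
  assumes "x \<noteq> p" "x \<noteq> s"
  shows "crr p q r s = crr p q x s * crr p x r s"
  using assms by (simp add: crr_def norm_minus_commute)

text \<open>As \<open>x\<close> runs along the arc from \<open>q\<close> to \<open>r\<close>, the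
  value \<open>crr p q x s\<close> moves continuously from 1 to \<open>crr p q r s\<close>. The
  disjunction comes from the clockwise case, where reversal makes the other piece the one of value
  \<open>c\<close>.\<close>

lemma cyclic4_subdivide:
  assumes "cyclic4 p q r s" "crr p q r s < c" "c < 1"
  obtains x where "cyclic4 p q x s" "cyclic4 p x r s" "crr p q x s = c \<or> crr p x r s = c"
proof -
  have ccw: "\<exists>x. ccw p q x s \<and> ccw p x r s \<and> crr p q x s = c"
    if c: "ccw p q r s" "crr p q r s < c" for p q r s
  proof -
    obtain \<alpha> \<beta> \<gamma> \<delta> where o: "\<alpha> < \<beta>" "\<beta> < \<gamma>" "\<gamma> < \<delta>" "\<delta> < \<alpha> + 2 * pi"
      and eq: "p = cis \<alpha>" "q = cis \<beta>" "r = cis \<gamma>" "s = cis \<delta>"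
      using c unfolding ccw_def by blast
    have ne: "cis \<alpha> \<noteq> cis \<theta>" if "\<beta> \<le> \<theta>" "\<theta> \<le> \<gamma>" for \<theta>
      using cis_neq[of \<alpha> \<theta>] o that by auto
    have ne': "cis \<beta> \<noteq> cis \<delta>"
      using cis_neq[of \<beta> \<delta>] o by auto
    have "continuous_on {\<beta>..\<gamma>} (\<lambda>\<theta>. crr p q (cis \<theta>) s)"
      unfolding crr_def eq by (intro continuous_intros) (use ne ne' in auto)
    moreover have "crr p q (cis \<gamma>) s \<le> c" "c \<le> crr p q (cis \<beta>) s"
      using c assms(3) ne[of \<beta>] ne' o by (auto simp: crr_def eq)
    ultimately obtain \<theta> where \<theta>: "\<beta> \<le> \<theta>" "\<theta> \<le> \<gamma>" "crr p q (cis \<theta>) s = c"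
      using IVT2'[of "\<lambda>\<theta>. crr p q (cis \<theta>) s" \<gamma> c \<beta>] o by auto
    moreover have "\<theta> \<noteq> \<beta>" "\<theta> \<noteq> \<gamma>"
      using \<theta> c assms(3) ne[of \<beta>] ne' o by (auto simp: crr_def eq)
    ultimately have "\<beta> < \<theta>" "\<theta> < \<gamma>" by simp_all
    then have "ccw p q (cis \<theta>) s" "ccw p (cis \<theta>) r s"
      unfolding eq using o by (auto intro!: ccwI)
    then show ?thesis using \<theta>(3) by blast
  qed
  consider "ccw p q r s" | "ccw s r q p"
    using assms unfolding cyclic4_def by blast
  then show thesis
  proof cases
    case 1
    then show thesis using ccw[of p q r s] assms that unfolding cyclic4_def by blast
  next
    case 2
    then obtain x where "ccw s r x p" "ccw s x q p" "crr s r x p = c"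
      using ccw[of s r q p] assms(2) by (auto simp: crr_reverse)
    then show thesis
      using that[of x] unfolding cyclic4_def by (metis crr_reverse)
  qed
qed

text \<open>For cyclically ordered points this is the open box of geodesics with one endpoint
  between \<open>q\<close> and \<open>r\<close> and the other between \<open>s\<close> and
  \<open>p\<close>. Signs make the description symmetric in the endpoints and meaningful for points
  in any order.\<close>

definition separating :: "complex \<Rightarrow> complex \<Rightarrow> complex \<Rightarrow> complex \<Rightarrow> complex uprod set" where
  "separating p q r s = {Upair a b | a b. a \<in> sphere 0 1 \<and> b \<in> sphere 0 1 \<and>
     0 < side a b p * side a b q \<and> 0 < side a b r * side a b s \<and> side a b p * side a b r < 0}"

lemma separating_iff:
  "Upair a b \<in> separating p q r s \<longleftrightarrow> a \<in> sphere 0 1 \<and> b \<in> sphere 0 1 \<and>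
     0 < side a b p * side a b q \<and> 0 < side a b r * side a b s \<and> side a b p * side a b r < 0"
  unfolding separating_def by (auto simp: side_swap[of b a])

lemma separating_reverse: "separating s r q p = separating p q r s"
proof -
  have "e \<in> separating s r q p \<longleftrightarrow> e \<in> separating p q r s" for e
    by (cases e) (auto simp: separating_iff zero_less_mult_iff mult_less_0_iff)
  then show ?thesis by blast
qed

lemma side_eq_0D:
  assumes "side a b k = 0" "a \<noteq> b"
  obtains u where "k = (1 - u) *\<^sub>R a + u *\<^sub>R b"
proof -
  have "(k - a) / (b - a) \<in> \<real>"
    using assms by (simp add: side_def complex_is_Real_iff Im_divide algebra_simps)
  then obtain u where "(k - a) / (b - a) = complex_of_real u"
    by (rule Reals_cases)
  then have "k = a + u *\<^sub>R (b - a)"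
    using assms(2) by (simp add: field_simps scaleR_conv_of_real)
  then show thesis
    by (intro that[of u]) (simp add: algebra_simps)
qed

lemma opposite_sides_weight:
  fixes c d u :: real
  assumes "c * d < 0" "(1 - u) * c + u * d = 0"
  shows "0 < u" "u < 1"
proof -
  have "u * (c - d) = c" using assms(2) by (simp add: algebra_simps)
  moreover have "c - d \<noteq> 0" using assms(1) by auto
  ultimately have "u = c / (c - d)" by (simp add: field_simps)
  then show "0 < u" "u < 1"
    using assms(1) by (auto simp: mult_less_0_iff field_simps)
qed

text \<open>The affine function \<open>side p r\<close> changes sign along the chord from
  \<open>q\<close> to \<open>s\<close>; its zero is the meeting point. The sign change of
  \<open>side q s\<close> then places it strictly inside the other chord.\<close>

lemma cyclic4_diagonals_meet:
  assumes "cyclic4 p q r s"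
  obtains u t where "0 < u" "u < 1" "0 < t" "t < 1" "(1 - u) *\<^sub>R p + u *\<^sub>R r = (1 - t) *\<^sub>R q + t *\<^sub>R s"
proof -
  have n: "side p r q * side p r s < 0"
    using assms cyclic4_iff_side[OF cyclic4_sphere[OF assms]] by blast
  have n': "side q s p * side q s r < 0"
    using cyclic4_rotate[OF assms] cyclic4_iff_side[OF cyclic4_sphere[OF cyclic4_rotate[OF assms]]]
    by (metis mult.commute)
  define t where "t = side p r q / (side p r q - side p r s)"
  define k where "k = (1 - t) *\<^sub>R q + t *\<^sub>R s"
  have "side p r q - side p r s \<noteq> 0" using n by auto
  then have k0: "(1 - t) * side p r q + t * side p r s = 0"
    by (simp add: t_def field_simps)
  have t: "0 < t" "t < 1"
    using opposite_sides_weight[OF n k0] by auto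
  have "p \<noteq> r" using n by auto
  then obtain u where u: "k = (1 - u) *\<^sub>R p + u *\<^sub>R r"
    using side_eq_0D[of p r k] k0 unfolding k_def side_affine by blast
  have "(1 - u) * side q s p + u * side q s r = side q s k"
    unfolding u by (simp add: side_affine)
  also have "\<dots> = 0" by (simp add: k_def side_affine)
  finally have "0 < u" "u < 1"
    using opposite_sides_weight[OF n'] by auto
  with t u show thesis
    by (intro that[of u t]) (auto simp: k_def)
qed

text \<open>A line with one diagonal strictly on each side would leave the common point of the
  diagonals on both sides.\<close>

lemma separating_crossed_empty:
  assumes "cyclic4 p q r s"
  shows "separating p r q s = {}"
proof -
  have "False" if e: "Upair a b \<in> separating p r q s" for a b
  proof -
    obtain u t where ut: "0 < u" "u < 1" "0 < t" "t < 1"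
      and eq: "(1 - u) *\<^sub>R p + u *\<^sub>R r = (1 - t) *\<^sub>R q + t *\<^sub>R s"
      using cyclic4_diagonals_meet[OF assms] .
    have s: "(1 - u) * side a b p + u * side a b r = (1 - t) * side a b q + t * side a b s"
      using arg_cong[OF eq, of "side a b"] by (simp only: side_affine)
    have pos: "0 < (1 - c) * x + c * y" if "0 < c" "c < 1" "0 < x" "0 < y" for c x y :: real
      using that by (intro add_pos_pos) auto
    consider "0 < side a b p" "0 < side a b r" "0 < - side a b q" "0 < - side a b s"
      | "0 < - side a b p" "0 < - side a b r" "0 < side a b q" "0 < side a b s"
      using e by (auto simp: separating_iff zero_less_mult_iff mult_less_0_iff)
    then show False
    proof cases
      case 1 then show ?thesis using pos[OF ut(1,2) 1(1,2)] pos[OF ut(3,4) 1(3,4)] s by simp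
    next
      case 2 then show ?thesis using pos[OF ut(1,2) 2(1,2)] pos[OF ut(3,4) 2(3,4)] s by simp
    qed
  qed
  then show ?thesis
    by (metis equals0I uprod_exhaust)
qed

lemma separating_degenerate: "separating p q p s = {}" "separating p q q s = {}"
proof -
  have "e \<notin> separating p q p s" "e \<notin> separating p q q s" for e
    by (cases e; auto simp: separating_iff zero_less_mult_iff mult_less_0_iff)+
  then show "separating p q p s = {}" "separating p q q s = {}" by blast+
qed

lemma separating_swap: "separating q p r s = separating p q r s" "separating p q s r = separating p q r s"
proof -
  have "e \<in> separating q p r s \<longleftrightarrow> e \<in> separating p q r s" "e \<in> separating p q s r \<longleftrightarrow> e \<in> separating p q r s" for e
    by (cases e; auto simp: separating_iff zero_less_mult_iff mult_less_0_iff)+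
  then show "separating q p r s = separating p q r s" "separating p q s r = separating p q r s" by blast+
qed

text \<open>For the ideal endpoints of two lines: unless they are cyclically ordered, one of the two
  excess terms in the four-point inequality vanishes. In the other arrangements one grouping opposes
  two crossing diagonals, and coincident points are degenerate.\<close>

lemma separating_cases:
  assumes "p \<in> sphere 0 1" "q \<in> sphere 0 1" "r \<in> sphere 0 1" "s \<in> sphere 0 1"
  shows "cyclic4 p q r s \<or> separating p q r s = {} \<or> separating p s q r = {}"
proof (cases "distinct [p, q, r, s]")
  case True
  then consider "cyclic4 p q r s" | "cyclic4 p q s r" | "cyclic4 p r q s"
    using cyclic4_trichotomy assms by blast
  then show ?thesis
    using separating_crossed_empty separating_swap by metis
next
  case False
  then consider "p = q" | "p = r" | "p = s" | "q = r" | "q = s" | "r = s" by auto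
  then show ?thesis
    using separating_degenerate separating_swap by cases metis+
qed

text \<open>This makes equality of signs a topological condition. Removing \<open>a\<close> and
  \<open>b\<close> leaves two open arcs, on one of which \<open>side a b\<close> is negative and on
  the other positive.\<close>

lemma connected_component_circle_minus2:
  assumes "a \<in> sphere 0 1" "b \<in> sphere 0 1" "p \<in> sphere 0 1" "q \<in> sphere 0 1" "a \<noteq> b"
  shows "connected_component (sphere 0 1 - {a, b}) p q \<longleftrightarrow> 0 < side a b p * side a b q"
proof -
  obtain \<alpha> where \<alpha>: "a = cis \<alpha>" using sphere_cis_ge[OF assms(1)] by metis
  obtain \<beta> where "\<alpha> \<le> \<beta>" "\<beta> < \<alpha> + 2 * pi" and \<beta>: "b = cis \<beta>" using sphere_cis_ge[OF assms(2)] by metis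
  with assms(5) \<alpha> have o: "\<alpha> < \<beta>" "\<beta> < \<alpha> + 2 * pi" by (auto simp: order.strict_iff_order)
  define A where "A = cis ` {\<alpha><..<\<beta>}"
  define B where "B = cis ` {\<beta><..<\<alpha> + 2 * pi}"
  have sA: "side a b x < 0" if "x \<in> A" for x
    using that side_cis_neg o unfolding A_def \<alpha> \<beta> by auto
  have sB: "0 < side a b x" if "x \<in> B" for x
    using that side_cis_pos o unfolding B_def \<alpha> \<beta> by auto
  have split: "x \<in> A \<or> x \<in> B" if x: "x \<in> sphere 0 1 - {a, b}" for x
  proof -
    obtain \<theta> where \<theta>: "\<alpha> \<le> \<theta>" "\<theta> < \<alpha> + 2 * pi" "x = cis \<theta>"
      using sphere_cis_ge[of x \<alpha>] x by auto
    then have "\<theta> \<noteq> \<alpha>" "\<theta> \<noteq> \<beta>" using x \<alpha> \<beta> by auto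
    then show ?thesis
      using \<theta> unfolding A_def B_def by (cases "\<theta> < \<beta>") auto
  qed
  have sub: "A \<subseteq> sphere 0 1 - {a, b}" "B \<subseteq> sphere 0 1 - {a, b}"
    using sA sB by (fastforce simp: A_def, fastforce simp: B_def)
  have conn: "connected A" "connected B"
    unfolding A_def B_def by (intro connected_continuous_image continuous_on_cis continuous_on_id connected_Ioo)+
  show ?thesis
  proof
    assume "connected_component (sphere 0 1 - {a, b}) p q"
    then obtain C where C: "connected C" "C \<subseteq> sphere 0 1 - {a, b}" "p \<in> C" "q \<in> C"
      unfolding connected_component_def by blast
    have "connected (side a b ` C)"
      by (intro connected_continuous_image continuous_intros C)
    moreover have 0: "0 \<notin> side a b ` C"
      using C(2) split sA sB by fastforce
    ultimately have "\<not> (x < 0 \<and> 0 < y)" if "x \<in> side a b ` C" "y \<in> side a b ` C" for x y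
      using connectedD_interval[OF _ that, of 0] by (meson less_imp_le)
    then have "\<not> (side a b p < 0 \<and> 0 < side a b q)" "\<not> (side a b q < 0 \<and> 0 < side a b p)"
      using C(3,4) by blast+
    moreover have "side a b p \<noteq> 0" "side a b q \<noteq> 0"
      using C(3,4) 0 by (metis imageI)+
    ultimately show "0 < side a b p * side a b q"
      by (auto simp: zero_less_mult_iff not_less)
  next
    assume pos: "0 < side a b p * side a b q"
    then have "p \<in> sphere 0 1 - {a, b}" "q \<in> sphere 0 1 - {a, b}"
      using assms by auto
    then consider "p \<in> A \<and> q \<in> A \<or> p \<in> B \<and> q \<in> B" | "p \<in> A" "q \<in> B" | "p \<in> B" "q \<in> A"
      using split by blast
    then have "p \<in> A \<and> q \<in> A \<or> p \<in> B \<and> q \<in> B"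
      using sA sB pos by cases (auto simp: zero_less_mult_iff dest: less_asym)
    then show "connected_component (sphere 0 1 - {a, b}) p q"
      using conn sub unfolding connected_component_def by blast
  qed
qed

section \<open>Action of circle homeomorphisms on boxes and cyclic order\<close>

definition circle_homeo :: "(complex \<Rightarrow> complex) \<Rightarrow> bool" where
  "circle_homeo f \<longleftrightarrow> continuous_on (sphere 0 1) f \<and> bij_betw f (sphere 0 1) (sphere 0 1)"

lemma circle_homeo_mem: "circle_homeo f \<Longrightarrow> a \<in> sphere 0 1 \<Longrightarrow> f a \<in> sphere 0 1"
  unfolding circle_homeo_def bij_betw_def by blast

lemma circle_homeo_eq_iff:
  "circle_homeo f \<Longrightarrow> a \<in> sphere 0 1 \<Longrightarrow> b \<in> sphere 0 1 \<Longrightarrow> f a = f b \<longleftrightarrow> a = b"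
  unfolding circle_homeo_def bij_betw_def by (blast dest: inj_onD)

lemma circle_homeo_compose:
  assumes "circle_homeo f" "circle_homeo g" shows "circle_homeo (f \<circ> g)"
  using assms unfolding circle_homeo_def
  by (metis bij_betw_imp_surj_on bij_betw_trans continuous_on_compose)

lemma circle_homeo_inv:
  assumes "circle_homeo f" shows "circle_homeo (inv_into (sphere 0 1) f)"
  using assms unfolding circle_homeo_def
  using continuous_on_inv[of "sphere 0 1" f "inv_into (sphere 0 1) f"] bij_betw_inv_into[of f "sphere 0 1" "sphere 0 1"]
  by (simp add: bij_betw_def)

lemma circle_homeo_connected_component:
  assumes "circle_homeo f" "a \<in> sphere 0 1" "b \<in> sphere 0 1" "connected_component (sphere 0 1 - {a, b}) p q"
  shows "connected_component (sphere 0 1 - {f a, f b}) (f p) (f q)"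
proof -
  obtain C where C: "connected C" "C \<subseteq> sphere 0 1 - {a, b}" "p \<in> C" "q \<in> C"
    using assms(4) unfolding connected_component_def by blast
  have "connected (f ` C)"
    using C(1,2) assms(1) unfolding circle_homeo_def
    by (meson Diff_subset connected_continuous_image continuous_on_subset order_trans)
  moreover have "f ` C \<subseteq> sphere 0 1 - {f a, f b}"
    using C(2) circle_homeo_mem[OF assms(1)] circle_homeo_eq_iff[OF assms(1)] assms(2,3) by blast
  ultimately show ?thesis
    using C(3,4) unfolding connected_component_def by blast
qed

lemma circle_homeo_side_pos:
  assumes "circle_homeo f" "a \<in> sphere 0 1" "b \<in> sphere 0 1" "p \<in> sphere 0 1" "q \<in> sphere 0 1"
    "0 < side a b p * side a b q"
  shows "0 < side (f a) (f b) (f p) * side (f a) (f b) (f q)"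
proof -
  have "a \<noteq> b" using assms(6) by auto
  then show ?thesis
    using assms circle_homeo_connected_component[OF assms(1-3), of p q] circle_homeo_mem[OF assms(1)]
      circle_homeo_eq_iff[OF assms(1-3)] connected_component_circle_minus2 by auto
qed

lemma side_eq_0_iff:
  assumes "a \<in> sphere 0 1" "b \<in> sphere 0 1" "p \<in> sphere 0 1" "a \<noteq> b"
  shows "side a b p = 0 \<longleftrightarrow> p = a \<or> p = b"
proof
  assume "side a b p = 0"
  then have "\<not> connected_component (sphere 0 1 - {a, b}) p p"
    using connected_component_circle_minus2[OF assms(1,2,3,3,4)] by simp
  then show "p = a \<or> p = b"
    using assms(3) by (auto simp: connected_component_refl_eq)
qed auto

text \<open>The image values are nonzero by injectivity. If they had equal signs, the inverse
  homeomorphism would carry this back to the original points.\<close>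

lemma circle_homeo_side_neg:
  assumes "circle_homeo f" "a \<in> sphere 0 1" "b \<in> sphere 0 1" "p \<in> sphere 0 1" "q \<in> sphere 0 1"
    "side a b p * side a b q < 0"
  shows "side (f a) (f b) (f p) * side (f a) (f b) (f q) < 0"
proof -
  let ?g = "inv_into (sphere 0 1) f"
  have inv: "?g (f x) = x" if "x \<in> sphere 0 1" for x
    using that assms(1) unfolding circle_homeo_def bij_betw_def by simp
  have ne: "a \<noteq> b" "p \<noteq> a" "p \<noteq> b" "q \<noteq> a" "q \<noteq> b"
    using assms(6) by auto
  have "side (f a) (f b) (f p) \<noteq> 0" "side (f a) (f b) (f q) \<noteq> 0"
    using ne assms(2-5) circle_homeo_mem[OF assms(1)] circle_homeo_eq_iff[OF assms(1)]
    by (simp_all add: side_eq_0_iff)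
  moreover have "\<not> 0 < side (f a) (f b) (f p) * side (f a) (f b) (f q)"
    using circle_homeo_side_pos[OF circle_homeo_inv[OF assms(1)], of "f a" "f b" "f p" "f q"]
      circle_homeo_mem[OF assms(1)] assms(2-6) inv by auto
  ultimately show ?thesis
    by (simp add: less_le not_less)
qed

lemma circle_homeo_separating:
  assumes "circle_homeo f" "p \<in> sphere 0 1" "q \<in> sphere 0 1" "r \<in> sphere 0 1" "s \<in> sphere 0 1"
    "e \<in> separating p q r s"
  shows "map_uprod f e \<in> separating (f p) (f q) (f r) (f s)"
proof (cases e)
  case (Upair a b)
  then show ?thesis
    using assms circle_homeo_side_pos[OF assms(1)] circle_homeo_side_neg[OF assms(1)] circle_homeo_mem[OF assms(1)]
    by (simp add: separating_iff)
qed

lemma circle_homeo_cyclic4: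
  assumes "circle_homeo f" "cyclic4 p q r s"
  shows "cyclic4 (f p) (f q) (f r) (f s)"
proof -
  note S = cyclic4_sphere[OF assms(2)]
  have "side (f p) (f r) (f q) * side (f p) (f r) (f s) < 0"
    using circle_homeo_side_neg[OF assms(1) S(1) S(3) S(2) S(4)] assms(2) cyclic4_iff_side[OF S] by blast
  then show ?thesis
    using cyclic4_iff_side[of "f p" "f q" "f r" "f s"] S[THEN circle_homeo_mem[OF assms(1)]] by blast
qed

subsection \<open>Distortion of cross-ratios\<close>

text \<open>The radial change from the Poincare model to the projective model. It fixes the circle
  pointwise, so ideal endpoints are the same in both.\<close>

definition klein :: "complex \<Rightarrow> complex" where
  "klein z = (2 / (1 + (cmod z)\<^sup>2)) *\<^sub>R z"

definition unklein :: "complex \<Rightarrow> complex" where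
  "unklein k = (1 / (1 + sqrt (1 - (cmod k)\<^sup>2))) *\<^sub>R k"

lemma one_plus_sq_pos: "0 < 1 + (cmod z)\<^sup>2"
  by (simp add: add_pos_nonneg)

lemma klein_norm: "1 - (cmod (klein z))\<^sup>2 = ((1 - (cmod z)\<^sup>2) / (1 + (cmod z)\<^sup>2))\<^sup>2"
proof -
  define N where "N = 1 + (cmod z)\<^sup>2"
  have N: "N \<noteq> 0" "(cmod z)\<^sup>2 = N - 1" using one_plus_sq_pos[of z] by (simp_all add: N_def)
  have k: "(cmod (klein z))\<^sup>2 = 4 * (N - 1) / N\<^sup>2"
    by (simp add: klein_def power_mult_distrib power_divide N)
  show ?thesis
    unfolding k N(2) using N(1) by (simp add: power_divide field_simps power2_eq_square)
qed

lemma klein_ball: "cmod z < 1 \<Longrightarrow> cmod (klein z) < 1"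
proof -
  assume "cmod z < 1"
  then have "(cmod z)\<^sup>2 < 1" by (simp add: power_less_one_iff)
  then have "0 < ((1 - (cmod z)\<^sup>2) / (1 + (cmod z)\<^sup>2))\<^sup>2"
    using one_plus_sq_pos[of z] by simp
  then have "(cmod (klein z))\<^sup>2 < 1\<^sup>2" by (simp flip: klein_norm)
  then show ?thesis by (rule power2_less_imp_less) simp
qed

lemma unklein_klein: "cmod z \<le> 1 \<Longrightarrow> unklein (klein z) = z"
proof -
  assume "cmod z \<le> 1"
  then have "(cmod z)\<^sup>2 \<le> 1" by (simp add: power_le_one_iff)
  then have "sqrt (1 - (cmod (klein z))\<^sup>2) = (1 - (cmod z)\<^sup>2) / (1 + (cmod z)\<^sup>2)"
    using one_plus_sq_pos[of z] by (simp only: klein_norm real_sqrt_abs) auto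
  then have "1 + sqrt (1 - (cmod (klein z))\<^sup>2) = 2 / (1 + (cmod z)\<^sup>2)"
    using one_plus_sq_pos[of z] by (simp add: field_simps)
  then have "unklein (klein z) = (1 / (2 / (1 + (cmod z)\<^sup>2))) *\<^sub>R ((2 / (1 + (cmod z)\<^sup>2)) *\<^sub>R z)"
    by (simp only: unklein_def flip: klein_def)
  also have "(1 / (2 / N)) *\<^sub>R ((2 / N) *\<^sub>R z) = z" if "N \<noteq> 0" for N :: real
    using that by simp
  finally show ?thesis
    using one_plus_sq_pos[of z] by (simp add: less_imp_neq[symmetric])
qed

lemma klein_unklein: "cmod k \<le> 1 \<Longrightarrow> klein (unklein k) = k"
proof -
  assume "cmod k \<le> 1"
  then have k: "(cmod k)\<^sup>2 \<le> 1" by (simp add: power_le_one_iff)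
  define s where "s = sqrt (1 - (cmod k)\<^sup>2)"
  have s: "0 \<le> s" "s\<^sup>2 = 1 - (cmod k)\<^sup>2" using k by (simp_all add: s_def)
  have "1 + (cmod (unklein k))\<^sup>2 = 1 + (1 - s\<^sup>2) / (1 + s)\<^sup>2"
    using s by (simp add: unklein_def power_mult_distrib power_divide flip: s_def)
  also have "\<dots> = 2 / (1 + s)"
  proof -
    define m where "m = 1 + s"
    have m: "m \<noteq> 0" "s = m - 1" using s(1) by (auto simp: m_def)
    show ?thesis unfolding m(2) using m(1) by (simp add: field_simps power2_eq_square)
  qed
  finally show ?thesis
    using s(1) by (simp add: klein_def) (simp add: unklein_def flip: s_def)
qed

lemma unklein_ball: "cmod k < 1 \<Longrightarrow> cmod (unklein k) < 1"
proof -
  assume k: "cmod k < 1"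
  then have "0 \<le> sqrt (1 - (cmod k)\<^sup>2)" by (simp add: power_le_one_iff)
  moreover have "cmod k / (1 + w) \<le> cmod k" "\<bar>1 + w\<bar> = 1 + w" if "0 \<le> w" for w :: real
    using that by (auto simp: divide_le_eq mult_le_cancel_left1)
  ultimately have "cmod (unklein k) \<le> cmod k"
    by (simp add: unklein_def)
  with k show ?thesis by simp
qed

lemma klein_inj: "cmod z \<le> 1 \<Longrightarrow> cmod w \<le> 1 \<Longrightarrow> klein z = klein w \<Longrightarrow> z = w"
  by (metis unklein_klein)

section \<open>Moebius maps and the visual distance\<close>

lemma norm_Moebius_diff:
  assumes "1 - cnj w * p \<noteq> 0" "1 - cnj w * q \<noteq> 0" "cmod w < 1"
  shows "cmod (Moebius_function t w p - Moebius_function t w q) =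
     cmod (p - q) * (1 - (cmod w)\<^sup>2) / (cmod (1 - cnj w * p) * cmod (1 - cnj w * q))"
proof -
  have "Moebius_function t w p - Moebius_function t w q =
     exp (\<i> * of_real t) * ((p - q) * (1 - w * cnj w) / ((1 - cnj w * p) * (1 - cnj w * q)))"
    using assms(1,2) unfolding Moebius_function_def by (simp add: field_simps)
  also have "1 - w * cnj w = of_real (1 - (cmod w)\<^sup>2)"
    by (simp flip: complex_norm_square)
  finally show ?thesis
    using assms(3) by (simp add: norm_mult norm_divide power_le_one_iff abs_mult del: of_real_diff of_real_1)
qed

lemma Moebius_denom_nonzero:
  assumes "cmod w < 1" "cmod z \<le> 1" shows "1 - cnj w * z \<noteq> 0"
proof
  assume "1 - cnj w * z = 0"
  then have "cmod (cnj w * z) = 1" by (metis eq_iff_diff_eq_0 norm_one)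
  moreover have "cmod (cnj w * z) < 1"
    using assms by (simp add: norm_mult) (metis mult_left_le norm_ge_zero order_le_less_trans)
  ultimately show False by simp
qed

lemma cmod_one_minus_cnj_mult:
  "(cmod (1 - cnj w * z))\<^sup>2 - (cmod (z - w))\<^sup>2 = (1 - (cmod w)\<^sup>2) * (1 - (cmod z)\<^sup>2)"
  unfolding cmod_power2 by (simp add: power2_eq_square algebra_simps)

lemma norm_Moebius:
  assumes "cmod w < 1" "cmod z \<le> 1"
  shows "1 - (cmod (Moebius_function t w z))\<^sup>2 =
     (1 - (cmod z)\<^sup>2) * (1 - (cmod w)\<^sup>2) / (cmod (1 - cnj w * z))\<^sup>2"
proof -
  have "(cmod (Moebius_function t w z))\<^sup>2 = (cmod (z - w))\<^sup>2 / (cmod (1 - cnj w * z))\<^sup>2"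
    by (simp add: Moebius_function_def norm_mult norm_divide power_divide)
  then show ?thesis
    using Moebius_denom_nonzero[OF assms] cmod_one_minus_cnj_mult[of w z]
    by (simp add: field_simps)
qed

text \<open>The chordal distance of \<open>p\<close> and \<open>q\<close> after moving \<open>z\<close> to the centre of the disc.\<close>

definition visual_dist :: "complex \<Rightarrow> complex \<Rightarrow> complex \<Rightarrow> real" where
  "visual_dist z p q = cmod (p - q) * (1 - (cmod z)\<^sup>2) / (cmod (p - z) * cmod (q - z))"

lemma disc_isometriesE:
  assumes "g \<in> disc_isometries"
  obtains w t where "cmod w < 1" "\<forall>z. cmod z \<le> 1 \<longrightarrow> g z = Moebius_function t w z"
proof -
  obtain t w where "g = restrict (Moebius_function t w) (cball 0 1)" "cmod w < 1"
    using assms unfolding disc_isometries_def by auto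
  then show thesis by (intro that[of w t]) auto
qed

lemma cmod_Moebius_sphere:
  assumes "cmod w < 1" "cmod p = 1" shows "cmod (Moebius_function t w p) = 1"
proof -
  have "(cmod (Moebius_function t w p))\<^sup>2 = 1\<^sup>2"
    using norm_Moebius[of w p t] assms by simp
  then show ?thesis by (rule power2_eq_imp_eq) auto
qed

lemma visual_dist_le_2:
  assumes "cmod z < 1" "cmod p = 1" "cmod q = 1"
  shows "visual_dist z p q \<le> 2"
proof -
  \<comment> \<open>On the circle the Moebius denominators become the distances to \<open>z\<close>
    that occur in \<open>visual_dist\<close>.\<close>
  have *: "cmod (1 - cnj z * p) = cmod (p - z)" if "cmod p = 1" for p
  proof -
    have "(cmod (1 - cnj z * p))\<^sup>2 = (cmod (p - z))\<^sup>2"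
      using cmod_one_minus_cnj_mult[of z p] that by simp
    then show ?thesis by (rule power2_eq_imp_eq) auto
  qed
  have "visual_dist z p q = cmod (Moebius_function 0 z p - Moebius_function 0 z q)"
    using assms Moebius_denom_nonzero[of z] by (subst norm_Moebius_diff) (auto simp: visual_dist_def *)
  also have "\<dots> \<le> cmod (Moebius_function 0 z p) + cmod (Moebius_function 0 z q)"
    by (rule norm_triangle_ineq4)
  finally show ?thesis
    using assms by (simp add: cmod_Moebius_sphere)
qed

lemma visual_dist_isometry:
  assumes "g \<in> disc_isometries" "cmod z < 1" "cmod p = 1" "cmod q = 1"
  shows "visual_dist (g z) (g p) (g q) = visual_dist z p q"
proof -
  obtain w t where w: "cmod w < 1" and g: "\<forall>z. cmod z \<le> 1 \<longrightarrow> g z = Moebius_function t w z"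
    using disc_isometriesE[OF assms(1)] .
  have nz: "cmod (1 - cnj w * x) \<noteq> 0" if "cmod x \<le> 1" for x
    using Moebius_denom_nonzero[OF w that] by simp
  have w2: "(cmod w)\<^sup>2 \<noteq> 1" using w power_less_one_iff[of "cmod w" 2] by simp
  have "p \<noteq> z" "q \<noteq> z" using assms by auto
  then show ?thesis
    using assms nz[of p] nz[of q] nz[of z] w2 unfolding visual_dist_def
    by (simp add: g norm_Moebius_diff Moebius_denom_nonzero w norm_Moebius)
       (simp add: power2_eq_square)
qed

lemma crr_isometry:
  assumes "g \<in> disc_isometries" "cmod p = 1" "cmod q = 1" "cmod r = 1" "cmod s = 1"
  shows "crr (g p) (g q) (g r) (g s) = crr p q r s"
proof -
  obtain w t where w: "cmod w < 1" and g: "\<forall>z. cmod z \<le> 1 \<longrightarrow> g z = Moebius_function t w z"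
    using disc_isometriesE[OF assms(1)] .
  have nz: "cmod (1 - cnj w * x) \<noteq> 0" if "cmod x \<le> 1" for x
    using Moebius_denom_nonzero[OF w that] by simp
  have w2: "(cmod w)\<^sup>2 \<noteq> 1" using w power_less_one_iff[of "cmod w" 2] by simp
  show ?thesis
    using assms nz[of p] nz[of q] nz[of r] nz[of s] w2 unfolding crr_def
    by (simp add: g norm_Moebius_diff Moebius_denom_nonzero w)
qed

lemma cmod_diff_sq: "(cmod (x - y))\<^sup>2 = (cmod x)\<^sup>2 + (cmod y)\<^sup>2 - 2 * (x \<bullet> y)"
  unfolding cmod_power2 by (simp add: inner_complex_def power2_eq_square algebra_simps)

text \<open>If a point of the geodesic from \<open>p\<close> to \<open>r\<close> is moved to the
  centre, \<open>p\<close> and \<open>r\<close> become antipodal. The proof computes every distance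
  from the Klein parameter \<open>u\<close> and the inner product \<open>c\<close>.\<close>

lemma visual_dist_chord:
  assumes "cmod p = 1" "cmod r = 1" "p \<noteq> r" "cmod z < 1" "klein z = (1 - u) *\<^sub>R p + u *\<^sub>R r" "0 < u" "u < 1"
  shows "visual_dist z p r = 2"
proof -
  define N where "N = 1 + (cmod z)\<^sup>2"
  define c where "c = p \<bullet> r"
  have N: "0 < N" using one_plus_sq_pos by (simp add: N_def)
  have z: "2 * (x \<bullet> z) = N * (x \<bullet> klein z)" for x
    using N by (simp add: klein_def N_def inner_commute)
  have pp: "p \<bullet> p = 1" "r \<bullet> r = 1" using assms by (simp_all add: dot_square_norm)
  have dp: "(cmod (p - z))\<^sup>2 = N * u * (1 - c)"
    unfolding cmod_diff_sq z assms(5) using assms(1) pp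
    by (simp add: inner_right_distrib N_def c_def algebra_simps)
  have dr: "(cmod (r - z))\<^sup>2 = N * (1 - u) * (1 - c)"
    unfolding cmod_diff_sq z assms(5) using assms(2) pp
    by (simp add: inner_right_distrib N_def c_def inner_commute algebra_simps)
  have pr: "(cmod (p - r))\<^sup>2 = 2 * (1 - c)"
    unfolding cmod_diff_sq using assms(1,2) by (simp add: c_def)
  have "(cmod (klein z))\<^sup>2 = 1 - 2 * u * (1 - u) * (1 - c)"
    unfolding assms(5) power2_norm_eq_inner using pp
    by (simp add: inner_right_distrib inner_left_distrib c_def inner_commute algebra_simps)
  then have "((1 - (cmod z)\<^sup>2) / N)\<^sup>2 = 2 * u * (1 - u) * (1 - c)"
    using klein_norm[of z] by (simp add: N_def)
  then have zz: "(1 - (cmod z)\<^sup>2)\<^sup>2 = 2 * u * (1 - u) * (1 - c) * N\<^sup>2"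
    using N by (simp add: power_divide field_simps)
  have frac: "2 * d * (2 * a * b * d * N\<^sup>2) / (N * a * d * (N * b * d)) = 2\<^sup>2"
    if "a \<noteq> 0" "b \<noteq> 0" "d \<noteq> 0" for a b d :: real
    using that N by (simp add: field_simps power2_eq_square)
  have "1 - c \<noteq> 0" using pr assms(3) by auto
  then have "2 * (1 - c) * (2 * u * (1 - u) * (1 - c) * N\<^sup>2) / (N * u * (1 - c) * (N * (1 - u) * (1 - c))) = 2\<^sup>2"
    using assms(6,7) by (intro frac) auto
  then have "(visual_dist z p r)\<^sup>2 = 2\<^sup>2"
    unfolding visual_dist_def power_divide power_mult_distrib dp dr pr zz .
  moreover have "0 \<le> visual_dist z p r"
    using assms(4) by (simp add: visual_dist_def power_le_one_iff)
  ultimately show ?thesis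
    using power2_eq_imp_eq[of "visual_dist z p r" 2] by simp
qed

text \<open>Seen from the meeting point of the two diagonals, all four points are spread out.\<close>

lemma cyclic4_center:
  assumes "cyclic4 p q r s"
  obtains z where "cmod z < 1" "2 * crr p q r s \<le> visual_dist z p q" "2 * crr p q r s \<le> visual_dist z r s"
    "2 * crr q r s p \<le> visual_dist z q r" "2 * crr q r s p \<le> visual_dist z s p"
    "visual_dist z p r = 2" "visual_dist z q s = 2"
proof -
  obtain u t where ut: "0 < u" "u < 1" "0 < t" "t < 1"
    and eq: "(1 - u) *\<^sub>R p + u *\<^sub>R r = (1 - t) *\<^sub>R q + t *\<^sub>R s"
    using cyclic4_diagonals_meet[OF assms] .
  define k where "k = (1 - u) *\<^sub>R p + u *\<^sub>R r"
  have S: "cmod p = 1" "cmod q = 1" "cmod r = 1" "cmod s = 1"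
    using cyclic4_sphere[OF assms] by auto
  have D: "distinct [p, q, r, s]" using cyclic4_distinct[OF assms] .
  have "k \<in> open_segment p r"
    using D ut by (auto simp: in_segment k_def)
  then have k1: "cmod k < 1"
    using dist_decreases_open_segment[of k p r 0] S by (auto simp: dist_norm norm_minus_commute)
  define z where "z = unklein k"
  have z: "cmod z < 1" and kz: "klein z = k"
    using k1 unklein_ball klein_unklein by (auto simp: z_def)
  have pr: "visual_dist z p r = 2" "visual_dist z q s = 2"
    using visual_dist_chord[of p r z u] visual_dist_chord[of q s z t] S D z ut kz eq by (auto simp: k_def)
  have ne: "p \<noteq> z" "q \<noteq> z" "r \<noteq> z" "s \<noteq> z" using S z by auto
  \<comment> \<open>Cross-ratios may be computed with visual distances, since the factors depending
    on \<open>z\<close> cancel. The diagonals have length 2, so opposite sides multiply to four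
    times a cross-ratio; as neither side exceeds 2, each is at least twice the cross-ratio.\<close>
  have "visual_dist z p q * visual_dist z r s = visual_dist z p r * visual_dist z q s * crr p q r s"
    "visual_dist z q r * visual_dist z s p = visual_dist z p r * visual_dist z q s * crr q r s p"
    using ne D unfolding visual_dist_def crr_def by (simp_all add: norm_minus_commute mult_ac)
  then have prod: "visual_dist z p q * visual_dist z r s = 4 * crr p q r s"
    "visual_dist z q r * visual_dist z s p = 4 * crr q r s p"
    using pr by simp_all
  have le: "visual_dist z a b \<le> 2" if "cmod a = 1" "cmod b = 1" for a b
    using visual_dist_le_2 z that by blast
  have ge: "0 \<le> visual_dist z a b" for a b
    using z by (simp add: visual_dist_def power_le_one_iff)
  have *: "2 * c \<le> x" "2 * c \<le> y" if "x * y = 4 * c" "x \<le> 2" "y \<le> 2" "0 \<le> x" "0 \<le> y" for x y c :: real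
    using mult_left_mono[of y 2 x] mult_right_mono[of x 2 y] that by auto
  show thesis
    using that[OF z] * pr prod le ge S by meson
qed


section \<open>Uniform bounds from compactness\<close>

lemma separated_images:
  assumes "circle_homeo f" "0 < \<delta>"
  obtains \<eta> where "0 < \<eta>"
    "\<And>p q. cmod p = 1 \<Longrightarrow> cmod q = 1 \<Longrightarrow> \<delta> \<le> cmod (p - q) \<Longrightarrow> \<eta> \<le> cmod (f p - f q)"
proof -
  define S where "S = {x \<in> sphere 0 1 \<times> sphere (0::complex) 1. \<delta> \<le> cmod (fst x - snd x)}"
  have "S = (sphere 0 1 \<times> sphere 0 1) \<inter> {x. \<delta> \<le> cmod (fst x - snd x)}"
    by (auto simp: S_def)
  then have "compact S"
    by (auto intro!: compact_Int_closed compact_Times closed_Collect_le continuous_intros)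
  have cont: "continuous_on S (\<lambda>x. cmod (f (fst x) - f (snd x)))"
  proof -
    have f: "continuous_on (sphere 0 1) f" using assms(1) by (simp add: circle_homeo_def)
    have "continuous_on S (\<lambda>x. f (fst x))" "continuous_on S (\<lambda>x. f (snd x))"
      by (rule continuous_on_compose2[OF f]; auto simp: S_def intro!: continuous_intros)+
    then show ?thesis by (intro continuous_on_norm continuous_on_diff)
  qed
  show thesis
  proof (cases "S = {}")
    case True
    then show thesis using that[of 1] by (auto simp: S_def)
  next
    case False
    obtain x where x: "x \<in> S" "\<And>y. y \<in> S \<Longrightarrow> cmod (f (fst x) - f (snd x)) \<le> cmod (f (fst y) - f (snd y))"
      using continuous_attains_inf[OF \<open>compact S\<close> False cont] by blast
    have "fst x \<noteq> snd x" using x(1) assms(2) by (auto simp: S_def)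
    then have "0 < cmod (f (fst x) - f (snd x))"
      using circle_homeo_eq_iff[OF assms(1)] x(1) by (auto simp: S_def)
    then show thesis
    proof (rule that)
      fix p q :: complex
      assume "cmod p = 1" "cmod q = 1" "\<delta> \<le> cmod (p - q)"
      then show "cmod (f (fst x) - f (snd x)) \<le> cmod (f p - f q)"
        using x(2)[of "(p, q)"] by (simp add: S_def)
    qed
  qed
qed

text \<open>The covering condition of \<open>closed_surface_group\<close> read through inverses:
  some element moves a given centre into \<open>K\<close>, which is the normalisation needed
  next.\<close>

definition cocompact :: "(complex \<Rightarrow> complex) set \<Rightarrow> bool" where
  "cocompact H \<longleftrightarrow> (\<exists>K. compact K \<and> K \<subseteq> ball 0 1 \<and> (\<forall>z\<in>ball 0 1. \<exists>h\<in>H. h z \<in> K))"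

lemma isometry_mem:
  assumes "g \<in> disc_isometries" "cmod p = 1"
  shows "cmod (g p) = 1"
proof -
  obtain w t where "cmod w < 1" "\<forall>z. cmod z \<le> 1 \<longrightarrow> g z = Moebius_function t w z"
    using disc_isometriesE[OF assms(1)] .
  then show ?thesis using assms(2) by (simp add: cmod_Moebius_sphere)
qed

lemma le_divide_denom:
  fixes a b c :: real
  assumes "1 \<le> a / (b * c)" "0 < b" "0 < c" shows "b * c \<le> a"
  using assms by (simp add: le_divide_eq)

text \<open>A quadruple of cross-ratio 1/2 has all mutual visual distances at least 1 from the
  crossing point \<open>z\<close> of its diagonals. Moving \<open>z\<close> into \<open>K\<close> by
  some \<open>h\<close> makes the points uniformly separated, hence also their images under
  \<open>f\<close>. By equivariance \<open>h\<close> acts on the image side as an isometry, which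
  leaves the cross-ratio unchanged.\<close>

lemma half_crr_bounds:
  assumes f: "circle_homeo f" and H: "H \<subseteq> disc_isometries" "cocompact H"
    and equi: "\<And>h. h \<in> H \<Longrightarrow> \<exists>g\<in>disc_isometries. \<forall>x\<in>sphere 0 1. f (h x) = g (f x)"
  obtains \<kappa> where "0 < \<kappa>" "\<kappa> < 1"
    "\<And>p q r s. cyclic4 p q r s \<Longrightarrow> crr p q r s = 1 / 2 \<Longrightarrow>
       \<kappa> \<le> crr (f p) (f q) (f r) (f s) \<and> crr (f p) (f q) (f r) (f s) \<le> 1 - \<kappa>"
proof -
  obtain K where K: "compact K" "K \<subseteq> ball 0 1" "\<And>z. cmod z < 1 \<Longrightarrow> \<exists>h\<in>H. h z \<in> K"
    using H(2) unfolding cocompact_def by auto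
  have "\<exists>R<1. \<forall>z\<in>K. cmod z \<le> R"
  proof (cases "K = {}")
    case False
    then obtain x where "x \<in> K" "\<forall>y\<in>K. cmod y \<le> cmod x"
      using continuous_attains_sup[OF K(1), of cmod] continuous_on_norm_id by blast
    then show ?thesis using K(2) by (intro exI[of _ "cmod x"]) auto
  qed (auto intro: exI[of _ 0])
  then obtain R where R: "R < 1" "\<And>z. z \<in> K \<Longrightarrow> cmod z \<le> R" by blast
  \<comment> \<open>Points of the circle have distance at least \<open>1 - R\<close> from points of
    \<open>K\<close>, so visual distance at least 1 from a point of \<open>K\<close> forces a chord
    of length at least \<open>(1 - R)\<^sup>2\<close>.\<close>
  obtain \<eta> where \<eta>: "0 < \<eta>"
    "\<And>p q. cmod p = 1 \<Longrightarrow> cmod q = 1 \<Longrightarrow> (1 - R)\<^sup>2 \<le> cmod (p - q) \<Longrightarrow> \<eta> \<le> cmod (f p - f q)"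
    using separated_images[OF f, of "(1 - R)\<^sup>2"] R(1) by auto
  \<comment> \<open>The numerator of a cross-ratio of images is at least
    \<open>\<eta>\<^sup>2\<close> and the denominator at most \<open>2 * 2\<close>. The minimum with
    1/2 keeps \<open>\<kappa>\<close> below 1.\<close>
  define \<kappa> where "\<kappa> = min (1 / 2) (\<eta>\<^sup>2 / 4)"
  have "\<kappa> \<le> crr (f p) (f q) (f r) (f s) \<and> crr (f p) (f q) (f r) (f s) \<le> 1 - \<kappa>"
    if c: "cyclic4 p q r s" "crr p q r s = 1 / 2" for p q r s
  proof -
    have S: "cmod p = 1" "cmod q = 1" "cmod r = 1" "cmod s = 1"
      using cyclic4_sphere[OF c(1)] by auto
    have c': "crr q r s p = 1 / 2" using crr_add[OF c(1)] c(2) by simp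
    obtain z where z0: "cmod z < 1" "2 * crr p q r s \<le> visual_dist z p q" "2 * crr p q r s \<le> visual_dist z r s"
      "2 * crr q r s p \<le> visual_dist z q r" "2 * crr q r s p \<le> visual_dist z s p"
      "visual_dist z p r = 2" "visual_dist z q s = 2"
      using cyclic4_center[OF c(1)] .
    then have z: "cmod z < 1" "1 \<le> visual_dist z p q" "1 \<le> visual_dist z r s"
      "1 \<le> visual_dist z q r" "1 \<le> visual_dist z s p" "1 \<le> visual_dist z p r" "1 \<le> visual_dist z q s"
      by (simp_all add: c(2) c')
    obtain h where h: "h \<in> H" "h z \<in> K" using K(3)[OF z(1)] by blast
    obtain g where g: "g \<in> disc_isometries" "\<And>x. cmod x = 1 \<Longrightarrow> f (h x) = g (f x)"
      using equi[OF h(1)] by auto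
    have hiso: "h \<in> disc_isometries" using h(1) H(1) by blast
    have hz: "cmod (h z) \<le> R" "cmod (h z) < 1" using R h(2) by fastforce+
    have far: "\<eta> \<le> cmod (f (h x) - f (h y))"
      if xy: "cmod x = 1" "cmod y = 1" "1 \<le> visual_dist z x y" for x y
    proof -
      have hx: "cmod (h x) = 1" "cmod (h y) = 1" using isometry_mem[OF hiso] xy by auto
      have ge: "1 - R \<le> cmod (h x - h z)" "1 - R \<le> cmod (h y - h z)"
        using norm_triangle_ineq2[of "h x" "h z"] norm_triangle_ineq2[of "h y" "h z"] hx hz(1) by auto
      have "1 \<le> visual_dist (h z) (h x) (h y)"
        using visual_dist_isometry[OF hiso z(1) xy(1,2)] xy(3) by simp
      then have "cmod (h x - h z) * cmod (h y - h z) \<le> cmod (h x - h y) * (1 - (cmod (h z))\<^sup>2)"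
        unfolding visual_dist_def by (rule le_divide_denom) (use ge R(1) in auto)
      also have "\<dots> \<le> cmod (h x - h y)"
        by (intro mult_left_le) auto
      finally have "cmod (h x - h z) * cmod (h y - h z) \<le> cmod (h x - h y)" .
      moreover have "(1 - R) * (1 - R) \<le> cmod (h x - h z) * cmod (h y - h z)"
        using ge R(1) by (intro mult_mono) auto
      ultimately show ?thesis
        using \<eta>(2)[OF hx] by (simp add: power2_eq_square)
    qed
    have unit: "cmod (f (h x)) = 1" "cmod (f x) = 1" if "cmod x = 1" for x
      using circle_homeo_mem[OF f] isometry_mem[OF hiso] that by auto
    have le2: "cmod (f (h x) - f (h y)) \<le> 2" if "cmod x = 1" "cmod y = 1" for x y
      using norm_triangle_ineq4[of "f (h x)" "f (h y)"] unit that by simp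
    have low: "\<eta>\<^sup>2 / 4 \<le> crr (f a) (f b) (f c) (f d)"
      if u: "cmod a = 1" "cmod b = 1" "cmod c = 1" "cmod d = 1" and
        v: "1 \<le> visual_dist z a b" "1 \<le> visual_dist z c d" "1 \<le> visual_dist z a c" "1 \<le> visual_dist z b d"
      for a b c d
    proof -
      have "crr (f a) (f b) (f c) (f d) = crr (f (h a)) (f (h b)) (f (h c)) (f (h d))"
        using crr_isometry[OF g(1)] unit(2) u g(2) by simp
      moreover have "\<eta>\<^sup>2 / 4 \<le> crr (f (h a)) (f (h b)) (f (h c)) (f (h d))"
      proof -
        have "\<eta> * \<eta> \<le> cmod (f (h a) - f (h b)) * cmod (f (h c) - f (h d))"
          using far u v \<eta>(1) by (intro mult_mono) auto
        moreover have "cmod (f (h a) - f (h c)) * cmod (f (h b) - f (h d)) \<le> 2 * 2"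
          using le2 u by (intro mult_mono) auto
        moreover have "0 < cmod (f (h a) - f (h c)) * cmod (f (h b) - f (h d))"
          using far[OF u(1,3) v(3)] far[OF u(2,4) v(4)] \<eta>(1) by (intro mult_pos_pos) linarith+
        ultimately show ?thesis
          unfolding crr_def power2_eq_square by (intro frac_le) auto
      qed
      ultimately show ?thesis by simp
    qed
    have sym: "visual_dist z a b = visual_dist z b a" for a b
      by (simp add: visual_dist_def norm_minus_commute mult.commute)
    \<comment> \<open>A lower bound for the opposite box; \<open>crr_add\<close> turns it into the
      upper bound \<open>1 - \<kappa>\<close>.\<close>
    have "\<eta>\<^sup>2 / 4 \<le> crr (f p) (f q) (f r) (f s)"
      using z S by (intro low) auto
    moreover have "\<eta>\<^sup>2 / 4 \<le> crr (f q) (f r) (f s) (f p)"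
      using z S sym[of q s] sym[of r p] by (intro low) auto
    ultimately show ?thesis
      using crr_add[OF circle_homeo_cyclic4[OF f c(1)]] by (auto simp: \<kappa>_def min_def)
  qed
  moreover have "0 < \<kappa>" "\<kappa> < 1" using \<eta>(1) by (auto simp: \<kappa>_def)
  ultimately show thesis using that by blast
qed

text \<open>Boxes are cut into pieces of cross-ratio one half, so that the bound for a single piece
  controls how a homeomorphism distorts arbitrary cross-ratios.\<close>

lemma crr_distortion_upper:
  assumes f: "circle_homeo f" and \<kappa>: "0 < \<kappa>" "\<kappa> < 1"
    and half: "\<And>p q r s. cyclic4 p q r s \<Longrightarrow> crr p q r s = 1 / 2 \<Longrightarrow> crr (f p) (f q) (f r) (f s) \<le> 1 - \<kappa>"
    and c: "cyclic4 p q r s" "crr p q r s \<le> (1 / 2) ^ n"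
  shows "crr (f p) (f q) (f r) (f s) \<le> (1 - \<kappa>) ^ n"
  using c
proof (induction n arbitrary: p q r s)
  case 0
  then show ?case
    using crr_bounds[OF circle_homeo_cyclic4[OF f 0(1)]] by simp
next
  case (Suc n)
  show ?case
  proof (cases "crr p q r s = 1 / 2")
    case True
    \<comment> \<open>The value 1/2 itself leaves no room for a strict cut, but then the hypothesis
      forces \<open>n = 0\<close> and the bound for a single piece is enough.\<close>
    then have "(1 / 2) ^ 0 \<le> (1 / 2 :: real) ^ n" using Suc.prems(2) by simp
    then have "n = 0" by (subst (asm) power_decreasing_iff) auto
    then show ?thesis using half[OF Suc.prems(1) True] by simp
  next
    case False
    have "crr p q r s \<le> 1 / 2 * 1"
      using Suc.prems(2) power_le_one[of "1 / 2 :: real" n] by simp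
    with False have "crr p q r s < 1 / 2" by simp
    then obtain x where x: "cyclic4 p q x s" "cyclic4 p x r s" "crr p q x s = 1 / 2 \<or> crr p x r s = 1 / 2"
      using cyclic4_subdivide[OF Suc.prems(1), of "1 / 2"] by auto
    have fx: "cyclic4 (f p) (f q) (f x) (f s)" "cyclic4 (f p) (f x) (f r) (f s)"
      using circle_homeo_cyclic4[OF f] x(1,2) by auto
    have m: "crr p q r s = crr p q x s * crr p x r s"
      using cyclic4_distinct[OF x(1)] by (intro crr_mult) auto
    have fm: "crr (f p) (f q) (f r) (f s) = crr (f p) (f q) (f x) (f s) * crr (f p) (f x) (f r) (f s)"
      using cyclic4_distinct[OF fx(1)] by (intro crr_mult) auto
    show ?thesis
      using x(3)
    proof
      assume h: "crr p q x s = 1 / 2"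
      then have "crr p x r s \<le> (1 / 2) ^ n" using m Suc.prems(2) by (simp add: h)
      then show ?thesis
        using half[OF x(1) h] Suc.IH[OF x(2)] crr_bounds[OF fx(1)] crr_bounds[OF fx(2)] \<kappa>
        unfolding fm power_Suc by (intro mult_mono) auto
    next
      assume h: "crr p x r s = 1 / 2"
      then have "crr p q x s \<le> (1 / 2) ^ n" using m Suc.prems(2) by (simp add: h)
      then show ?thesis
        using half[OF x(2) h] Suc.IH[OF x(1)] crr_bounds[OF fx(1)] crr_bounds[OF fx(2)] \<kappa>
        unfolding fm power_Suc2 by (intro mult_mono) auto
    qed
  qed
qed

text \<open>The subdivision ends as soon as the cross-ratio is at least 1/2. The opposite box then
  has value at most 1/2, its image value is at most \<open>1 - \<kappa>\<close>, and the complement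
  is at least \<open>\<kappa>\<close>.\<close>

lemma crr_distortion_lower:
  assumes f: "circle_homeo f" and \<kappa>: "0 < \<kappa>" "\<kappa> < 1"
    and half: "\<And>p q r s. cyclic4 p q r s \<Longrightarrow> crr p q r s = 1 / 2 \<Longrightarrow>
       \<kappa> \<le> crr (f p) (f q) (f r) (f s) \<and> crr (f p) (f q) (f r) (f s) \<le> 1 - \<kappa>"
    and c: "cyclic4 p q r s" "(1 / 2) ^ n \<le> crr p q r s"
  shows "\<kappa> ^ n \<le> crr (f p) (f q) (f r) (f s)"
  using c
proof (induction n arbitrary: p q r s)
  \<comment> \<open>For \<open>n = 0\<close> the hypothesis contradicts
    \<open>crr p q r s < 1\<close>.\<close>
  case 0
  then show ?case
    using crr_bounds[OF 0(1)] by simp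
next
  case (Suc n)
  show ?case
  proof (cases "1 / 2 \<le> crr p q r s")
    case True
    have "crr q r s p \<le> (1 / 2) ^ 1" using crr_add[OF Suc.prems(1)] True by simp
    then have "crr (f q) (f r) (f s) (f p) \<le> (1 - \<kappa>) ^ 1"
      using half cyclic4_rotate[OF Suc.prems(1)] by (intro crr_distortion_upper[OF f \<kappa>]) auto
    then have "\<kappa> \<le> crr (f p) (f q) (f r) (f s)"
      using crr_add[OF circle_homeo_cyclic4[OF f Suc.prems(1)]] by simp
    moreover have "\<kappa> ^ Suc n \<le> \<kappa>"
      using \<kappa> power_decreasing[of 1 "Suc n" \<kappa>] by simp
    ultimately show ?thesis by simp
  next
    case False
    then obtain x where x: "cyclic4 p q x s" "cyclic4 p x r s" "crr p q x s = 1 / 2 \<or> crr p x r s = 1 / 2"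
      using cyclic4_subdivide[OF Suc.prems(1), of "1 / 2"] by auto
    have fx: "cyclic4 (f p) (f q) (f x) (f s)" "cyclic4 (f p) (f x) (f r) (f s)"
      using circle_homeo_cyclic4[OF f] x(1,2) by auto
    have m: "crr p q r s = crr p q x s * crr p x r s"
      using cyclic4_distinct[OF x(1)] by (intro crr_mult) auto
    have fm: "crr (f p) (f q) (f r) (f s) = crr (f p) (f q) (f x) (f s) * crr (f p) (f x) (f r) (f s)"
      using cyclic4_distinct[OF fx(1)] by (intro crr_mult) auto
    show ?thesis
      using x(3)
    proof
      assume h: "crr p q x s = 1 / 2"
      then have "(1 / 2) ^ n \<le> crr p x r s" using m Suc.prems(2) by (simp add: h)
      then show ?thesis
        using half[OF x(1) h] Suc.IH[OF x(2)] crr_bounds[OF fx(1)] crr_bounds[OF fx(2)] \<kappa>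
        unfolding fm power_Suc by (intro mult_mono) auto
    next
      assume h: "crr p x r s = 1 / 2"
      then have "(1 / 2) ^ n \<le> crr p q x s" using m Suc.prems(2) by (simp add: h)
      then show ?thesis
        using half[OF x(2) h] Suc.IH[OF x(1)] crr_bounds[OF fx(1)] crr_bounds[OF fx(2)] \<kappa>
        unfolding fm power_Suc2 by (intro mult_mono) auto
    qed
  qed
qed

subsection \<open>The Klein model and the dual pseudometric\<close>

lemma hdist_ln:
  assumes "cmod z < 1" "cmod w < 1"
  defines "m \<equiv> cmod (Moebius_function 0 w z)"
  shows "0 \<le> m" "m < 1" "hdist z w = ln ((1 + m) / (1 - m))"
proof -
  show "0 \<le> m" by (simp add: m_def)
  have "cmod (1 - cnj w * z) \<noteq> 0" using Moebius_denom_nonzero assms by simp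
  then have "0 < (1 - (cmod z)\<^sup>2) * (1 - (cmod w)\<^sup>2) / (cmod (1 - cnj w * z))\<^sup>2"
    using assms by (intro divide_pos_pos mult_pos_pos) (auto simp: power_less_one_iff)
  then have "m\<^sup>2 < 1\<^sup>2"
    using norm_Moebius[of w z 0] assms(1,2) by (simp add: m_def)
  then show "m < 1" by (rule power2_less_imp_less) simp
  show "hdist z w = ln ((1 + m) / (1 - m))"
    by (simp add: hdist_def m_def artanh_def)
qed

lemma hdist_nonneg:
  assumes "cmod z < 1" "cmod w < 1" shows "0 \<le> hdist z w"
  unfolding hdist_ln(3)[OF assms] using hdist_ln(1,2)[OF assms]
  by (intro ln_ge_zero) (simp add: le_divide_eq)

lemma hdist_self [simp]: "hdist z z = 0"
  by (simp add: hdist_def Moebius_function_def)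

lemma hdist_pos:
  assumes "cmod z < 1" "cmod w < 1" "z \<noteq> w" shows "0 < hdist z w"
proof -
  have "Moebius_function 0 w z \<noteq> 0"
    using assms Moebius_denom_nonzero[of w z] by (simp add: Moebius_function_def)
  then show ?thesis
    unfolding hdist_ln(3)[OF assms(1,2)] using hdist_ln(2)[OF assms(1,2)]
    by (intro ln_gt_zero) (simp add: less_divide_eq)
qed

lemma klein_gap: 
  assumes "cmod z < 1"
  shows "sqrt (1 - (cmod (klein z))\<^sup>2) = (1 - (cmod z)\<^sup>2) / (1 + (cmod z)\<^sup>2)"
  using assms one_plus_sq_pos[of z] by (simp only: klein_norm real_sqrt_abs) (simp add: power_le_one_iff)

text \<open>The right side is the Minkowski product of the vectors \<open>(klein z, 1)\<close> and
  \<open>(klein w, 1)\<close> normalised to the hyperboloid. It comes out of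
  \<open>cosh (2 * artanh m) = 2 / (1 - m\<^sup>2) - 1\<close>.\<close>

lemma cosh_hdist:
  assumes "cmod z < 1" "cmod w < 1"
  shows "cosh (hdist z w) = (1 - klein z \<bullet> klein w) /
     (sqrt (1 - (cmod (klein z))\<^sup>2) * sqrt (1 - (cmod (klein w))\<^sup>2))"
proof -
  define m where "m = cmod (Moebius_function 0 w z)"
  define a b c where "a = (cmod z)\<^sup>2" "b = (cmod w)\<^sup>2" "c = z \<bullet> w"
  note abc = this
  have m: "0 \<le> m" "m < 1" "hdist z w = ln ((1 + m) / (1 - m))"
    unfolding m_def using hdist_ln[OF assms] by auto
  have ab: "1 - a > 0" "1 - b > 0" "1 + a > 0" "1 + b > 0"
    using assms one_plus_sq_pos by (auto simp: abc power_less_one_iff)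
  have D: "(cmod (1 - cnj w * z))\<^sup>2 = 1 + a * b - 2 * c"
    using cmod_one_minus_cnj_mult[of w z] cmod_diff_sq[of z w] by (simp add: abc algebra_simps)
  have D0: "(cmod (1 - cnj w * z))\<^sup>2 \<noteq> 0" using Moebius_denom_nonzero assms by simp
  have m2: "1 - m\<^sup>2 = (1 - a) * (1 - b) / (1 + a * b - 2 * c)"
    using norm_Moebius[of w z 0] assms unfolding m_def D abc by simp
  have "cosh (hdist z w) = ((1 + m) / (1 - m) + inverse ((1 + m) / (1 - m))) / 2"
    unfolding m(3) using m by (intro cosh_ln_real) simp
  also have "\<dots> = 2 / (1 - m\<^sup>2) - 1"
    using m power_less_one_iff[of m 2] by (simp add: divide_simps power2_eq_square) (simp add: algebra_simps)
  also have "\<dots> = 2 * (1 + a * b - 2 * c) / ((1 - a) * (1 - b)) - 1"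
    unfolding m2 by simp
  also have "\<dots> = (1 - (2 / (1 + a)) * (2 / (1 + b)) * c) / ((1 - a) / (1 + a) * ((1 - b) / (1 + b)))"
    using ab by (simp add: divide_simps) (simp add: algebra_simps)
  finally show ?thesis
    unfolding klein_gap[OF assms(1)] klein_gap[OF assms(2)] by (simp add: klein_def abc)
qed

text \<open>Additivity of distances becomes polynomial in the hyperbolic cosines:
  \<open>cosh f - cosh d * cosh e\<close> must equal the nonnegative \<open>sinh d * sinh e\<close>,
  and squaring is reversible once the sign is known.\<close>

lemma cosh_sum_iff:
  fixes d e f :: real
  assumes "0 \<le> d" "0 \<le> e" "0 \<le> f"
  shows "d + e = f \<longleftrightarrow> cosh d * cosh e \<le> cosh f \<and>
    (cosh f - cosh d * cosh e)\<^sup>2 = ((cosh d)\<^sup>2 - 1) * ((cosh e)\<^sup>2 - 1)"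
proof -
  have s: "(cosh x)\<^sup>2 - 1 = (sinh x)\<^sup>2" for x :: real
    by (simp add: cosh_square_eq)
  have nn: "0 \<le> sinh d * sinh e" using assms by simp
  have "d + e = f \<longleftrightarrow> cosh (d + e) = cosh f"
    using assms cosh_real_nonneg_le_iff[of "d + e" f] cosh_real_nonneg_le_iff[of f "d + e"] by auto
  also have "\<dots> \<longleftrightarrow> cosh f - cosh d * cosh e = sinh d * sinh e"
    by (auto simp: cosh_add)
  also have "\<dots> \<longleftrightarrow> cosh d * cosh e \<le> cosh f \<and> (cosh f - cosh d * cosh e)\<^sup>2 = (sinh d * sinh e)\<^sup>2"
    using nn power2_eq_imp_eq[of "cosh f - cosh d * cosh e" "sinh d * sinh e"] by auto
  finally show ?thesis
    by (simp add: s power_mult_distrib)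
qed

text \<open>The Gram determinant of the Minkowski vectors \<open>(x, 1), (y, 1), (z, 1)\<close> is minus the square of
  their determinant.\<close>

lemma gram_side:
  "(1 - (cmod x)\<^sup>2) * (1 - (cmod y)\<^sup>2) * (1 - (cmod z)\<^sup>2) + 2 * (1 - x \<bullet> y) * (1 - y \<bullet> z) * (1 - x \<bullet> z)
     - (1 - x \<bullet> z)\<^sup>2 * (1 - (cmod y)\<^sup>2) - (1 - z \<bullet> y)\<^sup>2 * (1 - (cmod x)\<^sup>2) - (1 - x \<bullet> y)\<^sup>2 * (1 - (cmod z)\<^sup>2)
   = (side x y z)\<^sup>2"
  unfolding side_def cmod_power2 inner_complex_def
  by (simp add: power2_eq_square) (simp add: algebra_simps)

text \<open>Here a unit vector is written with coefficients \<open>lam\<close>, \<open>mu\<close> in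
  two unit vectors of product \<open>C\<close>; \<open>A\<close> and \<open>B\<close> are its
  products with them, and the third hypothesis is its normalisation.\<close>

lemma segment_products:
  fixes lam mu A B C :: real
  assumes "A = lam + mu * C" "B = lam * C + mu" "lam\<^sup>2 + mu\<^sup>2 + 2 * lam * mu * C = 1"
  shows "C - A * B = lam * mu * (C\<^sup>2 - 1)" "A\<^sup>2 - 1 = mu\<^sup>2 * (C\<^sup>2 - 1)" "B\<^sup>2 - 1 = lam\<^sup>2 * (C\<^sup>2 - 1)"
proof -
  have "C - A * B = C * (lam\<^sup>2 + mu\<^sup>2 + 2 * lam * mu * C) - A * B" using assms(3) by simp
  then show "C - A * B = lam * mu * (C\<^sup>2 - 1)"
    unfolding assms(1,2) by (simp add: power2_eq_square algebra_simps)
  have "A\<^sup>2 - 1 = A\<^sup>2 - (lam\<^sup>2 + mu\<^sup>2 + 2 * lam * mu * C)" using assms(3) by simp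
  then show "A\<^sup>2 - 1 = mu\<^sup>2 * (C\<^sup>2 - 1)"
    unfolding assms(1,2) by (simp add: power2_eq_square algebra_simps)
  have "B\<^sup>2 - 1 = B\<^sup>2 - (lam\<^sup>2 + mu\<^sup>2 + 2 * lam * mu * C)" using assms(3) by simp
  then show "B\<^sup>2 - 1 = lam\<^sup>2 * (C\<^sup>2 - 1)"
    unfolding assms(1,2) by (simp add: power2_eq_square algebra_simps)
qed

text \<open>The squared equation of \<open>cosh_sum_iff\<close> says that the Gram determinant
  vanishes, which by \<open>gram_side\<close> is collinearity of the Klein points. On that line the
  sign condition \<open>A * B \<le> C\<close> means \<open>0 \<le> lam * mu\<close>, which singles
  out the segment.\<close>

lemma hdist_add_iff:
  assumes "cmod x < 1" "cmod y < 1" "cmod z < 1"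
  shows "hdist x z + hdist z y = hdist x y \<longleftrightarrow> klein z \<in> closed_segment (klein x) (klein y)"
proof (cases "x = y")
  case True
  have "hdist x z + hdist z x = 0 \<longleftrightarrow> z = x"
    using hdist_pos[OF assms(1,3)] hdist_pos[OF assms(3,1)] by force
  with True show ?thesis
    using klein_inj[of z x] assms by auto
next
  case False
  define X Y Z where "X = klein x" "Y = klein y" "Z = klein z"
  note XYZ = this
  have XY: "X \<noteq> Y" using False klein_inj[of x y] assms by (auto simp: XYZ)
  define a b c where "a = 1 / sqrt (1 - (cmod X)\<^sup>2)" "b = 1 / sqrt (1 - (cmod Y)\<^sup>2)" "c = 1 / sqrt (1 - (cmod Z)\<^sup>2)"
  note abc = this
  have gap: "0 < 1 - (cmod X)\<^sup>2" "0 < 1 - (cmod Y)\<^sup>2" "0 < 1 - (cmod Z)\<^sup>2"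
    using klein_ball assms by (auto simp: XYZ power_less_one_iff)
  then have pos: "0 < a" "0 < b" "0 < c" by (auto simp: abc)
  have sq: "a\<^sup>2 * (1 - (cmod X)\<^sup>2) = 1" "b\<^sup>2 * (1 - (cmod Y)\<^sup>2) = 1" "c\<^sup>2 * (1 - (cmod Z)\<^sup>2) = 1"
    using gap by (auto simp: abc power_divide)
  define A B C where "A = a * c * (1 - X \<bullet> Z)" "B = c * b * (1 - Z \<bullet> Y)" "C = a * b * (1 - X \<bullet> Y)"
  note ABC = this
  have cosh: "cosh (hdist x z) = A" "cosh (hdist z y) = B" "cosh (hdist x y) = C"
    using assms by (simp_all add: cosh_hdist ABC abc XYZ)
  have iff: "hdist x z + hdist z y = hdist x y \<longleftrightarrow> A * B \<le> C \<and> (C - A * B)\<^sup>2 = (A\<^sup>2 - 1) * (B\<^sup>2 - 1)"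
    using cosh_sum_iff[of "hdist x z" "hdist z y" "hdist x y"] hdist_nonneg assms by (simp add: cosh)
  have "1 < C"
    using cosh_real_nonneg_less_iff[of 0 "hdist x y"] hdist_pos[OF assms(1,2) False] cosh by simp
  then have C: "0 < C\<^sup>2 - 1" by (simp add: one_less_power)
  have on_line: "A * B \<le> C \<and> (C - A * B)\<^sup>2 = (A\<^sup>2 - 1) * (B\<^sup>2 - 1) \<longleftrightarrow> 0 \<le> t \<and> t \<le> 1"
    if Z: "Z = (1 - t) *\<^sub>R X + t *\<^sub>R Y" for t
  proof -
    \<comment> \<open>The coefficients in \<open>c Z = lam (a X) + mu (b Y)\<close>, where
      \<open>a\<close>, \<open>b\<close>, \<open>c\<close> normalise the three vectors to the
      hyperboloid.\<close>
    define lam mu where "lam = c * (1 - t) / a" "mu = c * t / b"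
    note lm = this
    have "A = c * (1 - t) / a * (a\<^sup>2 * (1 - (cmod X)\<^sup>2)) + c * t / b * C"
      using pos unfolding ABC Z power2_norm_eq_inner
      by (simp add: inner_right_distrib inner_diff_right field_simps power2_eq_square)
    then have 1: "A = lam + mu * C" unfolding sq lm by simp
    have "B = c * (1 - t) / a * C + c * t / b * (b\<^sup>2 * (1 - (cmod Y)\<^sup>2))"
      using pos unfolding ABC Z power2_norm_eq_inner
      by (simp add: inner_left_distrib inner_diff_left field_simps power2_eq_square)
    then have 2: "B = lam * C + mu" unfolding sq lm by simp
    have nZ: "1 - (cmod Z)\<^sup>2 = (1 - t)\<^sup>2 * (1 - (cmod X)\<^sup>2) + t\<^sup>2 * (1 - (cmod Y)\<^sup>2) + 2 * t * (1 - t) * (1 - X \<bullet> Y)"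
      unfolding Z power2_norm_eq_inner
      by (simp add: inner_left_distrib inner_right_distrib inner_commute power2_eq_square algebra_simps)
    have "1 = c\<^sup>2 * (1 - (cmod Z)\<^sup>2)" using sq by simp
    also have "\<dots> = (c * (1 - t) / a)\<^sup>2 * (a\<^sup>2 * (1 - (cmod X)\<^sup>2)) + (c * t / b)\<^sup>2 * (b\<^sup>2 * (1 - (cmod Y)\<^sup>2))
        + 2 * (c * (1 - t) / a) * (c * t / b) * C"
      unfolding nZ ABC using pos by (simp add: field_simps power2_eq_square)
    finally have 3: "lam\<^sup>2 + mu\<^sup>2 + 2 * lam * mu * C = 1" unfolding sq lm by simp
    note S = segment_products[OF 1 2 3]
    have "(C - A * B)\<^sup>2 = (A\<^sup>2 - 1) * (B\<^sup>2 - 1)"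
      unfolding S by (simp add: power2_eq_square)
    moreover have "A * B \<le> C \<longleftrightarrow> 0 \<le> lam * mu"
      using S(1) C by (metis diff_ge_0_iff_ge zero_le_mult_iff less_le_not_le)
    moreover have "0 \<le> lam * mu \<longleftrightarrow> 0 \<le> (1 - t) * t"
      using pos unfolding lm by (simp add: zero_le_mult_iff zero_le_divide_iff mult_le_0_iff divide_le_0_iff)
    moreover have "0 \<le> (1 - t) * t \<longleftrightarrow> 0 \<le> t \<and> t \<le> 1"
      by (auto simp: zero_le_mult_iff)
    ultimately show ?thesis by simp
  qed
  show ?thesis
  proof
    assume "hdist x z + hdist z y = hdist x y"
    then have eq: "A * B \<le> C" "(C - A * B)\<^sup>2 = (A\<^sup>2 - 1) * (B\<^sup>2 - 1)" using iff by auto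
    have "(side X Y Z)\<^sup>2 * (a\<^sup>2 * b\<^sup>2 * c\<^sup>2) =
        (a\<^sup>2 * (1 - (cmod X)\<^sup>2)) * (b\<^sup>2 * (1 - (cmod Y)\<^sup>2)) * (c\<^sup>2 * (1 - (cmod Z)\<^sup>2)) + 2 * C * B * A
        - A\<^sup>2 * (b\<^sup>2 * (1 - (cmod Y)\<^sup>2)) - B\<^sup>2 * (a\<^sup>2 * (1 - (cmod X)\<^sup>2)) - C\<^sup>2 * (c\<^sup>2 * (1 - (cmod Z)\<^sup>2))"
      unfolding gram_side[symmetric] ABC inner_commute[of Z Y]
      by (simp only: power2_eq_square ring_distribs mult_ac right_diff_distrib left_diff_distrib)
    also have "\<dots> = 0"
      unfolding sq using eq(2) by (simp add: power2_eq_square algebra_simps)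
    finally have "side X Y Z = 0" using pos by simp
    then obtain t where t: "Z = (1 - t) *\<^sub>R X + t *\<^sub>R Y"
      using side_eq_0D XY by blast
    then have "0 \<le> t \<and> t \<le> 1" using on_line eq by blast
    then show "klein z \<in> closed_segment (klein x) (klein y)"
      using t unfolding closed_segment_def XYZ[symmetric] by blast
  next
    assume "klein z \<in> closed_segment (klein x) (klein y)"
    then obtain t where "Z = (1 - t) *\<^sub>R X + t *\<^sub>R Y" "0 \<le> t \<and> t \<le> 1"
      unfolding closed_segment_def XYZ[symmetric] by blast
    then show "hdist x z + hdist z y = hdist x y"
      using on_line iff by blast
  qed
qed

section \<open>Geodesics as chords\<close>

lemma klein_circle: "cmod a = 1 \<Longrightarrow> klein a = a"
  by (simp add: klein_def)

text \<open>The Minkowski vectors \<open>(a, 1)\<close> and \<open>(b, 1)\<close> are isotropic, so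
  only the mixed terms survive.\<close>

lemma chord_gap:
  assumes "cmod a = 1" "cmod b = 1"
  shows "1 - ((1 - s) *\<^sub>R a + s *\<^sub>R b) \<bullet> ((1 - t) *\<^sub>R a + t *\<^sub>R b) = (1 - a \<bullet> b) * (s * (1 - t) + t * (1 - s))"
proof -
  have "a \<bullet> a = 1" "b \<bullet> b = 1" using assms by (simp_all add: dot_square_norm)
  then show ?thesis
    by (simp add: inner_left_distrib inner_right_distrib inner_commute[of b a] algebra_simps)
qed

lemma chord_weight:
  assumes "cmod a = 1" "cmod b = 1" "cmod ((1 - t) *\<^sub>R a + t *\<^sub>R b) < 1"
  shows "0 < t" "t < 1"
proof -
  have "(cmod ((1 - t) *\<^sub>R a + t *\<^sub>R b))\<^sup>2 < 1"
    using assms(3) by (simp add: power_less_one_iff)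
  then have "0 < (1 - a \<bullet> b) * (t * (1 - t) + t * (1 - t))"
    using chord_gap[OF assms(1,2), of t t] unfolding power2_norm_eq_inner by linarith
  moreover have "0 \<le> 1 - a \<bullet> b"
    using norm_cauchy_schwarz[of a b] assms by simp
  ultimately have "0 < t * (1 - t)"
    by (simp add: zero_less_mult_iff)
  then show "0 < t" "t < 1" by (auto simp: zero_less_mult_iff)
qed

lemma inner_circle_less_1:
  assumes "cmod a = 1" "cmod b = 1" "a \<noteq> b" shows "a \<bullet> b < 1"
  using cmod_diff_sq[of a b] assms zero_less_power2[of "cmod (a - b)"] by simp

lemma geodesic_line_exists:
  assumes "cmod a = 1" "cmod b = 1" "a \<noteq> b"
  obtains \<gamma> where "geodesic_line \<gamma>" "(\<gamma> \<longlongrightarrow> a) at_bot" "(\<gamma> \<longlongrightarrow> b) at_top"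
    "\<forall>z. cmod z < 1 \<and> side a b (klein z) = 0 \<longrightarrow> z \<in> range \<gamma>"
proof -
  \<comment> \<open>On the hyperboloid the unit-speed geodesic is proportional to
    \<open>exp (- t) (a, 1) + exp t (b, 1)\<close>; rescaling the last coordinate to 1 gives these
    weights.\<close>
  define w :: "real \<Rightarrow> real" where "w t = exp t / (exp t + exp (- t))" for t
  define V where "V t = (1 - w t) *\<^sub>R a + w t *\<^sub>R b" for t
  define \<gamma> where "\<gamma> t = unklein (V t)" for t
  have E: "exp t + exp (- t) \<noteq> 0" for t :: real
    by (metis add_pos_pos exp_gt_zero less_irrefl)
  have w1: "1 - w t = exp (- t) / (exp t + exp (- t))" for t
    using E[of t] by (simp add: w_def field_simps)
  have w01: "0 < w t" "w t < 1" for t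
    using w1[of t] by (auto simp: w_def add_pos_pos intro!: divide_pos_pos)
  define c where "c = 1 - a \<bullet> b"
  have c: "0 < c" using inner_circle_less_1[OF assms] by (simp add: c_def)
  have gapV: "1 - (cmod (V t))\<^sup>2 = 2 * c / (exp t + exp (- t))\<^sup>2" for t
  proof -
    have "1 - (cmod (V t))\<^sup>2 = c * (2 * (w t * (1 - w t)))"
      unfolding power2_norm_eq_inner V_def chord_gap[OF assms(1,2)] c_def by simp
    also have "\<dots> = 2 * c * (exp t * exp (- t)) / (exp t + exp (- t))\<^sup>2"
      unfolding w1 unfolding w_def by (simp add: power2_eq_square)
    also have "exp t * exp (- t) = 1" by (simp flip: exp_add)
    finally show ?thesis by simp
  qed
  have V1: "cmod (V t) < 1" for t
  proof -
    have "0 < 2 * c / (exp t + exp (- t))\<^sup>2" using c E[of t] by simp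
    then have "(cmod (V t))\<^sup>2 < 1\<^sup>2" by (simp flip: gapV)
    then show ?thesis by (rule power2_less_imp_less) simp
  qed
  have \<gamma>1: "cmod (\<gamma> t) < 1" and k\<gamma>: "klein (\<gamma> t) = V t" for t
    unfolding \<gamma>_def using V1[of t] unklein_ball klein_unklein by (auto simp: less_imp_le)
  have "hdist (\<gamma> s) (\<gamma> t) = \<bar>s - t\<bar>" for s t
  proof -
    have sq: "sqrt (1 - (cmod (V t))\<^sup>2) = sqrt (2 * c) / (exp t + exp (- t))" for t
      unfolding gapV by (simp add: real_sqrt_divide)
    have 1: "1 - V s \<bullet> V t = c * ((exp s * exp (- t) + exp t * exp (- s)) / ((exp s + exp (- s)) * (exp t + exp (- t))))"
    proof -
      have "1 - V s \<bullet> V t = c * (w s * (1 - w t) + w t * (1 - w s))"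
        unfolding V_def chord_gap[OF assms(1,2)] c_def ..
      then show ?thesis
        unfolding w1 unfolding w_def by (simp add: add_divide_distrib mult.commute)
    qed
    have "cosh (hdist (\<gamma> s) (\<gamma> t)) = (1 - V s \<bullet> V t) / (sqrt (1 - (cmod (V s))\<^sup>2) * sqrt (1 - (cmod (V t))\<^sup>2))"
      using cosh_hdist[OF \<gamma>1 \<gamma>1] k\<gamma> by simp
    also have "\<dots> = (exp s * exp (- t) + exp t * exp (- s)) / 2"
    proof -
      have "c * (m / (e * f)) / (h / e * (h / f)) = m / 2"
        if "e \<noteq> 0" "f \<noteq> 0" "h * h = 2 * c" for m e f h :: real
      proof -
        have "c * (m / (e * f)) / (h / e * (h / f)) = c * m / (h * h)"
          using that(1,2) by simp
        then show ?thesis using that(3) c by simp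
      qed
      then show ?thesis unfolding sq 1 using E c by simp
    qed
    also have "\<dots> = cosh \<bar>s - t\<bar>"
      by (cases "s \<le> t") (simp_all add: cosh_def flip: exp_add)
    finally have "cosh (hdist (\<gamma> s) (\<gamma> t)) = cosh \<bar>s - t\<bar>" .
    then show ?thesis
      using cosh_real_nonneg_le_iff[of "hdist (\<gamma> s) (\<gamma> t)" "\<bar>s - t\<bar>"]
        cosh_real_nonneg_le_iff[of "\<bar>s - t\<bar>" "hdist (\<gamma> s) (\<gamma> t)"] hdist_nonneg[OF \<gamma>1 \<gamma>1] by simp
  qed
  then have line: "geodesic_line \<gamma>"
    using \<gamma>1 unfolding geodesic_line_def by auto
  have unk: "(\<gamma> \<longlongrightarrow> e) F" if "(V \<longlongrightarrow> e) F" "cmod e = 1" for e F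
  proof -
    have "((\<lambda>t. (1 / (1 + sqrt (1 - (cmod (V t))\<^sup>2))) *\<^sub>R V t) \<longlongrightarrow> (1 / (1 + sqrt (1 - (cmod e)\<^sup>2))) *\<^sub>R e) F"
      by (intro tendsto_intros that(1)) (use that(2) in auto)
    then show ?thesis using that(2) by (simp add: \<gamma>_def[abs_def] unklein_def)
  qed
  have "(w \<longlongrightarrow> 1) at_top" "(w \<longlongrightarrow> 0) at_bot"
    unfolding w_def[abs_def] by real_asymp+
  moreover have "(V \<longlongrightarrow> (1 - l) *\<^sub>R a + l *\<^sub>R b) F" if "(w \<longlongrightarrow> l) F" for l F
    unfolding V_def[abs_def] by (intro tendsto_add tendsto_scaleR tendsto_diff tendsto_const that)
  ultimately have "(V \<longlongrightarrow> (1 - 1) *\<^sub>R a + 1 *\<^sub>R b) at_top" "(V \<longlongrightarrow> (1 - 0) *\<^sub>R a + 0 *\<^sub>R b) at_bot"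
    by blast+
  then have lim: "(\<gamma> \<longlongrightarrow> a) at_bot" "(\<gamma> \<longlongrightarrow> b) at_top"
    using unk assms(1,2) by auto
  have "z \<in> range \<gamma>" if z: "cmod z < 1" "side a b (klein z) = 0" for z
  proof -
    obtain u where u: "klein z = (1 - u) *\<^sub>R a + u *\<^sub>R b" using side_eq_0D[OF z(2) assms(3)] .
    then have "cmod ((1 - u) *\<^sub>R a + u *\<^sub>R b) < 1" using klein_ball[OF z(1)] by simp
    then have u01: "0 < u" "u < 1" using chord_weight[OF assms(1,2)] by blast+
    \<comment> \<open>This solves \<open>w t = u\<close>, because
      \<open>w t / (1 - w t) = exp (2 * t)\<close>.\<close>
    define t where "t = ln (u / (1 - u)) / 2"
    have "exp t * exp t = u / (1 - u)"
      using u01 by (simp add: t_def flip: exp_add)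
    moreover have "w t = (exp t * exp t) / (exp t * exp t + 1)"
      unfolding w_def exp_minus by (simp add: field_simps)
    ultimately have "w t = (u / (1 - u)) / (u / (1 - u) + 1)" by simp
    also have "\<dots> = u" using u01 by (simp add: field_simps)
    finally have "w t = u" .
    then have "\<gamma> t = unklein (klein z)" by (simp add: \<gamma>_def V_def u)
    then show ?thesis using unklein_klein[of z] z(1) by (metis less_imp_le rangeI)
  qed
  with line lim show thesis using that by blast
qed

lemma continuous_klein: "continuous_on A klein"
  unfolding klein_def by (intro continuous_intros) (metis add_pos_nonneg less_irrefl zero_le_power2 zero_less_one)

text \<open>For large \<open>n\<close> the point \<open>\<gamma> t\<close> lies on the Klein segment
  from \<open>\<gamma> (- n)\<close> to \<open>\<gamma> n\<close>. Collinearity is a closed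
  condition and passes to the limit, where the ends are \<open>a\<close> and
  \<open>b\<close>.\<close>

lemma geodesic_line_on_chord:
  assumes "geodesic_line \<gamma>" "(\<gamma> \<longlongrightarrow> a) at_bot" "(\<gamma> \<longlongrightarrow> b) at_top" "cmod a = 1" "cmod b = 1"
  shows "side a b (klein (\<gamma> t)) = 0"
proof -
  have \<gamma>: "cmod (\<gamma> s) < 1" "hdist (\<gamma> s) (\<gamma> t) = \<bar>s - t\<bar>" for s t
    using assms(1) unfolding geodesic_line_def by (auto simp: image_subset_iff)
  have zero: "side (klein (\<gamma> (- n))) (klein (\<gamma> n)) (klein (\<gamma> t)) = 0" if n: "\<bar>t\<bar> \<le> n" for n
  proof -
    have "hdist (\<gamma> (- n)) (\<gamma> t) + hdist (\<gamma> t) (\<gamma> n) = hdist (\<gamma> (- n)) (\<gamma> n)"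
      using n by (simp add: \<gamma>(2))
    then obtain u where "klein (\<gamma> t) = (1 - u) *\<^sub>R klein (\<gamma> (- n)) + u *\<^sub>R klein (\<gamma> n)"
      using hdist_add_iff[OF \<gamma>(1) \<gamma>(1) \<gamma>(1)] unfolding closed_segment_def by blast
    then show ?thesis by (simp only: side_affine side_self)
  qed
  have k: "((\<lambda>n. klein (f n)) \<longlongrightarrow> e) F" if "(f \<longlongrightarrow> e) F" "cmod e = 1" for f :: "real \<Rightarrow> complex" and e F
    using continuous_on_tendsto_compose[OF continuous_klein[of UNIV] that(1)] klein_circle[OF that(2)] by simp
  have "((\<lambda>n. \<gamma> (- n)) \<longlongrightarrow> a) at_top"
    using assms(2) by (simp add: filterlim_at_bot_mirror)
  then have "((\<lambda>n. side (klein (\<gamma> (- n))) (klein (\<gamma> n)) (klein (\<gamma> t))) \<longlongrightarrow> side a b (klein (\<gamma> t))) at_top"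
    unfolding side_def using assms(3-5) by (intro tendsto_intros k)
  moreover have "eventually (\<lambda>n. side (klein (\<gamma> (- n))) (klein (\<gamma> n)) (klein (\<gamma> t)) = 0) at_top"
    using eventually_ge_at_top[of "\<bar>t\<bar>"] by eventually_elim (rule zero)
  ultimately have "((\<lambda>n::real. 0) \<longlongrightarrow> side a b (klein (\<gamma> t))) at_top"
    by (rule Lim_transform_eventually)
  then show ?thesis by (simp add: tendsto_const_iff)
qed

lemma geodesic_points_Upair:
  assumes "cmod a = 1" "cmod b = 1" "a \<noteq> b"
  shows "geodesic_points (Upair a b) = {z. cmod z < 1 \<and> side a b (klein z) = 0}"
proof (intro equalityI subsetI)
  fix z assume "z \<in> geodesic_points (Upair a b)"
  then obtain \<gamma> a' b' t where g: "geodesic_line \<gamma>" "(\<gamma> \<longlongrightarrow> a') at_bot" "(\<gamma> \<longlongrightarrow> b') at_top"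
    "Upair a b = Upair a' b'" "z = \<gamma> t"
    unfolding geodesic_points_def by blast
  have "side a' b' (klein z) = 0"
    using geodesic_line_on_chord[OF g(1-3)] g(4,5) assms by auto
  moreover have "cmod z < 1" using g(1,5) unfolding geodesic_line_def by (auto simp: image_subset_iff)
  ultimately show "z \<in> {z. cmod z < 1 \<and> side a b (klein z) = 0}"
    using g(4) by (auto simp: side_swap[of b' a'])
next
  fix z assume z: "z \<in> {z. cmod z < 1 \<and> side a b (klein z) = 0}"
  obtain \<gamma> where "geodesic_line \<gamma>" "(\<gamma> \<longlongrightarrow> a) at_bot" "(\<gamma> \<longlongrightarrow> b) at_top"
    "\<forall>z. cmod z < 1 \<and> side a b (klein z) = 0 \<longrightarrow> z \<in> range \<gamma>"
    using geodesic_line_exists[OF assms] .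
  with z show "z \<in> geodesic_points (Upair a b)"
    unfolding geodesic_points_def by blast
qed


section \<open>Crossings of half-open segments\<close>

lemma geodesicsE:
  assumes "e \<in> geodesics"
  obtains a b where "e = Upair a b" "cmod a = 1" "cmod b = 1" "a \<noteq> b"
  using assms unfolding geodesics_def endpoint_pairs_def by auto

lemma Upair_geodesics_iff: "Upair a b \<in> geodesics \<longleftrightarrow> cmod a = 1 \<and> cmod b = 1 \<and> a \<noteq> b"
  unfolding geodesics_def endpoint_pairs_def by auto

lemma hsegment_klein:
  assumes "cmod x < 1" "cmod y < 1"
  shows "hsegment x y = {z. cmod z < 1 \<and> klein z \<in> closed_segment (klein x) (klein y)}"
  using hdist_add_iff assms unfolding hsegment_def by auto

lemma hsegment_commute: "cmod x < 1 \<Longrightarrow> cmod y < 1 \<Longrightarrow> hsegment x y = hsegment y x"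
  by (simp add: hsegment_klein closed_segment_commute)

abbreviation half_crossing :: "complex \<Rightarrow> complex \<Rightarrow> complex uprod set" where
  "half_crossing x y \<equiv> crossing (hsegment x y - {y})"

lemma klein_segment_point:
  assumes "cmod x < 1" "cmod y < 1" "0 \<le> t" "t \<le> 1"
  obtains z where "cmod z < 1" "klein z = (1 - t) *\<^sub>R klein x + t *\<^sub>R klein y"
proof -
  have "(1 - t) *\<^sub>R klein x + t *\<^sub>R klein y \<in> ball 0 1"
    using assms klein_ball by (intro convexD[OF convex_ball]) auto
  then have k: "cmod ((1 - t) *\<^sub>R klein x + t *\<^sub>R klein y) < 1" by simp
  show thesis
    using that[OF unklein_ball[OF k] klein_unklein] k by simp
qed

text \<open>The second alternative is the line through \<open>x\<close>, which belongs to the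
  half-open segment; it is transverse exactly if it misses \<open>y\<close>. A line through
  \<open>y\<close> alone is not counted.\<close>

lemma half_crossing_Upair:
  assumes x: "cmod x < 1" and y: "cmod y < 1" and ab: "cmod a = 1" "cmod b = 1" "a \<noteq> b"
  shows "Upair a b \<in> half_crossing x y \<longleftrightarrow>
    side a b (klein x) * side a b (klein y) < 0 \<or> side a b (klein x) = 0 \<and> side a b (klein y) \<noteq> 0"
    (is "?L \<longleftrightarrow> ?R")
proof -
  define u v where "u = side a b (klein x)" "v = side a b (klein y)"
  note uv = this
  have seg: "z \<in> hsegment x y - {y} \<longleftrightarrow>
      cmod z < 1 \<and> z \<noteq> y \<and> (\<exists>t. klein z = (1 - t) *\<^sub>R klein x + t *\<^sub>R klein y \<and> 0 \<le> t \<and> t \<le> 1)" for z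
    using hsegment_klein[OF x y] by (auto simp: closed_segment_def)
  have onl: "z \<in> geodesic_points (Upair a b) \<longleftrightarrow> cmod z < 1 \<and> side a b (klein z) = 0" for z
    using geodesic_points_Upair[OF ab] by simp
  have L: "?L \<longleftrightarrow> (\<exists>z \<in> hsegment x y - {y}. side a b (klein z) = 0) \<and>
      (\<exists>z \<in> hsegment x y - {y}. side a b (klein z) \<noteq> 0)"
    using ab onl seg unfolding crossing_def Upair_geodesics_iff mem_Collect_eq by blast
  show ?thesis
  proof
    assume ?L
    then obtain z z' where z: "z \<in> hsegment x y - {y}" "side a b (klein z) = 0"
      "z' \<in> hsegment x y - {y}" "side a b (klein z') \<noteq> 0"
      using L by blast
    obtain t where t: "klein z = (1 - t) *\<^sub>R klein x + t *\<^sub>R klein y" "0 \<le> t" "t \<le> 1" "z \<noteq> y" "cmod z < 1"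
      using z(1) seg by blast
    obtain t' where t': "klein z' = (1 - t') *\<^sub>R klein x + t' *\<^sub>R klein y"
      using z(3) seg by blast
    have "t \<noteq> 1" using t klein_inj[of z y] y by auto
    with t(3) have "t < 1" by simp
    have 0: "(1 - t) * u + t * v = 0" and n0: "(1 - t') * u + t' * v \<noteq> 0"
      using z(2,4) unfolding t(1) t' side_affine uv by auto
    show ?R
    proof (cases "u = 0")
      case True
      then show ?thesis using n0 by (auto simp flip: uv)
    next
      case False
      have "(1 - t) * (u * u) + t * (v * u) = ((1 - t) * u + t * v) * u"
        by (simp add: algebra_simps)
      also have "\<dots> = 0" unfolding 0 by simp
      finally have "t * (v * u) = - ((1 - t) * (u * u))" by linarith
      also have "\<dots> < 0" using \<open>t < 1\<close> False by (simp add: zero_less_mult_iff) linarith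
      finally have "v * u < 0" using t(2) by (simp add: mult_less_0_iff)
      then show ?thesis by (simp add: mult.commute flip: uv)
    qed
  next
    assume R: ?R
    then have "x \<noteq> y" by auto
    have xs: "x \<in> hsegment x y - {y}"
      using \<open>x \<noteq> y\<close> x unfolding seg by (auto intro: exI[of _ 0])
    show ?L
    proof (cases "u = 0")
      case True
      then have v: "v \<noteq> 0" using R by (auto simp: uv)
      \<comment> \<open>Since \<open>y\<close> has been removed from the segment, the midpoint
        serves as the point off the line.\<close>
      obtain z where z: "cmod z < 1" "klein z = (1 - 1/2) *\<^sub>R klein x + (1/2) *\<^sub>R klein y"
        using klein_segment_point[OF x y, of "1/2"] by auto
      have sz: "side a b (klein z) = v / 2"
        unfolding z side_affine using True by (simp add: uv)
      then have "z \<noteq> y" using v by (auto simp: uv)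
      then have "z \<in> hsegment x y - {y}"
        unfolding seg using z by (auto intro!: exI[of _ "1/2"])
      then show ?thesis
        using L xs True sz v uv by auto
    next
      case False
      then have neg: "u * v < 0" using R by (auto simp: uv)
      define t where "t = u / (u - v)"
      have t0: "(1 - t) * u + t * v = 0"
      proof -
        have "u - v \<noteq> 0" using neg by auto
        then show ?thesis by (simp add: t_def field_simps)
      qed
      note t = opposite_sides_weight[OF neg t0]
      obtain z where z: "cmod z < 1" "klein z = (1 - t) *\<^sub>R klein x + t *\<^sub>R klein y"
        using klein_segment_point[OF x y, of t] t by auto
      have sz: "side a b (klein z) = 0"
        unfolding z side_affine using t0 by (simp add: uv)
      then have "z \<noteq> y" using neg by (auto simp: uv)
      then have "z \<in> hsegment x y - {y}"
        unfolding seg using z t by (auto intro!: exI[of _ t])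
      then show ?thesis
        using L xs False sz uv by auto
    qed
  qed
qed

definition halfcount :: "complex \<Rightarrow> complex \<Rightarrow> complex uprod \<Rightarrow> real" where
  "halfcount x y e = 1/2 * indicator (half_crossing x y) e + 1/2 * indicator (half_crossing y x) e"

text \<open>A line through just one endpoint lies in exactly one of the two half-open crossings and
  gets weight 1/2, a line through the interior gets weight 1. Both are half the jump of the
  sign.\<close>

lemma halfcount_Upair:
  assumes "cmod x < 1" "cmod y < 1" "cmod a = 1" "cmod b = 1" "a \<noteq> b"
  shows "halfcount x y (Upair a b) = 1/2 * \<bar>sgn (side a b (klein x)) - sgn (side a b (klein y))\<bar>"
  using half_crossing_Upair[of x y a b] half_crossing_Upair[of y x a b] assms
  unfolding halfcount_def by (auto simp: indicator_def sgn_if mult_less_0_iff)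

lemma dual_dist_halfcount:
  assumes "cmod x < 1" "cmod y < 1"
  shows "dual_dist \<mu> x y = 1/2 * measure \<mu> (half_crossing x y) + 1/2 * measure \<mu> (half_crossing y x)"
  unfolding dual_dist_def using hsegment_commute[OF assms] by simp

section \<open>Measurability and finite mass of crossings\<close>

lemma side_mult_swap: "side b a u * side b a v = side a b u * side a b v"
  by (simp add: side_swap[of b a])

lemma side_eq_0_swap: "side b a u = 0 \<longleftrightarrow> side a b u = 0"
  by (simp add: side_swap[of b a])

lemma openin_geodesic_Collect:
  assumes "open {p. P (fst p) (snd p)}" "\<And>a b. P a b \<longleftrightarrow> P b a"
  shows "openin geodesic_topology {Upair a b | a b. cmod a = 1 \<and> cmod b = 1 \<and> a \<noteq> b \<and> P a b}" (is "openin _ ?U")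
proof -
  define V where "V = ?U"
  have U: "Upair a b \<in> V \<longleftrightarrow> cmod a = 1 \<and> cmod b = 1 \<and> a \<noteq> b \<and> P a b" for a b
    unfolding V_def mem_Collect_eq Upair_inject using assms(2) by blast
  have "{p \<in> endpoint_pairs. (\<lambda>(a, b). Upair a b) p \<in> V} = endpoint_pairs \<inter> {p. P (fst p) (snd p)}"
    by (auto simp: endpoint_pairs_def U)
  moreover have "V \<subseteq> geodesics" using Upair_geodesics_iff unfolding V_def by blast
  ultimately show ?thesis
    unfolding openin_geodesic_topology V_def[symmetric] using openin_open_Int[OF assms(1)] by metis
qed

lemma geodesic_borel_open: "openin geodesic_topology U \<Longrightarrow> U \<in> sets geodesic_borel"
  using openin_subset[of geodesic_topology]
  unfolding geodesic_borel_def topspace_geodesic_topology[symmetric]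
  by (subst sets_measure_of) auto

lemma half_crossing_measurable:
  assumes "cmod x < 1" "cmod y < 1"
  shows "half_crossing x y \<in> sets geodesic_borel"
proof -
  define N where "N = {Upair a b | a b. cmod a = 1 \<and> cmod b = 1 \<and> a \<noteq> b \<and> side a b (klein x) * side a b (klein y) < 0}"
  define Z where "Z z = {Upair a b | a b. cmod a = 1 \<and> cmod b = 1 \<and> a \<noteq> b \<and> side a b (klein z) \<noteq> 0}" for z
  have N: "N \<in> sets geodesic_borel"
    unfolding N_def
    by (intro geodesic_borel_open openin_geodesic_Collect open_Collect_less continuous_intros)
      (simp only: side_mult_swap side_eq_0_swap)
  have Z: "Z z \<in> sets geodesic_borel" for z
    unfolding Z_def
    by (intro geodesic_borel_open openin_geodesic_Collect open_Collect_neq continuous_intros)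
      (simp only: side_mult_swap side_eq_0_swap)
  \<comment> \<open>Vanishing of \<open>side\<close> at \<open>x\<close> is the complement of an
    open condition, so a difference of open sets accounts for the lines through
    \<open>x\<close>.\<close>
  have "half_crossing x y = N \<union> (Z y - Z x)"
  proof (rule Set.set_eqI)
    fix e
    show "e \<in> half_crossing x y \<longleftrightarrow> e \<in> N \<union> (Z y - Z x)"
    proof (cases "e \<in> geodesics")
      case True
      then obtain a b where e: "e = Upair a b" "cmod a = 1" "cmod b = 1" "a \<noteq> b" by (rule geodesicsE)
      have "e \<in> N \<longleftrightarrow> side a b (klein x) * side a b (klein y) < 0"
        "e \<in> Z z \<longleftrightarrow> side a b (klein z) \<noteq> 0" for z
        unfolding N_def Z_def using e by (auto simp: side_swap[of b a])
      then show ?thesis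
        using half_crossing_Upair[OF assms e(2-4)] unfolding e(1) by auto
    next
      case False
      then show ?thesis
        using Upair_geodesics_iff unfolding crossing_def N_def Z_def by auto
    qed
  qed
  then show ?thesis using N Z by auto
qed

lemma separating_measurable: "separating p q r s \<in> sets geodesic_borel"
proof -
  have "separating p q r s = {Upair a b | a b. cmod a = 1 \<and> cmod b = 1 \<and> a \<noteq> b \<and> 
     (0 < side a b p * side a b q \<and> 0 < side a b r * side a b s \<and> side a b p * side a b r < 0)}"
  proof -
    have "a \<in> sphere 0 1 \<and> b \<in> sphere 0 1 \<and>
        0 < side a b p * side a b q \<and> 0 < side a b r * side a b s \<and> side a b p * side a b r < 0 \<longleftrightarrow>
      cmod a = 1 \<and> cmod b = 1 \<and> a \<noteq> b \<and>
        (0 < side a b p * side a b q \<and> 0 < side a b r * side a b s \<and> side a b p * side a b r < 0)" for a b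
      by auto
    then show ?thesis unfolding separating_def by (simp only:)
  qed
  moreover have "openin geodesic_topology \<dots>"
    by (intro openin_geodesic_Collect open_Collect_conj open_Collect_less continuous_intros)
      (simp only: side_mult_swap side_eq_0_swap)
  ultimately show ?thesis by (simp add: geodesic_borel_open)
qed


text \<open>A chord meeting the disc of radius \<open>R\<close> is at least as long as its piece
  from the endpoint \<open>a\<close> to that disc. Hence the crossing geodesics stay away from the
  diagonal of pairs of endpoints.\<close>

lemma half_crossing_endpoints_far:
  assumes xy: "cmod x < 1" "cmod y < 1" and R: "cmod (klein x) \<le> R" "cmod (klein y) \<le> R" "R < 1"
    and e: "Upair a b \<in> half_crossing x y"
  shows "1 - R \<le> cmod (a - b)"
proof -
  have "Upair a b \<in> geodesics" "geodesic_points (Upair a b) \<inter> (hsegment x y - {y}) \<noteq> {}"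
    using e unfolding crossing_def by auto
  then have ab: "cmod a = 1" "cmod b = 1" "a \<noteq> b"
    and "\<exists>z. z \<in> geodesic_points (Upair a b) \<and> z \<in> hsegment x y"
    using Upair_geodesics_iff by auto
  then obtain z where z: "side a b (klein z) = 0" "klein z \<in> closed_segment (klein x) (klein y)" "cmod z < 1"
    using geodesic_points_Upair[OF ab] hsegment_klein[OF xy] by auto
  have "closed_segment (klein x) (klein y) \<subseteq> cball 0 R"
    using R by (intro closed_segment_subset convex_cball) auto
  then have kR: "cmod (klein z) \<le> R" using z(2) by auto
  obtain t where t: "klein z = (1 - t) *\<^sub>R a + t *\<^sub>R b" using side_eq_0D[OF z(1) ab(3)] .
  have t01: "0 < t" "t < 1" using chord_weight[OF ab(1,2), of t] kR R(3) by (auto simp flip: t)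
  have "a - klein z = t *\<^sub>R (a - b)" unfolding t by (simp add: algebra_simps)
  then have "cmod (a - klein z) = t * cmod (a - b)" using t01 by simp
  also have "\<dots> \<le> cmod (a - b)" using t01 by (simp add: mult_left_le_one_le)
  finally show ?thesis
    using norm_triangle_ineq2[of a "klein z"] ab(1) kR by simp
qed

text \<open>Local finiteness and a finite cover of the compact set \<open>T\<close> of separated
  endpoints. The compactness argument takes place among ordered pairs and descends to geodesics only
  at the end.\<close>

lemma half_crossing_finite:
  assumes "\<mu> \<in> geodesic_currents \<Gamma>" and xy: "cmod x < 1" "cmod y < 1"
  shows "emeasure \<mu> (half_crossing x y) < \<infinity>"
proof -
  define R where "R = max (cmod (klein x)) (cmod (klein y))"
  have R: "cmod (klein x) \<le> R" "cmod (klein y) \<le> R" "R < 1"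
    using klein_ball xy by (auto simp: R_def)
  define T where "T = (sphere 0 1 \<times> sphere 0 1) \<inter> {p :: complex \<times> complex. 1 - R \<le> cmod (fst p - snd p)}"
  have T: "compact T" unfolding T_def
    by (auto intro!: compact_Int_closed compact_Times closed_Collect_le continuous_intros)
  have sub: "T \<subseteq> endpoint_pairs" using R(3) by (auto simp: T_def endpoint_pairs_def)
  have sets: "sets \<mu> = sets geodesic_borel" using assms(1) by (simp add: geodesic_currents_def)
  have "\<exists>U N. openin geodesic_topology U \<and> emeasure \<mu> U < \<infinity> \<and> open N \<and> p \<in> N \<and>
      (\<forall>a b. (a, b) \<in> T \<inter> N \<longrightarrow> Upair a b \<in> U)" if p: "p \<in> T" for p
  proof -
    obtain a b where ab: "p = (a, b)" by force
    then have "Upair a b \<in> geodesics" using p sub unfolding geodesics_def by force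
    then obtain U where U: "openin geodesic_topology U" "Upair a b \<in> U" "emeasure \<mu> U < \<infinity>"
      using assms(1) unfolding geodesic_currents_def by blast
    then have "openin (top_of_set endpoint_pairs) {p \<in> endpoint_pairs. (\<lambda>(a, b). Upair a b) p \<in> U}"
      unfolding openin_geodesic_topology by blast
    then obtain N where N: "open N" "{p \<in> endpoint_pairs. (\<lambda>(a, b). Upair a b) p \<in> U} = endpoint_pairs \<inter> N"
      unfolding openin_open by blast
    have "p \<in> endpoint_pairs \<inter> N" using N(2) U(2) p sub ab by auto
    moreover have "Upair a b \<in> U" if "(a, b) \<in> T \<inter> N" for a b
    proof -
      have "(a, b) \<in> {p \<in> endpoint_pairs. (\<lambda>(a, b). Upair a b) p \<in> U}"
        unfolding N(2) using that sub by auto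
      then show ?thesis by simp
    qed
    ultimately show ?thesis using U N(1) by blast
  qed
  then obtain U N where "\<forall>p\<in>T. openin geodesic_topology (U p) \<and> emeasure \<mu> (U p) < \<infinity> \<and> open (N p) \<and> p \<in> N p \<and>
      (\<forall>a b. (a, b) \<in> T \<inter> N p \<longrightarrow> Upair a b \<in> U p)"
    by metis
  then have UO: "\<And>p. p \<in> T \<Longrightarrow> openin geodesic_topology (U p)" "\<And>p. p \<in> T \<Longrightarrow> emeasure \<mu> (U p) < \<infinity>"
    "\<And>p. p \<in> T \<Longrightarrow> open (N p)" "\<And>p. p \<in> T \<Longrightarrow> p \<in> N p"
    "\<And>p a b. p \<in> T \<Longrightarrow> (a, b) \<in> T \<inter> N p \<Longrightarrow> Upair a b \<in> U p" by blast+
  have cover: "T \<subseteq> (\<Union>p\<in>T. N p)" using UO(4) by blast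
  obtain F where F: "F \<subseteq> T" "finite F" "T \<subseteq> (\<Union>p\<in>F. N p)"
    by (rule compactE_image[OF T, of T N]) (use UO(3) cover in auto)
  have meas: "U p \<in> sets \<mu>" if "p \<in> F" for p
    using UO(1) F(1) that sets geodesic_borel_open by blast
  have "half_crossing x y \<subseteq> (\<Union>p\<in>F. U p)"
  proof
    fix e assume e: "e \<in> half_crossing x y"
    then have "e \<in> geodesics" by (simp add: crossing_def)
    then obtain a b where ab: "e = Upair a b" "cmod a = 1" "cmod b = 1" "a \<noteq> b" by (rule geodesicsE)
    then have "(a, b) \<in> T"
      using half_crossing_endpoints_far[OF xy R] e by (auto simp: T_def)
    then show "e \<in> (\<Union>p\<in>F. U p)" using F UO(5) ab(1) by blast
  qed
  then have "emeasure \<mu> (half_crossing x y) \<le> emeasure \<mu> (\<Union>p\<in>F. U p)"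
    using meas F(2) by (intro emeasure_mono) auto
  also have "\<dots> \<le> (\<Sum>p\<in>F. emeasure \<mu> (U p))"
    using meas F(2) by (intro emeasure_subadditive_finite) auto
  also have "\<dots> < \<infinity>" using UO(2) F(1,2) by (auto simp: less_top)
  finally show ?thesis .
qed

section \<open>The four-point inequality\<close>

text \<open>Going from values to signs loses nothing: the excess is positive only for geodesics that have
  \<open>u, v\<close> on one side and \<open>s, t\<close> on the other.\<close>

lemma sgn_four_point:
  fixes u v s t :: real
  shows "\<bar>sgn u - sgn s\<bar> + \<bar>sgn v - sgn t\<bar> \<le> \<bar>sgn u - sgn v\<bar> + \<bar>sgn s - sgn t\<bar> +
    (if sgn s < sgn u \<and> sgn t < sgn v \<or> sgn u < sgn s \<and> sgn v < sgn t then 4 else 0)"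
  by (auto simp: sgn_if)

text \<open>The hypothesis allows one of the two points to lie on the line. Prolonging the segment
  beyond both ends still puts its ends strictly on different sides, as \<open>separating\<close>
  requires.\<close>

lemma sgn_less_extend:
  fixes u s c d :: real
  assumes "sgn s < sgn u" "0 < c" "0 < d"
  shows "0 < u + c * (u - s)" "s + d * (s - u) < 0"
proof -
  have us: "0 \<le> u" "s \<le> 0" "0 < u - s"
    using assms(1) by (auto simp: sgn_if split: if_splits)
  then have "0 < c * (u - s)" "0 < d * (u - s)" using assms(2,3) by simp_all
  with us show "0 < u + c * (u - s)" "s + d * (s - u) < 0"
    by (auto simp: algebra_simps)
qed

lemma ideal_endpoint:
  fixes X Z :: complex
  assumes "cmod X < 1" "X \<noteq> Z"
  obtains c where "0 < c" "cmod (X + c *\<^sub>R (X - Z)) = 1"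
proof -
  obtain d where "0 < d" "X + d *\<^sub>R (X - Z) \<in> frontier (ball 0 1)"
    using ray_to_frontier[of "ball (0::complex) 1" X "X - Z"] assms by auto
  then show thesis using that by (auto simp: frontier_ball)
qed

lemma side_extend: "side a b (X + c *\<^sub>R (X - Z)) = side a b X + c * (side a b X - side a b Z)"
  using side_affine[of a b "- c" X Z] by (simp add: algebra_simps)

text \<open>The primed points lie on the lines through \<open>x, z\<close> and \<open>y, w\<close>,
  beyond the given points. The factor 2 is the excess 4 of \<open>sgn_four_point\<close> times the
  weight 1/2 in \<open>halfcount\<close>.\<close>

lemma halfcount_four_point:
  assumes B: "cmod x < 1" "cmod y < 1" "cmod z < 1" "cmod w < 1"
    and X: "X' = klein x + c1 *\<^sub>R (klein x - klein z)" "0 < c1" and Z: "Z' = klein z + c2 *\<^sub>R (klein z - klein x)" "0 < c2"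
    and Y: "Y' = klein y + c3 *\<^sub>R (klein y - klein w)" "0 < c3" and W: "W' = klein w + c4 *\<^sub>R (klein w - klein y)" "0 < c4"
    and e: "e \<in> geodesics"
  shows "halfcount x z e + halfcount y w e \<le> halfcount x y e + halfcount z w e + 2 * indicator (separating X' Y' Z' W') e"
proof -
  obtain a b where ab: "e = Upair a b" "cmod a = 1" "cmod b = 1" "a \<noteq> b" using e by (rule geodesicsE)
  define u v s t where "u = side a b (klein x)" "v = side a b (klein y)" "s = side a b (klein z)" "t = side a b (klein w)"
  note uvst = this
  have "Upair a b \<in> separating X' Y' Z' W'"
    if "sgn s < sgn u \<and> sgn t < sgn v \<or> sgn u < sgn s \<and> sgn v < sgn t"
    using that
  proof
    assume "sgn s < sgn u \<and> sgn t < sgn v"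
    then have "0 < side a b X'" "side a b Z' < 0" "0 < side a b Y'" "side a b W' < 0"
      unfolding X Y Z W side_extend uvst[symmetric] using sgn_less_extend X(2) Y(2) Z(2) W(2) by blast+
    then show ?thesis using ab by (auto simp: separating_iff zero_less_mult_iff mult_less_0_iff)
  next
    assume "sgn u < sgn s \<and> sgn v < sgn t"
    then have "side a b X' < 0" "0 < side a b Z'" "side a b Y' < 0" "0 < side a b W'"
      unfolding X Y Z W side_extend uvst[symmetric] using sgn_less_extend X(2) Y(2) Z(2) W(2) by blast+
    then show ?thesis using ab by (auto simp: separating_iff zero_less_mult_iff mult_less_0_iff)
  qed
  then show ?thesis
    using sgn_four_point[of u s v t] unfolding ab(1)
    by (simp add: halfcount_Upair B ab(2-4) indicator_def flip: uvst split: if_splits)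
qed

text \<open>Finite crossings let \<open>dual_dist\<close> be read as the integral of
  \<open>halfcount\<close>, so inequalities need only be checked for each geodesic.\<close>

locale finite_crossings =
  fixes \<mu> :: "complex uprod measure"
  assumes sets_eq: "sets \<mu> = sets geodesic_borel" and space_eq: "space \<mu> = geodesics"
    and finite_crossing: "\<And>x y. cmod x < 1 \<Longrightarrow> cmod y < 1 \<Longrightarrow> emeasure \<mu> (half_crossing x y) < \<infinity>"
begin

lemma halfcount_integral:
  assumes "cmod x < 1" "cmod y < 1"
  shows "integrable \<mu> (halfcount x y)" "integral\<^sup>L \<mu> (halfcount x y) = dual_dist \<mu> x y"
proof -
  have i: "integrable \<mu> (indicator (half_crossing x y) :: _ \<Rightarrow> real)"
    "integrable \<mu> (indicator (half_crossing y x) :: _ \<Rightarrow> real)"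
    using half_crossing_measurable finite_crossing assms sets_eq by (auto intro!: integrable_real_indicator)
  then show "integrable \<mu> (halfcount x y)"
    unfolding halfcount_def[abs_def] by auto
  show "integral\<^sup>L \<mu> (halfcount x y) = dual_dist \<mu> x y"
    unfolding halfcount_def[abs_def] dual_dist_halfcount[OF assms]
    using i half_crossing_measurable assms sets_eq sets.sets_into_space[of _ \<mu>]
    by (subst Bochner_Integration.integral_add) (auto simp: Int_absorb2)
qed

lemma dual_dist_le:
  assumes B: "cmod x < 1" "cmod y < 1" "cmod z < 1" "cmod w < 1" and "klein x \<noteq> klein z" "klein y \<noteq> klein w"
    and "X' = klein x + c1 *\<^sub>R (klein x - klein z)" "0 < c1" and "Z' = klein z + c2 *\<^sub>R (klein z - klein x)" "0 < c2"
    and "Y' = klein y + c3 *\<^sub>R (klein y - klein w)" "0 < c3" and "W' = klein w + c4 *\<^sub>R (klein w - klein y)" "0 < c4"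
    and fin: "emeasure \<mu> (separating X' Y' Z' W') < \<infinity>"
  shows "dual_dist \<mu> x z + dual_dist \<mu> y w \<le> dual_dist \<mu> x y + dual_dist \<mu> z w + 2 * measure \<mu> (separating X' Y' Z' W')"
proof -
  let ?S = "separating X' Y' Z' W'"
  have S: "?S \<in> sets \<mu>" using separating_measurable sets_eq by simp
  then have iS: "integrable \<mu> (indicator ?S :: _ \<Rightarrow> real)" using fin by (intro integrable_real_indicator)
  have "dual_dist \<mu> x z + dual_dist \<mu> y w = (\<integral>e. halfcount x z e + halfcount y w e \<partial>\<mu>)"
    using halfcount_integral B by simp
  also have "\<dots> \<le> (\<integral>e. (halfcount x y e + halfcount z w e) + 2 * indicator ?S e \<partial>\<mu>)"
    using halfcount_integral B iS halfcount_four_point[OF B assms(7-14)] unfolding space_eq[symmetric]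
    by (intro integral_mono) auto
  also have "\<dots> = dual_dist \<mu> x y + dual_dist \<mu> z w + 2 * measure \<mu> ?S"
    using halfcount_integral B iS S sets.sets_into_space[OF S] by (simp add: Int_absorb2)
  finally show ?thesis .
qed

lemma dual_dist_pseudometric: "pseudometric_on (ball 0 1) (dual_dist \<mu>)"
proof -
  have "dual_dist \<mu> x x = 0" if "cmod x < 1" for x
  proof -
    have "hsegment x x - {x} = {}"
      using that klein_inj[of _ x] by (auto simp: hsegment_klein)
    then have "crossing (hsegment x x - {x}) = {}"
      by (simp only: crossing_def) simp
    then show ?thesis by (simp add: dual_dist_def)
  qed
  moreover have "dual_dist \<mu> x y = dual_dist \<mu> y x" if "cmod x < 1" "cmod y < 1" for x y
    using that by (simp add: dual_dist_halfcount)
  moreover have "0 \<le> dual_dist \<mu> x y" for x y by (simp add: dual_dist_def)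
  moreover have "dual_dist \<mu> x z \<le> dual_dist \<mu> x y + dual_dist \<mu> y z"
    if B: "cmod x < 1" "cmod y < 1" "cmod z < 1" for x y z
  proof -
    have "halfcount x z e \<le> halfcount x y e + halfcount y z e" if e: "e \<in> geodesics" for e
    proof -
      obtain a b where "e = Upair a b" "cmod a = 1" "cmod b = 1" "a \<noteq> b" using e by (rule geodesicsE)
      then show ?thesis
        using B by (simp add: halfcount_Upair)
    qed
    then have "(\<integral>e. halfcount x z e \<partial>\<mu>) \<le> (\<integral>e. halfcount x y e + halfcount y z e \<partial>\<mu>)"
      using halfcount_integral B unfolding space_eq[symmetric] by (intro integral_mono) auto
    then show ?thesis using halfcount_integral B by simp
  qed
  ultimately show ?thesis unfolding pseudometric_on_def by auto
qed

text \<open>From \<open>?D \<le> ?P + 2 * A\<close> and \<open>?D \<le> ?Q + 2 * B\<close> the claim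
  follows on multiplying the assumed inequality by \<open>exp (\<epsilon> / 2 * ?D)\<close>. The
  factor 2 cancels the half in the exponent.\<close>

lemma strongly_hyperbolic_criterion:
  assumes "0 < \<epsilon>"
    and sep: "\<And>p q r s. cyclic4 p q r s \<Longrightarrow> emeasure \<mu> (separating p q r s) < \<infinity> \<and>
      1 \<le> exp (- \<epsilon> * measure \<mu> (separating p q r s)) + exp (- \<epsilon> * measure \<mu> (separating q r s p))"
  shows "strongly_hyperbolic_current \<mu>"
proof -
  have "exp (\<epsilon> / 2 * (dual_dist \<mu> x z + dual_dist \<mu> y w))
      \<le> exp (\<epsilon> / 2 * (dual_dist \<mu> x y + dual_dist \<mu> z w)) + exp (\<epsilon> / 2 * (dual_dist \<mu> x w + dual_dist \<mu> y z))"
    (is "exp (\<epsilon> / 2 * ?D) \<le> exp (\<epsilon> / 2 * ?P) + exp (\<epsilon> / 2 * ?Q)")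
    if B: "cmod x < 1" "cmod y < 1" "cmod z < 1" "cmod w < 1" for x y z w
  proof -
    have le: ?thesis if "?D \<le> ?P \<or> ?D \<le> ?Q"
    proof -
      have "exp (\<epsilon> / 2 * ?D) \<le> exp (\<epsilon> / 2 * ?P) \<or> exp (\<epsilon> / 2 * ?D) \<le> exp (\<epsilon> / 2 * ?Q)"
        using that assms(1) by simp
      then show ?thesis by (smt (verit) exp_gt_zero)
    qed
    have pm: "dual_dist \<mu> a a = 0" "dual_dist \<mu> a b = dual_dist \<mu> b a"
      "dual_dist \<mu> a c \<le> dual_dist \<mu> a b + dual_dist \<mu> b c"
      if "cmod a < 1" "cmod b < 1" "cmod c < 1" for a b c
      using dual_dist_pseudometric that unfolding pseudometric_on_def by auto
    consider "x = z" | "y = w" | "x \<noteq> z" "y \<noteq> w" by blast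
    then show ?thesis
    proof cases
      case 1
      \<comment> \<open>If a diagonal degenerates there is no line to prolong, but the triangle
        inequality already gives the bound.\<close>
      have "?D \<le> ?P" using 1 pm[of x x x] pm[of y x w] pm(2)[of x y] B by simp
      then show ?thesis using le by blast
    next
      case 2
      have "?D \<le> ?P" using 2 pm[of y y y] pm[of x y z] pm(2)[of z y] B by simp
      then show ?thesis using le by blast
    next
      case 3
      then have kn: "klein x \<noteq> klein z" "klein y \<noteq> klein w" using klein_inj B by (metis less_imp_le)+
      have k1: "cmod (klein x) < 1" "cmod (klein y) < 1" "cmod (klein z) < 1" "cmod (klein w) < 1"
        using klein_ball B by auto
      obtain c1 where c1: "0 < c1" "cmod (klein x + c1 *\<^sub>R (klein x - klein z)) = 1" using ideal_endpoint k1 kn by metis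
      obtain c2 where c2: "0 < c2" "cmod (klein z + c2 *\<^sub>R (klein z - klein x)) = 1" using ideal_endpoint k1 kn by metis
      obtain c3 where c3: "0 < c3" "cmod (klein y + c3 *\<^sub>R (klein y - klein w)) = 1" using ideal_endpoint k1 kn by metis
      obtain c4 where c4: "0 < c4" "cmod (klein w + c4 *\<^sub>R (klein w - klein y)) = 1" using ideal_endpoint k1 kn by metis
      define p q r s where "p = klein x + c1 *\<^sub>R (klein x - klein z)" "q = klein y + c3 *\<^sub>R (klein y - klein w)"
        "r = klein z + c2 *\<^sub>R (klein z - klein x)" "s = klein w + c4 *\<^sub>R (klein w - klein y)"
      note pqrs = this
      have P: "?D \<le> ?P + 2 * measure \<mu> (separating p q r s)" if "emeasure \<mu> (separating p q r s) < \<infinity>"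
        using dual_dist_le[OF B kn pqrs(1) c1(1) pqrs(3) c2(1) pqrs(2) c3(1) pqrs(4) c4(1) that] .
      \<comment> \<open>Exchanging \<open>y\<close> with \<open>w\<close> turns the bound by
        \<open>?P\<close> into the one by \<open>?Q\<close> and groups the ideal points the other
        way.\<close>
      have Q: "?D \<le> ?Q + 2 * measure \<mu> (separating p s r q)" if "emeasure \<mu> (separating p s r q) < \<infinity>"
        using dual_dist_le[OF B(1,4,3,2) kn(1) kn(2)[symmetric] pqrs(1) c1(1) pqrs(3) c2(1) pqrs(4) c4(1) pqrs(2) c3(1) that]
          pm(2)[of w y] pm(2)[of z y] B by simp
      have sw: "separating p s r q = separating q r s p"
        using separating_reverse separating_swap by metis
      have S: "p \<in> sphere 0 1" "q \<in> sphere 0 1" "r \<in> sphere 0 1" "s \<in> sphere 0 1"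
        using c1 c2 c3 c4 pqrs by auto
      have "separating p s q r = separating p s r q" by (rule separating_swap(2)[symmetric])
      with separating_cases[OF S]
      consider "cyclic4 p q r s" | "separating p q r s = {}" | "separating p s r q = {}"
        by auto
      then show ?thesis
      proof cases
        case 1
        define A B where "A = measure \<mu> (separating p q r s)" "B = measure \<mu> (separating q r s p)"
        have AB: "1 \<le> exp (- \<epsilon> * A) + exp (- \<epsilon> * B)"
          using sep[OF 1] by (simp add: A_B_def)
        have D: "?D - 2 * A \<le> ?P" "?D - 2 * B \<le> ?Q"
          using P Q sep[OF 1] sep[OF cyclic4_rotate[OF 1]] unfolding sw A_B_def by auto
        have "exp (\<epsilon> / 2 * ?D) * 1 \<le> exp (\<epsilon> / 2 * ?D) * (exp (- \<epsilon> * A) + exp (- \<epsilon> * B))"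
          using AB by (intro mult_left_mono) auto
        also have "\<dots> = exp (\<epsilon> / 2 * (?D - 2 * A)) + exp (\<epsilon> / 2 * (?D - 2 * B))"
          by (simp add: distrib_left algebra_simps flip: exp_add)
        also have "\<dots> \<le> exp (\<epsilon> / 2 * ?P) + exp (\<epsilon> / 2 * ?Q)"
          using D assms(1) by (intro add_mono) auto
        finally show ?thesis by simp
      next
        case 2 then show ?thesis using P le by simp
      next
        case 3 then show ?thesis using Q le by simp
      qed
    qed
  qed
  then have "strongly_hyperbolic_with \<epsilon> (ball 0 1) (dual_dist \<mu>)"
    unfolding strongly_hyperbolic_with_def using dual_dist_pseudometric by auto
  then show ?thesis
    unfolding strongly_hyperbolic_current_def strongly_hyperbolic_def using assms(1) by blast
qed

end

subsection \<open>Liouville measures and combinations of currents\<close>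

lemma side_cis_window:
  assumes "\<alpha> \<le> \<theta>1" "\<theta>1 < \<theta>2" "\<theta>2 < \<alpha> + 2 * pi" "\<alpha> \<le> \<phi>" "\<phi> < \<alpha> + 2 * pi"
  shows "side (cis \<theta>1) (cis \<theta>2) (cis \<phi>) < 0 \<Longrightarrow> \<theta>1 < \<phi> \<and> \<phi> < \<theta>2"
    and "0 < side (cis \<theta>1) (cis \<theta>2) (cis \<phi>) \<Longrightarrow> \<phi> < \<theta>1 \<or> \<theta>2 < \<phi>"
proof -
  have pos: "0 < side (cis \<theta>1) (cis \<theta>2) (cis \<phi>)" if "\<phi> < \<theta>1 \<or> \<theta>2 < \<phi>"
  proof (cases "\<phi> < \<theta>1")
    case True
    \<comment> \<open>An angle before \<open>\<theta>1\<close> is moved by a full turn so that it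
      follows \<open>\<theta>2\<close>.\<close>
    then have "0 < side (cis \<theta>1) (cis \<theta>2) (cis (\<phi> + 2 * pi))"
      using assms by (intro side_cis_pos) auto
    then show ?thesis by simp
  next
    case False
    then show ?thesis using that assms by (intro side_cis_pos) auto
  qed
  have neg: "side (cis \<theta>1) (cis \<theta>2) (cis \<phi>) < 0" if "\<theta>1 < \<phi>" "\<phi> < \<theta>2"
    using that assms by (intro side_cis_neg) auto
  show "side (cis \<theta>1) (cis \<theta>2) (cis \<phi>) < 0 \<Longrightarrow> \<theta>1 < \<phi> \<and> \<phi> < \<theta>2"
    using pos by (cases \<phi> \<theta>1 rule: linorder_cases; cases \<phi> \<theta>2 rule: linorder_cases) auto
  show "0 < side (cis \<theta>1) (cis \<theta>2) (cis \<phi>) \<Longrightarrow> \<phi> < \<theta>1 \<or> \<theta>2 < \<phi>"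
    using neg by (cases \<phi> \<theta>1 rule: linorder_cases; cases \<phi> \<theta>2 rule: linorder_cases) auto
qed

lemma separating_in_box:
  assumes o: "\<alpha> < \<beta>" "\<beta> < \<gamma>" "\<gamma> < \<delta>" "\<delta> < \<alpha> + 2 * pi"
  shows "separating (cis \<alpha>) (cis \<beta>) (cis \<gamma>) (cis \<delta>) \<subseteq>
    {Upair u v | u v. u \<in> cis ` {\<beta>..\<gamma>} \<and> v \<in> cis ` {\<delta>..\<alpha> + 2 * pi}}" (is "_ \<subseteq> ?box")
proof
  fix e assume e: "e \<in> separating (cis \<alpha>) (cis \<beta>) (cis \<gamma>) (cis \<delta>)"
  obtain a b where ab: "e = Upair a b" "a \<in> sphere 0 1" "b \<in> sphere 0 1"
    using e unfolding separating_def by blast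
  have main: "Upair (cis \<theta>1) (cis \<theta>2) \<in> ?box"
    if t: "\<alpha> \<le> \<theta>1" "\<theta>1 < \<theta>2" "\<theta>2 < \<alpha> + 2 * pi"
      and s: "Upair (cis \<theta>1) (cis \<theta>2) \<in> separating (cis \<alpha>) (cis \<beta>) (cis \<gamma>) (cis \<delta>)" for \<theta>1 \<theta>2
  proof -
    let ?s = "\<lambda>\<phi>. side (cis \<theta>1) (cis \<theta>2) (cis \<phi>)"
    \<comment> \<open>The window of angles starts at \<open>\<alpha>\<close>, so
      \<open>\<alpha>\<close> cannot lie strictly between \<open>\<theta>1\<close> and
      \<open>\<theta>2\<close>; this fixes all four signs.\<close>
    have "\<not> ?s \<alpha> < 0" using side_cis_window(1)[OF t, of \<alpha>] o t(1) by auto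
    then have "0 < ?s \<alpha>" "0 < ?s \<beta>" "?s \<gamma> < 0" "?s \<delta> < 0"
      using s by (auto simp: separating_iff zero_less_mult_iff mult_less_0_iff)
    then have "\<beta> < \<theta>1 \<or> \<theta>2 < \<beta>" "\<theta>1 < \<gamma> \<and> \<gamma> < \<theta>2" "\<theta>1 < \<delta> \<and> \<delta> < \<theta>2"
      using side_cis_window(1)[OF t, of \<gamma>] side_cis_window(1)[OF t, of \<delta>] side_cis_window(2)[OF t, of \<beta>] o by auto
    then have "\<theta>1 \<in> {\<beta>..\<gamma>}" "\<theta>2 \<in> {\<delta>..\<alpha> + 2 * pi}" using o t by auto
    then show ?thesis by blast
  qed
  obtain \<theta>1 where 1: "\<alpha> \<le> \<theta>1" "\<theta>1 < \<alpha> + 2 * pi" "a = cis \<theta>1" using sphere_cis_ge[OF ab(2)] .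
  obtain \<theta>2 where 2: "\<alpha> \<le> \<theta>2" "\<theta>2 < \<alpha> + 2 * pi" "b = cis \<theta>2" using sphere_cis_ge[OF ab(3)] .
  have "a \<noteq> b" using e ab(1) by (auto simp: separating_iff)
  then have "\<theta>1 \<noteq> \<theta>2" using 1 2 by auto
  then have "\<theta>1 < \<theta>2 \<or> \<theta>2 < \<theta>1" by (simp only: neq_iff)
  then show "e \<in> ?box"
  proof
    assume "\<theta>1 < \<theta>2" then show ?thesis using main[of \<theta>1 \<theta>2] 1 2 ab(1) e by simp
  next
    assume "\<theta>2 < \<theta>1"
    moreover have "e = Upair (cis \<theta>2) (cis \<theta>1)" using ab(1) 1 2 by simp
    ultimately show ?thesis using main[of \<theta>2 \<theta>1] 1 2 e by simp
  qed
qed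

text \<open>Monotonicity in the closed box gives an inequality, and it goes in the useful direction
  because \<open>exp (- \<epsilon> * A)\<close> decreases with the mass \<open>A\<close>.\<close>

lemma liouville_separating:
  assumes L: "is_liouville_measure L" and c: "cyclic4 p q r s"
  shows "emeasure L (separating p q r s) \<le> ennreal (- ln (crr p q r s))"
proof -
  have *: "emeasure L (separating p q r s) \<le> ennreal (- ln (crr p q r s))" if c: "ccw p q r s" for p q r s
  proof -
    obtain \<alpha> \<beta> \<gamma> \<delta> where o: "\<alpha> < \<beta>" "\<beta> < \<gamma>" "\<gamma> < \<delta>" "\<delta> < \<alpha> + 2 * pi"
      and eq: "p = cis \<alpha>" "q = cis \<beta>" "r = cis \<gamma>" "s = cis \<delta>"
      using c unfolding ccw_def by blast
    define box where "box = {Upair u v | u v. u \<in> cis ` {\<beta>..\<gamma>} \<and> v \<in> cis ` {\<delta>..\<alpha> + 2 * pi}}"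
    have cyc: "cyclic4 p q r s" using c by (simp add: cyclic4_def)
    note X = crr_bounds[OF cyc]
    have "\<forall>\<alpha> \<beta> \<gamma> \<delta>. \<alpha> \<le> \<beta> \<and> \<beta> < \<gamma> \<and> \<gamma> \<le> \<delta> \<and> \<delta> < \<alpha> + 2 * pi \<longrightarrow>
        (let a = cis \<alpha>; b = cis \<beta>; c = cis \<gamma>; d = cis \<delta> in
         emeasure L {Upair p q | p q. p \<in> cis ` {\<alpha>..\<beta>} \<and> q \<in> cis ` {\<gamma>..\<delta>}}
           = ennreal \<bar>ln (cmod (((a - c) * (b - d)) / ((a - d) * (b - c))))\<bar>)"
      using L unfolding is_liouville_measure_def by blast
    \<comment> \<open>The arcs from \<open>q\<close> to \<open>r\<close> and from \<open>s\<close>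
      to \<open>p\<close>; the angle \<open>\<alpha> + 2 * pi\<close> for \<open>p\<close> keeps the
      second one counterclockwise.\<close>
    from this[rule_format, of \<beta> \<gamma> \<delta> "\<alpha> + 2 * pi"] o
    have "emeasure L box = ennreal \<bar>ln (cmod (((q - s) * (r - p)) / ((q - p) * (r - s))))\<bar>"
      unfolding Let_def box_def eq by simp
    also have "cmod (((q - s) * (r - p)) / ((q - p) * (r - s))) = inverse (crr p q r s)"
      by (simp add: crr_def norm_mult norm_divide norm_minus_commute mult.commute)
    also have "\<bar>ln (inverse (crr p q r s))\<bar> = - ln (crr p q r s)"
      using X by (simp add: ln_inverse)
    finally have box: "emeasure L box = ennreal (- ln (crr p q r s))" .
    \<comment> \<open>A set outside the sigma-algebra would have \<open>emeasure\<close> 0 by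
      convention, so the positive value shows that the box is measurable.\<close>
    then have "emeasure L box \<noteq> 0" using X by (simp add: ennreal_eq_0_iff)
    then have "box \<in> sets L" using emeasure_notin_sets by blast
    moreover have "separating p q r s \<subseteq> box"
      unfolding box_def eq using separating_in_box[OF o] .
    ultimately show ?thesis using emeasure_mono box by metis
  qed
  show ?thesis
    using c *[of p q r s] *[of s r q p] unfolding cyclic4_def
    by (auto simp: separating_reverse crr_reverse)
qed

section \<open>Transport and combination of measures\<close>

lemma space_geodesic_borel [simp]: "space geodesic_borel = geodesics"
  unfolding geodesic_borel_def using openin_subset[of geodesic_topology]
  by (simp add: space_measure_of_conv)

lemma circle_homeo_measurable:
  assumes f: "circle_homeo f"
  shows "map_uprod f \<in> measurable geodesic_borel geodesic_borel"
proof -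
  have open_sub: "{U. openin geodesic_topology U} \<subseteq> Pow geodesics"
    using openin_subset[of geodesic_topology] by (auto simp: topspace_geodesic_topology)
  have cont: "continuous_on endpoint_pairs (\<lambda>p. (f (fst p), f (snd p)))"
  proof -
    have c: "continuous_on (sphere 0 1) f" using f by (simp add: circle_homeo_def)
    have "continuous_on endpoint_pairs (\<lambda>p. f (fst p))" "continuous_on endpoint_pairs (\<lambda>p. f (snd p))"
      by (rule continuous_on_compose2[OF c]; auto simp: endpoint_pairs_def intro!: continuous_intros)+
    then show ?thesis by (rule continuous_on_Pair)
  qed
  have into: "(\<lambda>p. (f (fst p), f (snd p))) \<in> endpoint_pairs \<rightarrow> endpoint_pairs"
    using circle_homeo_mem[OF f] circle_homeo_eq_iff[OF f] by (auto simp: endpoint_pairs_def)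
  have mem: "map_uprod f e \<in> geodesics" if "e \<in> geodesics" for e
    using that circle_homeo_mem[OF f] circle_homeo_eq_iff[OF f]
    by (cases e) (auto simp: Upair_geodesics_iff)
  have "map_uprod f -` U \<inter> space geodesic_borel \<in> sets geodesic_borel" if U: "openin geodesic_topology U" for U
  proof -
    define V where "V = {p \<in> endpoint_pairs. (\<lambda>(a, b). Upair a b) p \<in> U}"
    have "openin (top_of_set endpoint_pairs) V"
      using U unfolding openin_geodesic_topology V_def by blast
    then have "openin (top_of_set endpoint_pairs) (endpoint_pairs \<inter> (\<lambda>p. (f (fst p), f (snd p))) -` V)"
      using continuous_openin_preimage[OF cont into] by blast
    moreover have "endpoint_pairs \<inter> (\<lambda>p. (f (fst p), f (snd p))) -` V =
        {p \<in> endpoint_pairs. (\<lambda>(a, b). Upair a b) p \<in> map_uprod f -` U \<inter> geodesics}"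
      using into by (auto simp: V_def Pi_iff Upair_geodesics_iff) (auto simp: endpoint_pairs_def)
    ultimately have "openin geodesic_topology (map_uprod f -` U \<inter> geodesics)"
      unfolding openin_geodesic_topology by simp
    then show ?thesis by (simp add: geodesic_borel_open)
  qed
  then have "map_uprod f \<in> measurable geodesic_borel (sigma geodesics {U. openin geodesic_topology U})"
    using open_sub mem by (intro measurable_measure_of) auto
  then show ?thesis by (simp add: geodesic_borel_def)
qed

lemma sets_combination [simp]: "sets (combination I c M) = sets geodesic_borel"
proof -
  have "sets geodesic_borel \<subseteq> Pow geodesics" using sets.space_closed[of geodesic_borel] by simp
  then have "sets (combination I c M) = sigma_sets geodesics (sets geodesic_borel)"
    unfolding combination_def by (rule sets_measure_of)
  also have "\<dots> = sets geodesic_borel"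
    using sets.sigma_sets_eq[of geodesic_borel] by simp
  finally show ?thesis .
qed

lemma space_combination [simp]: "space (combination I c M) = geodesics"
  unfolding combination_def by (rule space_measure_of) (use sets.space_closed[of geodesic_borel] in simp)

lemma emeasure_combination:
  assumes "\<And>i. i \<in> I \<Longrightarrow> sets (M i) = sets geodesic_borel" and A: "A \<in> sets geodesic_borel"
  shows "emeasure (combination I c M) A = (\<Sum>i\<in>I. ennreal (c i) * emeasure (M i) A)"
  unfolding combination_def
proof (rule emeasure_measure_of_sigma)
  show "sigma_algebra geodesics (sets geodesic_borel)"
    using sets.sigma_algebra_axioms[of geodesic_borel] by simp
  show "positive (sets geodesic_borel) (\<lambda>A. \<Sum>i\<in>I. ennreal (c i) * emeasure (M i) A)"
    by (simp add: positive_def)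
  show "countably_additive (sets geodesic_borel) (\<lambda>A. \<Sum>i\<in>I. ennreal (c i) * emeasure (M i) A)"
  proof (rule countably_additiveI)
    fix S :: "nat \<Rightarrow> complex uprod set"
    assume S: "range S \<subseteq> sets geodesic_borel" "disjoint_family S" "\<Union> (range S) \<in> sets geodesic_borel"
    have "(\<Sum>n. \<Sum>i\<in>I. ennreal (c i) * emeasure (M i) (S n)) = (\<Sum>i\<in>I. \<Sum>n. ennreal (c i) * emeasure (M i) (S n))"
      by (rule suminf_sum) simp
    also have "\<dots> = (\<Sum>i\<in>I. ennreal (c i) * emeasure (M i) (\<Union> (range S)))"
      using S assms(1) by (intro sum.cong refl) (simp add: suminf_emeasure)
    finally show "(\<Sum>n. \<Sum>i\<in>I. ennreal (c i) * emeasure (M i) (S n)) =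
        (\<Sum>i\<in>I. ennreal (c i) * emeasure (M i) (\<Union> (range S)))" .
  qed
qed (fact A)

section \<open>Isometries and markings on the circle\<close>

lemma Disc_Group_mult:
  assumes "f \<in> carrier Disc_Group" "g \<in> carrier Disc_Group" "cmod x \<le> 1"
  shows "(f \<otimes>\<^bsub>Disc_Group\<^esub> g) x = f (g x)"
  using assms by (simp add: BijGroup_def compose_def)

lemma Disc_Group_mem: "f \<in> carrier Disc_Group \<Longrightarrow> cmod x \<le> 1 \<Longrightarrow> cmod (f x) \<le> 1"
  by (auto simp: BijGroup_def Bij_def bij_betw_def)

lemma Disc_Group_inv:
  assumes "f \<in> carrier Disc_Group" "cmod x \<le> 1"
  shows "(inv\<^bsub>Disc_Group\<^esub> f) (f x) = x" "f ((inv\<^bsub>Disc_Group\<^esub> f) x) = x"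
proof -
  interpret group Disc_Group by (rule group_BijGroup)
  have "(inv\<^bsub>Disc_Group\<^esub> f \<otimes>\<^bsub>Disc_Group\<^esub> f) x = x" "(f \<otimes>\<^bsub>Disc_Group\<^esub> inv\<^bsub>Disc_Group\<^esub> f) x = x"
    using assms by (simp_all add: l_inv r_inv) (simp_all add: BijGroup_def)
  then show "(inv\<^bsub>Disc_Group\<^esub> f) (f x) = x" "f ((inv\<^bsub>Disc_Group\<^esub> f) x) = x"
    unfolding Disc_Group_mult[OF inv_closed[OF assms(1)] assms] Disc_Group_mult[OF assms(1) inv_closed[OF assms(1)] assms(2)] .
qed

text \<open>By \<open>norm_Moebius\<close> a point of the closed disc goes to the circle exactly if
  it lies there, so bijectivity restricts from the closed disc to the circle.\<close>

lemma isometry_circle_homeo: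
  assumes "g \<in> disc_isometries" "g \<in> carrier Disc_Group"
  shows "circle_homeo g"
proof -
  obtain w t where w: "cmod w < 1" and g: "\<forall>z. cmod z \<le> 1 \<longrightarrow> g z = Moebius_function t w z"
    using disc_isometriesE[OF assms(1)] .
  have b: "bij_betw g (cball 0 1) (cball 0 1)"
    using assms(2) by (simp add: BijGroup_def Bij_def)
  have iff: "cmod (g z) = 1 \<longleftrightarrow> cmod z = 1" if "cmod z \<le> 1" for z
  proof
    assume "cmod (g z) = 1"
    then have "(1 - (cmod z)\<^sup>2) * (1 - (cmod w)\<^sup>2) = 0"
      using norm_Moebius[OF w that, of t] Moebius_denom_nonzero[OF w that] g that by simp
    moreover have "(cmod w)\<^sup>2 \<noteq> 1" using w power_less_one_iff[of "cmod w" 2] by simp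
    ultimately have "(cmod z)\<^sup>2 = 1" by simp
    then show "cmod z = 1" by (simp add: power2_eq_1_iff) (smt (verit) norm_ge_zero)
  qed (use isometry_mem[OF assms(1)] in blast)
  have "inj_on g (sphere 0 1)"
    using b by (auto simp: bij_betw_def intro: inj_on_subset)
  moreover have "g ` sphere 0 1 = sphere 0 1"
  proof (intro equalityI subsetI)
    fix y :: complex assume y: "y \<in> sphere 0 1"
    then have "y \<in> g ` cball 0 1" using b by (auto simp: bij_betw_def)
    then show "y \<in> g ` sphere 0 1" using iff y by auto
  qed (use iff in auto)
  moreover have "continuous_on (sphere 0 1) (Moebius_function t w)"
    unfolding Moebius_function_def using Moebius_denom_nonzero[OF w]
    by (intro continuous_intros) auto
  then have "continuous_on (sphere 0 1) g"
    using g by (subst continuous_on_cong[of _ _ _ "Moebius_function t w"]) auto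
  ultimately show ?thesis by (simp add: circle_homeo_def bij_betw_def)
qed

lemma marked_surface_circle_homeo:
  assumes "F \<in> marked_surfaces H"
  shows "circle_homeo F" "circle_homeo (inv\<^bsub>Disc_Group\<^esub> F)"
proof -
  let ?G = "inv\<^bsub>Disc_Group\<^esub> F"
  have F: "F \<in> carrier Disc_Group" "F ` ball 0 1 = ball 0 1" "homeomorphism (cball 0 1) (cball 0 1) F ?G"
    using assms unfolding marked_surfaces_def by auto
  have b: "bij_betw F (cball 0 1) (cball 0 1)"
    using F(1) by (simp add: BijGroup_def Bij_def)
  have s: "sphere (0::complex) 1 = cball 0 1 - ball 0 1" by auto
  have "F ` sphere 0 1 = sphere 0 1"
    using inj_on_image_set_diff[of F "cball 0 1" "cball 0 1" "ball 0 1"] b F(2)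
    unfolding s by (simp add: bij_betw_def)
  then have bs: "bij_betw F (sphere 0 1) (sphere 0 1)"
    using b by (auto simp: bij_betw_def intro: inj_on_subset)
  have "continuous_on (cball 0 1) F" "continuous_on (cball 0 1) ?G"
    using F(3) by (auto simp: homeomorphism_def)
  then have c: "continuous_on (sphere 0 1) F" "continuous_on (sphere 0 1) ?G"
    by (auto intro: continuous_on_subset)
  show "circle_homeo F" using bs c by (simp add: circle_homeo_def)
  have "bij_betw ?G (sphere 0 1) (sphere 0 1)"
  proof (rule bij_betw_byWitness[where f' = F])
    show "\<forall>a\<in>sphere 0 1. F (?G a) = a" "\<forall>a\<in>sphere 0 1. ?G (F a) = a"
      using Disc_Group_inv[OF F(1)] by auto
    show "F ` sphere 0 1 \<subseteq> sphere 0 1" using bs by (simp add: bij_betw_def)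
    show "?G ` sphere 0 1 \<subseteq> sphere 0 1"
    proof
      fix y assume "y \<in> ?G ` sphere 0 1"
      then have "y \<in> ?G ` F ` sphere 0 1" using bs by (simp add: bij_betw_def)
      then obtain z where "z \<in> sphere 0 1" "y = ?G (F z)" by blast
      then show "y \<in> sphere 0 1" using Disc_Group_inv(1)[OF F(1), of z] by simp
    qed
  qed
  then show "circle_homeo ?G" using c by (simp add: circle_homeo_def)
qed

lemma closed_surface_groupD:
  assumes "closed_surface_group \<Gamma>"
  shows "subgroup \<Gamma> Disc_Group" "\<Gamma> \<subseteq> disc_isometries"
    "\<exists>K. compact K \<and> K \<subseteq> ball 0 1 \<and> (\<Union>g\<in>\<Gamma>. g ` K) = ball 0 1"
proof -
  note D = assms[unfolded closed_surface_group_def]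
  show "subgroup \<Gamma> Disc_Group" by (rule conjunct1[OF D])
  show "\<Gamma> \<subseteq> disc_isometries" by (rule conjunct1[OF conjunct2[OF D]])
  show "\<exists>K. compact K \<and> K \<subseteq> ball 0 1 \<and> (\<Union>g\<in>\<Gamma>. g ` K) = ball 0 1"
    by (rule conjunct2[OF conjunct2[OF conjunct2[OF conjunct2[OF D]]]])
qed

text \<open>The marking intertwines \<open>h\<close> with its conjugate, an isometry, which is the
  equivariance of \<open>half_crr_bounds\<close>. Cocompactness of \<open>H\<close> is pulled back
  by the inverse marking from the compact set of the marked surface, without counting cosets in a
  larger group.\<close>

lemma marked_surface_half_crr_bounds:
  assumes H: "subgroup H Disc_Group" "H \<subseteq> disc_isometries" and F: "F \<in> marked_surfaces H"
  obtains \<kappa> where "0 < \<kappa>" "\<kappa> < 1"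
    "\<And>p q r s. cyclic4 p q r s \<Longrightarrow> crr p q r s = 1 / 2 \<Longrightarrow>
       \<kappa> \<le> crr (F p) (F q) (F r) (F s) \<and> crr (F p) (F q) (F r) (F s) \<le> 1 - \<kappa>"
proof -
  let ?G = "inv\<^bsub>Disc_Group\<^esub> F"
  let ?\<Delta> = "(\<lambda>h. F \<otimes>\<^bsub>Disc_Group\<^esub> h \<otimes>\<^bsub>Disc_Group\<^esub> ?G) ` H"
  interpret group Disc_Group by (rule group_BijGroup)
  have Fc: "F \<in> carrier Disc_Group" "F ` ball 0 1 = ball 0 1" "homeomorphism (cball 0 1) (cball 0 1) F ?G"
    "closed_surface_group ?\<Delta>"
    using F unfolding marked_surfaces_def by auto
  have Hc: "h \<in> carrier Disc_Group" if "h \<in> H" for h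
    using H(1) that subgroup.mem_carrier by metis
  have conj: "(F \<otimes>\<^bsub>Disc_Group\<^esub> h \<otimes>\<^bsub>Disc_Group\<^esub> ?G) x = F (h (?G x))" if "h \<in> H" "cmod x \<le> 1" for h x
  proof -
    have "cmod (?G x) \<le> 1" using Disc_Group_mem[OF inv_closed[OF Fc(1)] that(2)] .
    then show ?thesis
      using Disc_Group_mult Fc(1) Hc[OF that(1)] that(2) by (simp add: m_closed inv_closed)
  qed
  note \<Delta> = closed_surface_groupD(2,3)[OF Fc(4)]
  have "\<exists>g\<in>disc_isometries. \<forall>x\<in>sphere 0 1. F (h x) = g (F x)" if h: "h \<in> H" for h
  proof (intro bexI ballI)
    show "F \<otimes>\<^bsub>Disc_Group\<^esub> h \<otimes>\<^bsub>Disc_Group\<^esub> ?G \<in> disc_isometries"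
      using \<Delta>(1) imageI[OF h] by (rule subsetD)
    fix x :: complex assume "x \<in> sphere 0 1"
    then have x: "cmod x \<le> 1" by simp
    show "F (h x) = (F \<otimes>\<^bsub>Disc_Group\<^esub> h \<otimes>\<^bsub>Disc_Group\<^esub> ?G) (F x)"
      using conj[OF h Disc_Group_mem[OF Fc(1) x]] Disc_Group_inv(1)[OF Fc(1) x] by simp
  qed
  moreover have "cocompact H"
  proof -
    obtain K where K: "compact K" "K \<subseteq> ball 0 1" "(\<Union>g\<in>?\<Delta>. g ` K) = ball 0 1"
      using \<Delta>(2) by metis
    have "\<exists>h\<in>H. h z \<in> ?G ` K" if z: "z \<in> ball 0 1" for z
    proof -
      have "F z \<in> (\<Union>g\<in>?\<Delta>. g ` K)" unfolding K(3) using Fc(2) imageI[OF z, of F] by simp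
      then obtain h k where hk: "h \<in> H" "k \<in> K" "F z = (F \<otimes>\<^bsub>Disc_Group\<^esub> h \<otimes>\<^bsub>Disc_Group\<^esub> ?G) k"
        by blast
      have k1: "cmod k \<le> 1" using K(2) hk(2) by auto
      have G1: "cmod (?G k) \<le> 1" using Disc_Group_mem[OF inv_closed[OF Fc(1)] k1] .
      have "F z = F (h (?G k))" using conj[OF hk(1) k1] hk(3) by simp
      then have "?G (F z) = ?G (F (h (?G k)))" by simp
      then have "z = h (?G k)"
        using Disc_Group_inv(1)[OF Fc(1)] Disc_Group_mem[OF Hc[OF hk(1)] G1] z by simp
      then have "(inv\<^bsub>Disc_Group\<^esub> h) z = ?G k"
        using Disc_Group_inv(1)[OF Hc[OF hk(1)] G1] by simp
      moreover have "inv\<^bsub>Disc_Group\<^esub> h \<in> H" using subgroup.m_inv_closed[OF H(1) hk(1)] .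
      ultimately show ?thesis using hk(2) by blast
    qed
    moreover have "compact (?G ` K)"
    proof (rule compact_continuous_image[OF _ K(1)])
      have "continuous_on (cball 0 1) ?G" using Fc(3) by (simp add: homeomorphism_def)
      then show "continuous_on K ?G" by (rule continuous_on_subset) (use K(2) in auto)
    qed
    moreover have "?G ` K \<subseteq> ball 0 1"
    proof
      fix y assume "y \<in> ?G ` K"
      then obtain k where k: "k \<in> K" "y = ?G k" by blast
      then have "k \<in> F ` ball 0 1" using K(2) Fc(2) by blast
      then obtain z where "z \<in> ball 0 1" "k = F z" by blast
      then show "y \<in> ball 0 1" using k Disc_Group_inv(1)[OF Fc(1), of z] by simp
    qed
    ultimately show ?thesis unfolding cocompact_def by blast
  qed
  ultimately show thesis
    using half_crr_bounds[OF marked_surface_circle_homeo(1)[OF F] H(2)] that by blast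
qed


text \<open>Put \<open>u = (1 - \<kappa>) ^ n\<close>. The two entries of the minimum defining
  \<open>\<eta>\<close> give \<open>1 - \<kappa> \<le> \<kappa>^\<eta>\<close> and
  \<open>\<eta> / \<kappa> \<le> 1 - \<kappa>\<close>, so the first summand is at least
  \<open>\<eta> / \<kappa> * u\<close>. Since \<open>0 < n\<close>, \<open>1 - u\<close> is at least
  \<open>\<kappa>\<close>, and the second summand is at least
  \<open>1 - \<eta> / \<kappa> * u\<close>.\<close>

lemma exp_distortion_bound:
  fixes \<kappa> :: real
  assumes \<kappa>: "0 < \<kappa>" "\<kappa> < 1"
  obtains \<eta> where "0 < \<eta>"
    "\<And>n. 0 < n \<Longrightarrow> 1 \<le> exp (\<eta> * ln (\<kappa> ^ Suc n)) + exp (\<eta> * ln (1 - (1 - \<kappa>) ^ n))"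
proof -
  have l: "ln \<kappa> < 0" using \<kappa> by simp
  define \<eta> where "\<eta> = min (\<kappa> / - ln \<kappa>) (\<kappa> * (1 - \<kappa>))"
  have \<eta>: "0 < \<eta>" using \<kappa> l by (auto simp: \<eta>_def divide_pos_neg)
  have "\<eta> * - ln \<kappa> \<le> \<kappa> / - ln \<kappa> * - ln \<kappa>"
    using l by (intro mult_right_mono) (auto simp: \<eta>_def)
  also have "\<dots> = \<kappa>" using l by simp
  finally have e: "1 - \<kappa> \<le> exp (\<eta> * ln \<kappa>)"
    using exp_ge_add_one_self[of "\<eta> * ln \<kappa>"] unfolding mult_minus_right by linarith
  have "\<eta> / \<kappa> \<le> 1 - \<kappa>"
    using \<kappa> by (simp add: divide_le_eq mult.commute) (simp add: \<eta>_def)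
  with e have e': "\<eta> / \<kappa> \<le> exp (\<eta> * ln \<kappa>)" by simp
  have "1 \<le> exp (\<eta> * ln (\<kappa> ^ Suc n)) + exp (\<eta> * ln (1 - (1 - \<kappa>) ^ n))" if n: "0 < n" for n
  proof -
    define u where "u = (1 - \<kappa>) ^ n"
    have u0: "0 \<le> u" using \<kappa> by (simp add: u_def)
    have "u \<le> (1 - \<kappa>) ^ 1" unfolding u_def using \<kappa> n by (intro power_decreasing) auto
    then have u: "\<kappa> \<le> 1 - u" by simp
    have "exp (\<eta> * ln (\<kappa> ^ Suc n)) = exp (\<eta> * ln \<kappa>) * exp (\<eta> * ln \<kappa>) ^ n"
      using \<kappa> by (simp add: ln_realpow ln_mult distrib_left exp_add mult.left_commute[of \<eta>] flip: exp_of_nat_mult)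
    also have "\<dots> \<ge> \<eta> / \<kappa> * (1 - \<kappa>) ^ n"
      using e e' \<kappa> \<eta> by (intro mult_mono power_mono) auto
    finally have 1: "\<eta> / \<kappa> * u \<le> exp (\<eta> * ln (\<kappa> ^ Suc n))" by (simp add: u_def)
    have "- ln (1 - u) \<le> 1 / (1 - u) - 1"
      using ln_le_minus_one[of "1 / (1 - u)"] u \<kappa> by (simp add: ln_div)
    also have "\<dots> = u / (1 - u)" using u \<kappa> by (simp add: field_simps)
    also have "\<dots> \<le> u / \<kappa>" using u \<kappa> u0 by (intro divide_left_mono) auto
    finally have "\<eta> * - ln (1 - u) \<le> \<eta> * (u / \<kappa>)" using \<eta> by (intro mult_left_mono) auto
    also have "\<eta> * (u / \<kappa>) = \<eta> / \<kappa> * u" by simp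
    finally have "1 - \<eta> / \<kappa> * u \<le> exp (\<eta> * ln (1 - u))"
      using exp_ge_add_one_self[of "\<eta> * ln (1 - u)"] unfolding mult_minus_right by linarith
    with 1 show ?thesis by (simp add: u_def)
  qed
  with \<eta> show thesis using that by blast
qed

lemma half_power_bracket:
  fixes X :: real
  assumes "0 < X" "X \<le> 1 / 2"
  obtains n where "0 < n" "X \<le> (1 / 2) ^ n" "(1 / 2) ^ Suc n \<le> X"
proof -
  obtain m :: nat where "(1 / 2) ^ m < X" using real_arch_pow_inv[OF assms(1), of "1 / 2"] by auto
  define k where "k = (LEAST m. (1 / 2 :: real) ^ m < X)"
  have k: "(1 / 2) ^ k < X" unfolding k_def by (rule LeastI) fact
  have least: "X \<le> (1 / 2) ^ j" if "j < k" for j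
    using not_less_Least[of j "\<lambda>m. (1 / 2 :: real) ^ m < X"] that by (simp add: k_def)
  \<comment> \<open>The bound \<open>X \<le> 1 / 2\<close> excludes \<open>k = 1\<close> as well, so
    that \<open>n = k - 1\<close> is positive.\<close>
  have "k \<noteq> 0" "k \<noteq> 1" by (rule notI; use k assms in simp)+
  then obtain n where "k = Suc n" "0 < n" by (metis One_nat_def not0_implies_Suc gr0I)
  then show thesis using that[of n] k least[of n] by simp
qed

text \<open>Averaging the sharp inequalities for the individual Liouville currents fails, because one current
  may see a long box where another sees a short one. The common distortion bound \<open>\<kappa>\<close> excludes this.\<close>

lemma weighted_crr_bound:
  assumes J: "finite J" and w: "\<And>j. j \<in> J \<Longrightarrow> 0 \<le> w j" and \<kappa>: "0 < \<kappa>" "\<kappa> < 1"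
    and cyc: "\<And>j p q r s. j \<in> J \<Longrightarrow> cyclic4 p q r s \<Longrightarrow> cyclic4 (f j p) (f j q) (f j r) (f j s)"
    and upper: "\<And>j p q r s n. j \<in> J \<Longrightarrow> cyclic4 p q r s \<Longrightarrow> crr p q r s \<le> (1 / 2) ^ n \<Longrightarrow>
      crr (f j p) (f j q) (f j r) (f j s) \<le> (1 - \<kappa>) ^ n"
    and lower: "\<And>j p q r s n. j \<in> J \<Longrightarrow> cyclic4 p q r s \<Longrightarrow> (1 / 2) ^ n \<le> crr p q r s \<Longrightarrow>
      \<kappa> ^ n \<le> crr (f j p) (f j q) (f j r) (f j s)"
  shows "\<exists>\<epsilon>>0. \<forall>p q r s. cyclic4 p q r s \<longrightarrow>
      1 \<le> exp (- \<epsilon> * (\<Sum>j\<in>J. w j * - ln (crr (f j p) (f j q) (f j r) (f j s))))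
        + exp (- \<epsilon> * (\<Sum>j\<in>J. w j * - ln (crr (f j q) (f j r) (f j s) (f j p))))"
proof -
  obtain \<eta> where \<eta>: "0 < \<eta>"
    "\<And>n. 0 < n \<Longrightarrow> 1 \<le> exp (\<eta> * ln (\<kappa> ^ Suc n)) + exp (\<eta> * ln (1 - (1 - \<kappa>) ^ n))"
    using exp_distortion_bound[OF \<kappa>] by metis
  define W where "W = sum w J"
  have W: "0 \<le> W" unfolding W_def using w by (rule sum_nonneg)
  \<comment> \<open>The product of \<open>\<epsilon>\<close> with the total weight \<open>W\<close>
    is at most \<open>\<eta>\<close>; adding 1 also covers \<open>W = 0\<close>.\<close>
  define \<epsilon> where "\<epsilon> = \<eta> / (W + 1)"
  have \<epsilon>: "0 < \<epsilon>" using \<eta>(1) W by (simp add: \<epsilon>_def)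
  have weight: "exp (\<eta> * ln c) \<le> exp (- \<epsilon> * (\<Sum>j\<in>J. w j * - ln (x j)))"
    if "0 < c" "c \<le> 1" "\<And>j. j \<in> J \<Longrightarrow> c \<le> x j" for c and x :: "'a \<Rightarrow> real"
  proof -
    have "(\<Sum>j\<in>J. w j * - ln (x j)) \<le> (\<Sum>j\<in>J. w j * - ln c)"
    proof (intro sum_mono mult_left_mono w)
      fix j assume "j \<in> J"
      then have "0 < x j" "c \<le> x j" using that(1) that(3)[of j] by auto
      then show "- ln (x j) \<le> - ln c" using that(1) by simp
    qed
    also have "\<dots> = W * - ln c" by (simp add: W_def sum_distrib_right sum_negf)
    finally have "\<epsilon> * (\<Sum>j\<in>J. w j * - ln (x j)) \<le> \<epsilon> * (W * - ln c)"
      using \<epsilon> by (intro mult_left_mono) auto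
    also have "\<epsilon> * (W * - ln c) = \<eta> * (W / (W + 1)) * - ln c" by (simp add: \<epsilon>_def)
    also have "\<dots> \<le> \<eta> * 1 * - ln c"
      using \<eta>(1) W that(1,2) by (intro mult_right_mono mult_left_mono) auto
    finally show ?thesis by simp
  qed
  have main: "1 \<le> exp (- \<epsilon> * (\<Sum>j\<in>J. w j * - ln (crr (f j p) (f j q) (f j r) (f j s))))
        + exp (- \<epsilon> * (\<Sum>j\<in>J. w j * - ln (crr (f j q) (f j r) (f j s) (f j p))))"
    if c: "cyclic4 p q r s" and le: "crr p q r s \<le> 1 / 2" for p q r s
  proof -
    obtain n where n: "0 < n" "crr p q r s \<le> (1 / 2) ^ n" "(1 / 2) ^ Suc n \<le> crr p q r s"
      using half_power_bracket[OF crr_bounds(1)[OF c] le] .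
    have u: "(1 - \<kappa>) ^ n < 1" "0 \<le> (1 - \<kappa>) ^ n"
      using \<kappa> n(1) by (auto simp: power_less_one_iff)
    have "exp (\<eta> * ln (\<kappa> ^ Suc n)) \<le> exp (- \<epsilon> * (\<Sum>j\<in>J. w j * - ln (crr (f j p) (f j q) (f j r) (f j s))))"
      using \<kappa> lower[OF _ c n(3)] by (intro weight zero_less_power power_le_one) auto
    moreover have "exp (\<eta> * ln (1 - (1 - \<kappa>) ^ n)) \<le>
        exp (- \<epsilon> * (\<Sum>j\<in>J. w j * - ln (crr (f j q) (f j r) (f j s) (f j p))))"
    proof (rule weight)
      fix j assume j: "j \<in> J"
      show "1 - (1 - \<kappa>) ^ n \<le> crr (f j q) (f j r) (f j s) (f j p)"
        using upper[OF j c n(2)] crr_add[OF cyc[OF j c]] by simp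
    qed (use u in auto)
    ultimately show ?thesis using \<eta>(2)[OF n(1)] by linarith
  qed
  show ?thesis
  proof (intro exI[of _ \<epsilon>] conjI allI impI \<epsilon>)
    fix p q r s assume c: "cyclic4 p q r s"
    show "1 \<le> exp (- \<epsilon> * (\<Sum>j\<in>J. w j * - ln (crr (f j p) (f j q) (f j r) (f j s))))
        + exp (- \<epsilon> * (\<Sum>j\<in>J. w j * - ln (crr (f j q) (f j r) (f j s) (f j p))))"
    proof (cases "crr p q r s \<le> 1 / 2")
      case True
      then show ?thesis using main c by blast
    next
      case False
      \<comment> \<open>The roles of the two boxes are exchanged by a rotation;
        \<open>crr_rotate2\<close> brings back the original sums.\<close>
      then have "crr q r s p \<le> 1 / 2" using crr_add[OF c] by simp
      from main[OF cyclic4_rotate[OF c] this] show ?thesis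
        by (simp only: crr_rotate2 add.commute)
    qed
  qed
qed

section \<open>Estimate for the transferred combination\<close>

theorem theorem2:
  fixes \<Gamma> :: "(complex \<Rightarrow> complex) set" and \<mu> :: "complex uprod measure"
  assumes "closed_surface_group \<Gamma>"
    and "\<mu> \<in> geodesic_currents \<Gamma>"
    and "\<mu> \<in> RTeich_inf \<Gamma>"
  shows "strongly_hyperbolic_current \<mu>"
proof -
  obtain H T L and k :: nat and c F where \<mu>: "\<mu> = transfer_map T (combination {..<k} c (\<lambda>i. pullback_measure L (F i)))"
    and HT: "subgroup H Disc_Group" "H \<subseteq> \<Gamma>" "is_transversal \<Gamma> H T" "is_liouville_measure L"
    and cF: "\<forall>i<k. 0 \<le> c i \<and> F i \<in> marked_surfaces H"
    using assms(3) unfolding RTeich_inf_def by blast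
  have \<Gamma>: "subgroup \<Gamma> Disc_Group" "\<Gamma> \<subseteq> disc_isometries"
    using closed_surface_groupD[OF assms(1)] by blast+
  have T: "finite T" "T \<subseteq> \<Gamma>" using HT(3) unfolding is_transversal_def by auto
  have setsL: "sets L = sets geodesic_borel" "space L = geodesics"
    using HT(4) unfolding is_liouville_measure_def by auto
  interpret group Disc_Group by (rule group_BijGroup)
  define \<tau> where "\<tau> t = inv\<^bsub>Disc_Group\<^esub> t" for t
  have carrier: "t \<in> carrier Disc_Group" if "t \<in> \<Gamma>" for t
    using subgroup.mem_carrier[OF \<Gamma>(1) that] .
  have \<tau>: "\<tau> t \<in> \<Gamma>" if "t \<in> T" for t
    unfolding \<tau>_def using subgroup.m_inv_closed[OF \<Gamma>(1)] T(2) that by blast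
  have homeo: "circle_homeo t" if "t \<in> \<Gamma>" for t
    using isometry_circle_homeo \<Gamma>(2) carrier that by blast
  have Fhomeo: "circle_homeo (F i)" "circle_homeo (inv\<^bsub>Disc_Group\<^esub> (F i))" if "i < k" for i
    using marked_surface_circle_homeo cF that by blast+
  have Fcarrier: "F i \<in> carrier Disc_Group" if "i < k" for i
    using cF that unfolding marked_surfaces_def by blast

  \<comment> \<open>Pushing the pullback by \<open>F i\<close> forward along \<open>t\<close>
    amounts to pulling \<open>L\<close> back along \<open>F i \<circ> \<tau> t\<close>. The
    transferred current is thus a weighted combination indexed by the pairs
    \<open>(t, i)\<close>.\<close>
  define f where "f = (\<lambda>(t, i). F i \<circ> \<tau> t)"
  define w where "w = (\<lambda>(t::complex \<Rightarrow> complex, i). 1 / real (card T) * c i)"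
  define J where "J = T \<times> {..<k}"
  have J: "finite J" using T by (simp add: J_def)
  have w: "0 \<le> w j" if "j \<in> J" for j using that cF by (auto simp: w_def J_def)
  have fhomeo: "circle_homeo (f j)" if "j \<in> J" for j
    using that circle_homeo_compose Fhomeo homeo \<tau> by (auto simp: f_def J_def)

  have "\<exists>\<kappa>. 0 < \<kappa> \<and> \<kappa> < 1 \<and> (\<forall>p q r s. cyclic4 p q r s \<longrightarrow> crr p q r s = 1 / 2 \<longrightarrow>
       \<kappa> \<le> crr (F i p) (F i q) (F i r) (F i s) \<and> crr (F i p) (F i q) (F i r) (F i s) \<le> 1 - \<kappa>)"
    if i: "i < k" for i
  proof -
    have "H \<subseteq> disc_isometries" "F i \<in> marked_surfaces H" using HT(2) \<Gamma>(2) cF i by auto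
    from marked_surface_half_crr_bounds[OF HT(1) this] show ?thesis by metis
  qed
  then obtain K where K: "\<And>i. i < k \<Longrightarrow> 0 < K i \<and> K i < 1 \<and> (\<forall>p q r s. cyclic4 p q r s \<longrightarrow> crr p q r s = 1 / 2 \<longrightarrow>
       K i \<le> crr (F i p) (F i q) (F i r) (F i s) \<and> crr (F i p) (F i q) (F i r) (F i s) \<le> 1 - K i)"
    by metis
  \<comment> \<open>One constant for all markings; the entry 1/2 keeps the set nonempty if
    \<open>k = 0\<close>.\<close>
  define \<kappa> where "\<kappa> = Min (insert (1 / 2) (K ` {..<k}))"
  have "\<kappa> \<in> insert (1 / 2) (K ` {..<k})" unfolding \<kappa>_def by (intro Min_in) auto
  then have \<kappa>: "0 < \<kappa>" "\<kappa> < 1" using K by auto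
  have \<kappa>K: "\<kappa> \<le> K i" if "i < k" for i unfolding \<kappa>_def using that by (intro Min_le) auto
  have half: "\<kappa> \<le> crr (F i p) (F i q) (F i r) (F i s) \<and> crr (F i p) (F i q) (F i r) (F i s) \<le> 1 - \<kappa>"
    if "i < k" "cyclic4 p q r s" "crr p q r s = 1 / 2" for i p q r s
    using K[OF that(1)] that(2,3) \<kappa>K[OF that(1)] by fastforce

  \<comment> \<open>Isometries preserve cross-ratios, so the distortion bounds for
    \<open>F i\<close> hold for \<open>F i \<circ> \<tau> t\<close> with the same constant.\<close>
  have iso: "crr (\<tau> t p) (\<tau> t q) (\<tau> t r) (\<tau> t s) = crr p q r s" "cyclic4 (\<tau> t p) (\<tau> t q) (\<tau> t r) (\<tau> t s)"
    if "t \<in> T" "cyclic4 p q r s" for t p q r s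
    using crr_isometry[of "\<tau> t" p q r s] circle_homeo_cyclic4[OF homeo[OF \<tau>[OF that(1)]] that(2)]
      \<tau>[OF that(1)] \<Gamma>(2) cyclic4_sphere[OF that(2)] by auto
  have upper: "crr (f j p) (f j q) (f j r) (f j s) \<le> (1 - \<kappa>) ^ n"
    if j: "j \<in> J" and c: "cyclic4 p q r s" "crr p q r s \<le> (1 / 2) ^ n" for j p q r s n
  proof -
    obtain t i where ti: "j = (t, i)" "t \<in> T" "i < k" using j by (auto simp: J_def)
    show ?thesis
      using crr_distortion_upper[OF Fhomeo(1)[OF ti(3)] \<kappa>, of "\<tau> t p" "\<tau> t q" "\<tau> t r" "\<tau> t s" n]
        half[OF ti(3)] iso[OF ti(2) c(1)] c(2) by (simp add: f_def ti(1))
  qed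
  have lower: "\<kappa> ^ n \<le> crr (f j p) (f j q) (f j r) (f j s)"
    if j: "j \<in> J" and c: "cyclic4 p q r s" "(1 / 2) ^ n \<le> crr p q r s" for j p q r s n
  proof -
    obtain t i where ti: "j = (t, i)" "t \<in> T" "i < k" using j by (auto simp: J_def)
    show ?thesis
      using crr_distortion_lower[OF Fhomeo(1)[OF ti(3)] \<kappa>, of "\<tau> t p" "\<tau> t q" "\<tau> t r" "\<tau> t s" n]
        half[OF ti(3)] iso[OF ti(2) c(1)] c(2) by (simp add: f_def ti(1))
  qed
  have fcyc: "cyclic4 (f j p) (f j q) (f j r) (f j s)" if "j \<in> J" "cyclic4 p q r s" for j p q r s
    using circle_homeo_cyclic4[OF fhomeo] that .
  have "\<exists>\<epsilon>>0. \<forall>p q r s. cyclic4 p q r s \<longrightarrow>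
      1 \<le> exp (- \<epsilon> * (\<Sum>j\<in>J. w j * - ln (crr (f j p) (f j q) (f j r) (f j s))))
        + exp (- \<epsilon> * (\<Sum>j\<in>J. w j * - ln (crr (f j q) (f j r) (f j s) (f j p))))"
    by (rule weighted_crr_bound[where \<kappa> = \<kappa>]) (fact J w \<kappa> fcyc upper lower)+
  then obtain \<epsilon> where \<epsilon>: "0 < \<epsilon>"
    "\<And>p q r s. cyclic4 p q r s \<Longrightarrow>
      1 \<le> exp (- \<epsilon> * (\<Sum>j\<in>J. w j * - ln (crr (f j p) (f j q) (f j r) (f j s))))
        + exp (- \<epsilon> * (\<Sum>j\<in>J. w j * - ln (crr (f j q) (f j r) (f j s) (f j p))))"
    by blast

  let ?\<nu> = "combination {..<k} c (\<lambda>i. pullback_measure L (F i))"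
  have bound: "emeasure \<mu> (separating p q r s) \<le> ennreal (\<Sum>j\<in>J. w j * - ln (crr (f j p) (f j q) (f j r) (f j s)))"
    if cyc: "cyclic4 p q r s" for p q r s
  proof -
    let ?S = "separating p q r s"
    define X where "X j = - ln (crr (f j p) (f j q) (f j r) (f j s))" for j
    have X0: "0 \<le> X j" if "j \<in> J" for j
      using crr_bounds[OF circle_homeo_cyclic4[OF fhomeo[OF that] cyc]] by (simp add: X_def)
    have piece: "emeasure (pullback_measure L (F i)) (map_uprod t -` ?S \<inter> geodesics) \<le> ennreal (X (t, i))"
      if ti: "t \<in> T" "i < k" for t i
    proof -
      let ?G = "inv\<^bsub>Disc_Group\<^esub> (F i)"
      have j: "(t, i) \<in> J" using ti by (simp add: J_def)
      have t: "t \<in> \<Gamma>" using ti T by blast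
      have mt: "map_uprod t -` ?S \<inter> geodesics \<in> sets geodesic_borel"
        using measurable_sets[OF circle_homeo_measurable[OF homeo[OF t]] separating_measurable] by simp
      have mG: "map_uprod ?G \<in> measurable L geodesic_borel"
        using circle_homeo_measurable[OF Fhomeo(2)[OF ti(2)]] setsL(1) measurable_cong_sets by blast
      have "emeasure (pullback_measure L (F i)) (map_uprod t -` ?S \<inter> geodesics) =
          emeasure L (map_uprod ?G -` (map_uprod t -` ?S \<inter> geodesics) \<inter> space L)"
        unfolding pullback_measure_def using mG mt by (rule emeasure_distr)
      also have "\<dots> \<le> emeasure L (separating (f (t, i) p) (f (t, i) q) (f (t, i) r) (f (t, i) s))"
      proof (rule emeasure_mono)
        show "separating (f (t, i) p) (f (t, i) q) (f (t, i) r) (f (t, i) s) \<in> sets L"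
          using separating_measurable setsL(1) by simp
        show "map_uprod ?G -` (map_uprod t -` ?S \<inter> geodesics) \<inter> space L \<subseteq>
            separating (f (t, i) p) (f (t, i) q) (f (t, i) r) (f (t, i) s)"
        proof
          fix e assume e: "e \<in> map_uprod ?G -` (map_uprod t -` ?S \<inter> geodesics) \<inter> space L"
          then obtain a b where ab: "e = Upair a b" "cmod a = 1" "cmod b = 1"
            using geodesicsE setsL(2) by (metis IntD2)
          \<comment> \<open>The composite of \<open>?G\<close> and \<open>t\<close> is inverted on
            the circle by \<open>f (t, i)\<close>, so a geodesic in the double preimage of
            \<open>?S\<close> lies in the box of the image points.\<close>
          have cancel: "f (t, i) (t (?G x)) = x" if x: "cmod x = 1" for x
          proof -
            have "cmod (?G x) \<le> 1" using circle_homeo_mem[OF Fhomeo(2)[OF ti(2)], of x] x by simp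
            then show ?thesis
              using Disc_Group_inv(1)[OF carrier[OF t]] Disc_Group_inv(2)[OF Fcarrier[OF ti(2)]] x
              by (simp add: f_def \<tau>_def)
          qed
          have "map_uprod (f (t, i)) (map_uprod t (map_uprod ?G e)) \<in>
              separating (f (t, i) p) (f (t, i) q) (f (t, i) r) (f (t, i) s)"
            using e cyclic4_sphere[OF cyc] by (intro circle_homeo_separating fhomeo j) auto
          then show "e \<in> separating (f (t, i) p) (f (t, i) q) (f (t, i) r) (f (t, i) s)"
            using ab cancel by simp
        qed
      qed
      also have "\<dots> \<le> ennreal (X (t, i))"
        unfolding X_def by (rule liouville_separating[OF HT(4) circle_homeo_cyclic4[OF fhomeo[OF j] cyc]])
      finally show ?thesis .
    qed
    have "emeasure \<mu> ?S = (\<Sum>t\<in>T. ennreal (1 / real (card T)) * emeasure (distr ?\<nu> geodesic_borel (map_uprod t)) ?S)"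
      unfolding \<mu> transfer_map_def by (rule emeasure_combination) (simp_all add: separating_measurable)
    also have "\<dots> \<le> (\<Sum>t\<in>T. ennreal (1 / real (card T)) * (\<Sum>i<k. ennreal (c i) * ennreal (X (t, i))))"
    proof (intro sum_mono mult_left_mono)
      fix t assume t: "t \<in> T"
      then have mt: "map_uprod t \<in> measurable geodesic_borel geodesic_borel"
        using circle_homeo_measurable homeo T(2) by blast
      then have mt': "map_uprod t \<in> measurable ?\<nu> geodesic_borel"
        using measurable_cong_sets[OF sets_combination refl] by blast
      have "emeasure (distr ?\<nu> geodesic_borel (map_uprod t)) ?S = emeasure ?\<nu> (map_uprod t -` ?S \<inter> geodesics)"
        using emeasure_distr[OF mt' separating_measurable] by simp
      also have "\<dots> = (\<Sum>i<k. ennreal (c i) * emeasure (pullback_measure L (F i)) (map_uprod t -` ?S \<inter> geodesics))"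
        using measurable_sets[OF mt separating_measurable]
        by (intro emeasure_combination) (simp_all add: pullback_measure_def)
      also have "\<dots> \<le> (\<Sum>i<k. ennreal (c i) * ennreal (X (t, i)))"
        using piece t by (intro sum_mono mult_left_mono) auto
      finally show "emeasure (distr ?\<nu> geodesic_borel (map_uprod t)) ?S \<le> (\<Sum>i<k. ennreal (c i) * ennreal (X (t, i)))" .
    qed auto
    also have "\<dots> = (\<Sum>t\<in>T. \<Sum>i<k. ennreal (w (t, i) * X (t, i)))"
      unfolding sum_distrib_left using cF X0
      by (intro sum.cong refl) (simp add: w_def J_def mult.assoc flip: ennreal_mult)
    also have "\<dots> = (\<Sum>j\<in>J. ennreal (w j * X j))"
      unfolding J_def by (simp add: sum.cartesian_product case_prod_beta)
    also have "\<dots> = ennreal (\<Sum>j\<in>J. w j * X j)"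
      using w X0 by (intro sum_ennreal) auto
    finally show ?thesis by (simp add: X_def)
  qed

  interpret finite_crossings \<mu>
  proof
    show "sets \<mu> = sets geodesic_borel" "space \<mu> = geodesics"
      using assms(2) unfolding geodesic_currents_def by auto
  qed (rule half_crossing_finite[OF assms(2)])
  show ?thesis
  proof (rule strongly_hyperbolic_criterion[OF \<epsilon>(1)], intro conjI)
    fix p q r s assume cyc: "cyclic4 p q r s"
    show "emeasure \<mu> (separating p q r s) < \<infinity>"
      using bound[OF cyc] by (simp add: order_le_less_trans)
    have le: "measure \<mu> (separating p q r s) \<le> (\<Sum>j\<in>J. w j * - ln (crr (f j p) (f j q) (f j r) (f j s)))"
      if cyc: "cyclic4 p q r s" for p q r s
    proof -
      have "0 \<le> (\<Sum>j\<in>J. w j * - ln (crr (f j p) (f j q) (f j r) (f j s)))"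
        using crr_bounds[OF circle_homeo_cyclic4[OF fhomeo cyc]]
        by (intro sum_nonneg mult_nonneg_nonneg w) (auto simp: less_imp_le)
      then show ?thesis
        unfolding measure_def using enn2real_mono[OF bound[OF cyc]] by simp
    qed
    have "exp (- \<epsilon> * (\<Sum>j\<in>J. w j * - ln (crr (f j p) (f j q) (f j r) (f j s)))) \<le> exp (- \<epsilon> * measure \<mu> (separating p q r s))"
      if cyc: "cyclic4 p q r s" for p q r s
      using le[OF cyc] \<epsilon>(1) by simp
    from this[OF cyc] this[OF cyclic4_rotate[OF cyc]]
    show "1 \<le> exp (- \<epsilon> * measure \<mu> (separating p q r s)) + exp (- \<epsilon> * measure \<mu> (separating q r s p))"
      using \<epsilon>(2)[OF cyc] by linarith
  qed
qed

end
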